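(* In the setting described in the context, on $M\times G^4\times\mathbb R$ define $$\pi^1:=\alpha-\big(t-\tfrac i2\,\mathrm{Im}\,Z^2\big)\rho-\big(R^1-\overline{K^6}\big)\kappa-R^2\zeta-K^6\bar\kappa,$$ $$\pi^2:=\beta-iZ^1\rho-\big(t-\tfrac i2\,\mathrm{Im}\,Z^2+K^1\big)\kappa-K^2\zeta-K^3\bar\kappa-K^4\bar\zeta .$$ Then $$d\rho=(\pi^1+\bar\pi^1)\wedge\rho+i\,\kappa\wedge\bar\kappa,\qquad d\kappa=\pi^2\wedge\rho+\pi^1\wedge\kappa+\zeta\wedge\bar\kappa,$$ $$d\zeta=(\pi^1-\bar\pi^1)\wedge\zeta+i\,\pi^2\wedge\kappa+R\,\rho\wedge\zeta+J\,\rho\wedge\bar\kappa+W\,\kappa\wedge\zeta,$$ where $W:=\frac1cW_0$, $J:=\frac{i}{\bar c^{3}}\overline{J_0}$, and $$R:=\mathrm{Re}\Big[i\,\frac{e}{c^2}W_0+\frac1{c\bar c}\Big(-\frac i2\overline{\mathcal L}_1(W_0)+\frac i2\Big(-\frac13\frac{\overline{\mathcal L}_1(\overline{\mathcal L}_1(k))}{\overline{\mathcal L}_1(k)}+\frac13\overline P\Big)W_0\Big)\Big].$$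
   Context: Let $M\subset\mathbb C^3$ be a real-analytic real hypersurface, considered locally near a point, represented in holomorphic coordinates $(z_1,z_2,w)$, $w=u+iv$, as a graph $u=F(z_1,z_2,\bar z_1,\bar z_2,v)$; $(z_1,z_2,\bar z_1,\bar z_2,v)$ are coordinates on $M$. Bars denote complex conjugation. Put $A^j:=-iF_{z_j}/(1+iF_v)$, $\mathcal L_j:=\partial_{z_j}+A^j\partial_v$ ($j=1,2$). Let $\ell:=i(\mathcal L_1(\overline{A^1})-\overline{\mathcal L}_1(A^1))$, assumed nowhere zero, and $\mathcal T:=\ell\,\partial_v$. Assume the Levi form has constant rank 1, let $k:=-(\mathcal L_2(\overline{A^1})-\overline{\mathcal L}_1(A^2))/(\mathcal L_1(\overline{A^1})-\overline{\mathcal L}_1(A^1))$, $\mathcal K:=k\mathcal L_1+\mathcal L_2$, and assume $\overline{\mathcal L}_1(k)$ vanishes nowhere (2-nondegeneracy). Let $P:=(\ell_{z_1}+A^1\ell_v-\ell A^1_v)/\ell$, $B_0:=\overline{\mathcal L}_1(\overline{\mathcal L}_1(k))/\overline{\mathcal L}_1(k)-\overline P$, $H_0:=-\tfrac16\tfrac{\overline{\mathcal L}_1(\overline{\mathcal L}_1(\overline{\mathcal L}_1(k)))}{\overline{\mathcal L}_1(k)}+\tfrac29\tfrac{\overline{\mathcal L}_1(\overline{\mathcal L}_1(k))^2}{\overline{\mathcal L}_1(k)^2}+\tfrac1{18}\tfrac{\overline{\mathcal L}_1(\overline{\mathcal L}_1(k))\overline P}{\overline{\mathcal L}_1(k)}+\tfrac16\overline{\mathcal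 L}_1(\overline P)-\tfrac19\overline P^{\,2}$, $W_0:=-\tfrac13\tfrac{\mathcal K(\overline{\mathcal L}_1(\overline{\mathcal L}_1(k)))}{\overline{\mathcal L}_1(k)^2}+\tfrac13\tfrac{\mathcal K(\overline{\mathcal L}_1(k))\,\overline{\mathcal L}_1(\overline{\mathcal L}_1(k))}{\overline{\mathcal L}_1(k)^3}+\tfrac23\tfrac{\mathcal L_1(\mathcal L_1(\bar k))}{\mathcal L_1(\bar k)}+\tfrac23\tfrac{\mathcal L_1(\overline{\mathcal L}_1(k))}{\overline{\mathcal L}_1(k)}+\tfrac i3\tfrac{\mathcal T(k)}{\overline{\mathcal L}_1(k)}$, and let $\overline{J_0}:=\tfrac43\tfrac{\overline{\mathcal L}_1(\overline{\mathcal L}_1(k))}{\overline{\mathcal L}_1(k)}H_0+\tfrac23\overline P H_0-\overline{\mathcal L}_1(H_0)$ (these are the primary invariants $W_0$, $J_0$ of Pocchiola). On $M$ let $\rho_0:=\ell^{-1}(dv-A^1dz_1-A^2dz_2-\overline{A^1}d\bar z_1-\overline{A^2}d\bar z_2)$, $\kappa_0':=dz_1-k\,dz_2+\tfrac i3B_0\rho_0$, $\zeta_0'':=\overline{\mathcal L}_1(k)\,dz_2+iH_0\rho_0$. Let $G^4:=\mathbb C^*\times\mathbb C$ with coordinates $(c,e)$; on $M\times G^4$ define $\rho:=c\bar c\,\rho_0$, $\kappa:=-i\bar c e\,\rho_0+c\,\kappa_0'$, $\zeta:=-\tfrac i2\tfrac{\bar c e^2}{c}\rho_0+e\,\kappa_0'+\tfrac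 c{\bar c}\zeta_0''$, $\alpha:=dc/c$, $\beta:=i\,e\,dc/c^2-i\,e\,d\bar c/(c\bar c)-i\,de/c$; $\{\rho,\kappa,\zeta,\bar\kappa,\bar\zeta,\alpha,\beta,\bar\alpha,\bar\beta\}$ is a coframe of $\mathbb C\otimes T(M\times G^4)$. With $\omega_1,\dots,\omega_{10}$ denoting $\rho\wedge\kappa,\rho\wedge\zeta,\rho\wedge\bar\kappa,\rho\wedge\bar\zeta,\kappa\wedge\zeta,\kappa\wedge\bar\kappa,\kappa\wedge\bar\zeta,\zeta\wedge\bar\kappa,\zeta\wedge\bar\zeta,\bar\kappa\wedge\bar\zeta$, let $R^j$, $K^j$, $Z^j$ be the coefficients of $\omega_j$ in the expansions of $d\rho$, $d\kappa$, $d\zeta$ respectively in the basis of 2-forms induced by this coframe. All objects are pulled back to $M\times G^4\times\mathbb R$, where $t$ denotes the real coordinate on the factor $\mathbb R$. *)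

theory Defs
  imports "HOL-Analysis.Analysis"
begin

text \<open>A point of M x G^4 x R (and a real tangent vector there) is represented by
  (z1, z2, v, c, e, t) with z1 z2 c e complex and v t real.  The hypersurface M is
  parametrised by (z1,z2,v) ranging in an open set U (its points are
  (z1, z2, F(z1,z2,v) + i v)).\<close>

type_synonym pt = "complex \<times> complex \<times> real \<times> complex \<times> complex \<times> real"
type_synonym form1 = "pt \<Rightarrow> pt \<Rightarrow> complex"
type_synonym form2 = "pt \<Rightarrow> pt \<Rightarrow> pt \<Rightarrow> complex"

definition pz1 :: "pt \<Rightarrow> complex" where "pz1 p = fst p"
definition pz2 :: "pt \<Rightarrow> complex" where "pz2 p = fst (snd p)"
definition pv :: "pt \<Rightarrow> real" where "pv p = fst (snd (snd p))"
definition pc :: "pt \<Rightarrow> complex" where "pc p = fst (snd (snd (snd p)))"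
definition pe :: "pt \<Rightarrow> complex" where "pe p = fst (snd (snd (snd (snd p))))"
definition ptt :: "pt \<Rightarrow> real" where "ptt p = snd (snd (snd (snd (snd p))))"

definition ex1 :: pt where "ex1 = (1, 0, 0, 0, 0, 0)"
definition ey1 :: pt where "ey1 = (\<i>, 0, 0, 0, 0, 0)"
definition ex2 :: pt where "ex2 = (0, 1, 0, 0, 0, 0)"
definition ey2 :: pt where "ey2 = (0, \<i>, 0, 0, 0, 0)"
definition evv :: pt where "evv = (0, 0, 1, 0, 0, 0)"

definition Dd :: "(pt \<Rightarrow> complex) \<Rightarrow> pt \<Rightarrow> pt \<Rightarrow> complex" where
  "Dd f p X = vector_derivative (\<lambda>s::real. f (p + s *\<^sub>R X)) (at 0)"

definition dZ1 :: "(pt \<Rightarrow> complex) \<Rightarrow> pt \<Rightarrow> complex" where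
  "dZ1 f p = (Dd f p ex1 - \<i> * Dd f p ey1) / 2"
definition dZ2 :: "(pt \<Rightarrow> complex) \<Rightarrow> pt \<Rightarrow> complex" where
  "dZ2 f p = (Dd f p ex2 - \<i> * Dd f p ey2) / 2"
definition dZb1 :: "(pt \<Rightarrow> complex) \<Rightarrow> pt \<Rightarrow> complex" where
  "dZb1 f p = (Dd f p ex1 + \<i> * Dd f p ey1) / 2"
definition dZb2 :: "(pt \<Rightarrow> complex) \<Rightarrow> pt \<Rightarrow> complex" where
  "dZb2 f p = (Dd f p ex2 + \<i> * Dd f p ey2) / 2"
definition dV :: "(pt \<Rightarrow> complex) \<Rightarrow> pt \<Rightarrow> complex" where
  "dV f p = Dd f p evv"

definition cf :: "(pt \<Rightarrow> complex) \<Rightarrow> pt \<Rightarrow> complex" where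
  "cf f p = cnj (f p)"

definition real_analytic_on ::
  "(complex \<times> complex \<times> real) set \<Rightarrow> (complex \<times> complex \<times> real \<Rightarrow> real) \<Rightarrow> bool" where
  "real_analytic_on U F \<longleftrightarrow>
     (\<forall>q\<in>U. \<exists>r>0. \<exists>a :: nat \<times> nat \<times> nat \<times> nat \<times> nat \<Rightarrow> real.
        \<forall>x\<in>ball q r.
          ((\<lambda>(i, j, k, l, m). a (i, j, k, l, m)
               * (Re (fst x) - Re (fst q)) ^ i * (Im (fst x) - Im (fst q)) ^ j
               * (Re (fst (snd x)) - Re (fst (snd q))) ^ k
               * (Im (fst (snd x)) - Im (fst (snd q))) ^ l
               * (snd (snd x) - snd (snd q)) ^ m) has_sum F x) UNIV)"

definition Fl :: "(complex \<times> complex \<times> real \<Rightarrow> real) \<Rightarrow> pt \<Rightarrow> complex" where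
  "Fl F p = complex_of_real (F (pz1 p, pz2 p, pv p))"

definition A1 :: "(complex \<times> complex \<times> real \<Rightarrow> real) \<Rightarrow> pt \<Rightarrow> complex" where
  "A1 F p = - \<i> * dZ1 (Fl F) p / (1 + \<i> * dV (Fl F) p)"
definition A2 :: "(complex \<times> complex \<times> real \<Rightarrow> real) \<Rightarrow> pt \<Rightarrow> complex" where
  "A2 F p = - \<i> * dZ2 (Fl F) p / (1 + \<i> * dV (Fl F) p)"

definition L1 where "L1 F f p = dZ1 f p + A1 F p * dV f p"
definition L2 where "L2 F f p = dZ2 f p + A2 F p * dV f p"
definition Lb1 where "Lb1 F f p = dZb1 f p + cnj (A1 F p) * dV f p"
definition Lb2 where "Lb2 F f p = dZb2 f p + cnj (A2 F p) * dV f p"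

text \<open>Levi matrix entries L_j(conj A^k) - conj-L_k(A^j) (up to the factor i).\<close>
definition levi11 where "levi11 F p = L1 F (cf (A1 F)) p - Lb1 F (A1 F) p"
definition levi12 where "levi12 F p = L1 F (cf (A2 F)) p - Lb2 F (A1 F) p"
definition levi21 where "levi21 F p = L2 F (cf (A1 F)) p - Lb1 F (A2 F) p"
definition levi22 where "levi22 F p = L2 F (cf (A2 F)) p - Lb2 F (A2 F) p"

definition levi_rank_one where
  "levi_rank_one F p \<longleftrightarrow>
     (levi11 F p \<noteq> 0 \<or> levi12 F p \<noteq> 0 \<or> levi21 F p \<noteq> 0 \<or> levi22 F p \<noteq> 0) \<and>
     levi11 F p * levi22 F p - levi12 F p * levi21 F p = 0"

definition ell where "ell F p = \<i> * (L1 F (cf (A1 F)) p - Lb1 F (A1 F) p)"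
definition TT where "TT F f p = ell F p * dV f p"
definition kk where
  "kk F p = - (L2 F (cf (A1 F)) p - Lb1 F (A2 F) p) / (L1 F (cf (A1 F)) p - Lb1 F (A1 F) p)"
definition KK where "KK F f p = kk F p * L1 F f p + L2 F f p"
definition PP where
  "PP F p = (dZ1 (ell F) p + A1 F p * dV (ell F) p - ell F p * dV (A1 F) p) / ell F p"

definition B0 where
  "B0 F p = Lb1 F (Lb1 F (kk F)) p / Lb1 F (kk F) p - cnj (PP F p)"

definition H0 where
  "H0 F p = - (1/6) * Lb1 F (Lb1 F (Lb1 F (kk F))) p / Lb1 F (kk F) p
     + (2/9) * (Lb1 F (Lb1 F (kk F)) p) ^ 2 / (Lb1 F (kk F) p) ^ 2
     + (1/18) * Lb1 F (Lb1 F (kk F)) p * cnj (PP F p) / Lb1 F (kk F) p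
     + (1/6) * Lb1 F (cf (PP F)) p
     - (1/9) * (cnj (PP F p)) ^ 2"

definition W0 where
  "W0 F p = - (1/3) * KK F (Lb1 F (Lb1 F (kk F))) p / (Lb1 F (kk F) p) ^ 2
     + (1/3) * KK F (Lb1 F (kk F)) p * Lb1 F (Lb1 F (kk F)) p / (Lb1 F (kk F) p) ^ 3
     + (2/3) * L1 F (L1 F (cf (kk F))) p / L1 F (cf (kk F)) p
     + (2/3) * L1 F (Lb1 F (kk F)) p / Lb1 F (kk F) p
     + (\<i>/3) * TT F (kk F) p / Lb1 F (kk F) p"

definition J0b where
  "J0b F p = (4/3) * Lb1 F (Lb1 F (kk F)) p / Lb1 F (kk F) p * H0 F p
     + (2/3) * cnj (PP F p) * H0 F p - Lb1 F (H0 F) p"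

definition cform :: "form1 \<Rightarrow> form1" where "cform \<theta> p X = cnj (\<theta> p X)"
definition wedge :: "form1 \<Rightarrow> form1 \<Rightarrow> form2" where
  "wedge \<theta> \<eta> p X Y = \<theta> p X * \<eta> p Y - \<theta> p Y * \<eta> p X"
text \<open>Exterior derivative of a 1-form, evaluated on constant (coordinate) vector fields.\<close>
definition dform :: "form1 \<Rightarrow> form2" where
  "dform \<theta> p X Y = Dd (\<lambda>q. \<theta> q Y) p X - Dd (\<lambda>q. \<theta> q X) p Y"

definition rho0 :: "_ \<Rightarrow> form1" where
  "rho0 F p X = (complex_of_real (pv X) - A1 F p * pz1 X - A2 F p * pz2 X
      - cnj (A1 F p) * cnj (pz1 X) - cnj (A2 F p) * cnj (pz2 X)) / ell F p"
definition kap0 :: "_ \<Rightarrow> form1" where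
  "kap0 F p X = pz1 X - kk F p * pz2 X + (\<i>/3) * B0 F p * rho0 F p X"
definition zet0 :: "_ \<Rightarrow> form1" where
  "zet0 F p X = Lb1 F (kk F) p * pz2 X + \<i> * H0 F p * rho0 F p X"

definition rho :: "_ \<Rightarrow> form1" where
  "rho F p X = pc p * cnj (pc p) * rho0 F p X"
definition kap :: "_ \<Rightarrow> form1" where
  "kap F p X = - \<i> * cnj (pc p) * pe p * rho0 F p X + pc p * kap0 F p X"
definition zet :: "_ \<Rightarrow> form1" where
  "zet F p X = - (\<i>/2) * (cnj (pc p) * (pe p) ^ 2 / pc p) * rho0 F p X
      + pe p * kap0 F p X + pc p / cnj (pc p) * zet0 F p X"
definition alph :: form1 where
  "alph p X = pc X / pc p"
definition bet :: form1 where
  "bet p X = \<i> * pe p * pc X / (pc p) ^ 2 - \<i> * pe p * cnj (pc X) / (pc p * cnj (pc p))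
      - \<i> * pe X / pc p"

definition coframe :: "_ \<Rightarrow> form1 list" where
  "coframe F = [rho F, kap F, zet F, cform (kap F), cform (zet F),
                alph, bet, cform alph, cform bet]"

text \<open>Coefficients of a 2-form in the basis of wedges of the coframe
  (the coframe lives on M x G^4; coefficients are computed there, i.e. on tangent
  vectors without t-component, and then pulled back).\<close>
definition coeff2 :: "_ \<Rightarrow> form2 \<Rightarrow> pt \<Rightarrow> nat \<Rightarrow> nat \<Rightarrow> complex" where
  "coeff2 F \<Omega> p = (THE c. (\<forall>x y. c x y \<noteq> 0 \<longrightarrow> x < y \<and> y < 9) \<and>
      (\<forall>X Y. ptt X = 0 \<longrightarrow> ptt Y = 0 \<longrightarrow>
         \<Omega> p X Y = (\<Sum>x<9. \<Sum>y<9. c x y * wedge (coframe F ! x) (coframe F ! y) p X Y)))"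

text \<open>omega_1..omega_10 = rho^kap, rho^zet, rho^kapb, rho^zetb, kap^zet, kap^kapb,
  kap^zetb, zet^kapb, zet^zetb, kapb^zetb (indices into the coframe).\<close>
definition omidx :: "nat \<Rightarrow> nat \<times> nat" where
  "omidx j = [(0,1),(0,2),(0,3),(0,4),(1,2),(1,3),(1,4),(2,3),(2,4),(3,4)] ! (j - 1)"

definition Rc where "Rc F j p = coeff2 F (dform (rho F)) p (fst (omidx j)) (snd (omidx j))"
definition Kc where "Kc F j p = coeff2 F (dform (kap F)) p (fst (omidx j)) (snd (omidx j))"
definition Zc where "Zc F j p = coeff2 F (dform (zet F)) p (fst (omidx j)) (snd (omidx j))"

definition pi1 :: "_ \<Rightarrow> form1" where
  "pi1 F p X = alph p X
     - (complex_of_real (ptt p) - (\<i>/2) * complex_of_real (Im (Zc F 2 p))) * rho F p X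
     - (Rc F 1 p - cnj (Kc F 6 p)) * kap F p X - Rc F 2 p * zet F p X
     - Kc F 6 p * cform (kap F) p X"

definition pi2 :: "_ \<Rightarrow> form1" where
  "pi2 F p X = bet p X - \<i> * Zc F 1 p * rho F p X
     - (complex_of_real (ptt p) - (\<i>/2) * complex_of_real (Im (Zc F 2 p)) + Kc F 1 p) * kap F p X
     - Kc F 2 p * zet F p X - Kc F 3 p * cform (kap F) p X - Kc F 4 p * cform (zet F) p X"

definition Wsc where "Wsc F p = W0 F p / pc p"
definition Jsc where "Jsc F p = \<i> / (cnj (pc p)) ^ 3 * J0b F p"
definition Rsc where
  "Rsc F p = complex_of_real (Re (\<i> * pe p / (pc p) ^ 2 * W0 F p
     + 1 / (pc p * cnj (pc p)) * (- (\<i>/2) * Lb1 F (W0 F) p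
         + (\<i>/2) * (- (1/3) * Lb1 F (Lb1 F (kk F)) p / Lb1 F (kk F) p + (1/3) * cnj (PP F p))
             * W0 F p)))"

definition fplus :: "form1 \<Rightarrow> form1 \<Rightarrow> form1" where "fplus \<theta> \<eta> p X = \<theta> p X + \<eta> p X"
definition fminus :: "form1 \<Rightarrow> form1 \<Rightarrow> form1" where "fminus \<theta> \<eta> p X = \<theta> p X - \<eta> p X"

definition dom_MG :: "(complex \<times> complex \<times> real) set \<Rightarrow> pt set" where
  "dom_MG U = {p. (pz1 p, pz2 p, pv p) \<in> U \<and> pc p \<noteq> 0}"

end

theory Submission
  imports Defs
begin

text \<open>
  On M the fields \<open>\<T>, \<L>\<^sub>1, \<K>\<close> and the conjugates of the last two form a frame. The Jacobi identity, applied to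
  functions, gives all its brackets: in particular \<open>\<K>\<close> annihilates the conjugate of k (rank one), and the \<open>\<K>\<close>- and
  conjugate \<open>\<K>\<close>-derivatives of P are expressed by k. In terms of \<open>B\<^sub>0\<close> (whose role is to normalise
  \<open>\<kappa>\<^sub>0'\<close>) the invariants take the short forms
  \<open>6 H\<^sub>0 = - M B\<^sub>0 + B\<^sub>0 Pb + B\<^sub>0\<^sup>2 / 3\<close> and \<open>W\<^sub>0 = L f / f + P + 2 Bb / 3 + \<i> T k / f - K B\<^sub>0 / (3 f)\<close>, where M is
  the conjugate of L, \<open>f = M k\<close>, and Pb, Bb are conjugates. These yield the structure equations for \<open>c = 1, e = 0\<close>;
  the only one that is not immediate is the value of the real part of \<open>Z\<^sup>2\<close>, where everything except
  \<open>W\<^sub>0\<close> and \<open>M W\<^sub>0\<close> combines to a purely imaginary quantity. The structure group then acts on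
  \<open>\<rho>, \<kappa>, \<zeta>\<close> by scalings and unipotent matrices in \<open>s = e / c\<close>, under which the relations between the torsion
  coefficients are preserved.
\<close>

text \<open>Inserting \<pi>1 and \<pi>2 and comparing coefficients shows that, apart from W, J and
  R, the torsion of d\<zeta> must be a fixed linear combination of that of d\<rho> and d\<kappa>.
  For \<open>c = 1, e = 0\<close> this explains the constants in \<kappa>0' and \<zeta>0''. Let
  these forms be \<open>dz1 - k dz2 + b \<rho>0\<close> and \<open>f dz2 + h \<rho>0\<close>. The
  coefficient of \<zeta> ^ conj \<kappa> requires \<open>3 i b - Pb = - M f / f\<close>, that is
  \<open>b = (i/3) B0\<close>. The coefficient of \<kappa> ^ conj \<kappa> requires
  \<open>2 h = - (i/3) M B0 + b (Pb + B0/3)\<close>, that is \<open>h = i H0\<close>. The torsion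
  coefficients are given by a description operator, so an expansion must be exhibited and shown to
  be unique. Apart from W, J and the real part of the coefficient of \<rho> ^ \<zeta>, only
  relations among them are carried to the group. Vector fields are operators on functions here; a
  relation between coefficients is found by testing a Jacobi identity on z1, its conjugate and v.
  The series of F serves only to give smoothness, and with it symmetric second derivatives.\<close>

declare split_paired_All [simp del] split_paired_Ex [simp del]

section \<open>Directional derivatives and smooth functions\<close>

primrec ck :: "nat \<Rightarrow> pt set \<Rightarrow> (pt \<Rightarrow> complex) \<Rightarrow> bool" where
  "ck 0 S f \<longleftrightarrow> True"
| "ck (Suc n) S f \<longleftrightarrow> (\<forall>p\<in>S. f differentiable (at p)) \<and> (\<forall>X. ck n S (\<lambda>p. Dd f p X))"

text \<open>Every order is phrased by derivatives along constant vectors, so all derivatives remain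
  functions of type \<open>pt => complex\<close> to which the same operators apply again. Order 0
  asks nothing; continuity comes from differentiability at the next order.\<close>

definition smooth_on :: "pt set \<Rightarrow> (pt \<Rightarrow> complex) \<Rightarrow> bool" where
  "smooth_on S f \<longleftrightarrow> (\<forall>n. ck n S f)"

lemma Dd_eqI:
  assumes "(f has_derivative D) (at p)"
  shows "Dd f p X = D X"
proof -
  have g: "((\<lambda>s::real. p + s *\<^sub>R X) has_vector_derivative X) (at 0)"
    by (auto intro!: derivative_eq_intros simp: has_vector_derivative_def)
  have f: "(f has_derivative D) (at (p + 0 *\<^sub>R X))" using assms by simp
  have "((f \<circ> (\<lambda>s::real. p + s *\<^sub>R X)) has_derivative (D \<circ> (\<lambda>s. s *\<^sub>R X))) (at 0)"
    by (rule diff_chain_at[OF g[unfolded has_vector_derivative_def] f])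
  moreover have "linear D" using assms has_derivative_linear by blast
  ultimately have "((\<lambda>s::real. f (p + s *\<^sub>R X)) has_vector_derivative D X) (at 0)"
    by (simp add: has_vector_derivative_def o_def linear_scale)
  then show ?thesis unfolding Dd_def by (rule vector_derivative_at)
qed

lemma Dd_has_derivative:
  assumes "f differentiable (at p)"
  shows "(f has_derivative Dd f p) (at p)"
proof -
  obtain D where D: "(f has_derivative D) (at p)" using assms differentiable_def by blast
  then have "Dd f p = D" using Dd_eqI by blast
  then show ?thesis using D by simp
qed

lemma Dd_cong:
  assumes "open S" "p \<in> S" "\<And>q. q \<in> S \<Longrightarrow> f q = g q"
  shows "Dd f p X = Dd g p X"
proof -
  have "open ((\<lambda>s::real. p + s *\<^sub>R X) -` S)"
    by (intro open_vimage assms continuous_intros)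
  then have "eventually (\<lambda>s::real. s \<in> (\<lambda>s::real. p + s *\<^sub>R X) -` S) (nhds 0)"
    using assms(2) by (intro eventually_nhds_in_open) auto
  then have "eventually (\<lambda>s::real. f (p + s *\<^sub>R X) = g (p + s *\<^sub>R X)) (nhds 0)"
    by eventually_elim (use assms(3) in auto)
  then show ?thesis
    unfolding Dd_def
    by (intro vector_derivative_cong_eq) (auto simp: assms)
qed

lemma differentiable_cong_open:
  assumes "open S" "p \<in> S" "\<And>q. q \<in> S \<Longrightarrow> f q = g q" "f differentiable (at p)"
  shows "g differentiable (at p)"
proof -
  obtain D where D: "(f has_derivative D) (at p)" using assms differentiable_def by blast
  have "(g has_derivative D) (at p)"
    by (rule has_derivative_transform_within_open[OF D assms(1,2)]) (use assms(3) in auto)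
  then show ?thesis using differentiable_def by blast
qed

lemma ck_cong:
  assumes "open S" "\<And>q. q \<in> S \<Longrightarrow> f q = g q" "ck n S f"
  shows "ck n S g"
  using assms(2,3)
proof (induction n arbitrary: f g)
  case (Suc n)
  have "g differentiable (at p)" if "p \<in> S" for p
    by (rule differentiable_cong_open[OF assms(1) that Suc.prems(1)]) (use Suc.prems(2) that in auto)
  moreover have "ck n S (\<lambda>p. Dd g p X)" for X
  proof (rule Suc.IH)
    show "Dd f q X = Dd g q X" if "q \<in> S" for q
      by (rule Dd_cong[OF assms(1) that Suc.prems(1)])
    show "ck n S (\<lambda>p. Dd f p X)" using Suc.prems(2) by simp
  qed
  ultimately show ?case by simp
qed simp

lemma ck_SucD: "ck (Suc n) S f \<Longrightarrow> ck n S f"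
  by (induction n arbitrary: f) auto

text \<open>\<open>ck n T f\<close> speaks of differentiability in full neighbourhoods of the points
  of T, so T may be any set. This glues the boxes on which the local power series converge.\<close>

lemma ck_local:
  assumes "\<And>p. p \<in> S \<Longrightarrow> \<exists>T. p \<in> T \<and> ck n T f"
  shows "ck n S f"
  using assms
proof (induction n arbitrary: f)
  case (Suc n)
  have "f differentiable (at p)" if "p \<in> S" for p
    using Suc.prems[OF that] by auto
  moreover have "ck n S (\<lambda>p. Dd f p X)" for X
  proof (rule Suc.IH)
    show "\<exists>T. p \<in> T \<and> ck n T (\<lambda>p. Dd f p X)" if "p \<in> S" for p
      using Suc.prems[OF that] by auto
  qed
  ultimately show ?case by simp
qed simp

lemma Dd_const [simp]: "Dd (\<lambda>_. a) p X = 0"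
  by (rule Dd_eqI) simp

lemma Dd_blinear: "bounded_linear f \<Longrightarrow> Dd f p X = f X"
  by (intro Dd_eqI bounded_linear_imp_has_derivative)

lemma Dd_add:
  assumes "f differentiable (at p)" "g differentiable (at p)"
  shows "Dd (\<lambda>q. f q + g q) p X = Dd f p X + Dd g p X"
  by (rule Dd_eqI) (intro derivative_intros assms Dd_has_derivative)

lemma Dd_mult:
  assumes "f differentiable (at p)" "g differentiable (at p)"
  shows "Dd (\<lambda>q. f q * g q) p X = f p * Dd g p X + Dd f p X * g p"
  by (rule Dd_eqI) (intro has_derivative_mult assms Dd_has_derivative)

lemma Dd_inverse:
  assumes "f differentiable (at p)" "f p \<noteq> 0"
  shows "Dd (\<lambda>q. inverse (f q)) p X = - (inverse (f p) * Dd f p X * inverse (f p))"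
  by (rule Dd_eqI) (intro Deriv.has_derivative_inverse assms Dd_has_derivative)

lemma Dd_divide:
  assumes f: "f differentiable (at p)" and g: "g differentiable (at p)" and nz: "g p \<noteq> 0"
  shows "Dd (\<lambda>q. f q / g q) p X = Dd f p X / g p - f p * Dd g p X / (g p)\<^sup>2"
proof -
  have "(\<lambda>q. inverse (g q)) differentiable (at p)"
    by (rule differentiableI[OF Deriv.has_derivative_inverse[OF nz Dd_has_derivative[OF g]]])
  then show ?thesis
    using Dd_mult[OF f, of "\<lambda>q. inverse (g q)" X] Dd_inverse[OF g nz, of X] nz
    by (simp add: field_simps power2_eq_square)
qed

lemma Dd_diff:
  assumes "f differentiable (at p)" "g differentiable (at p)"
  shows "Dd (\<lambda>q. f q - g q) p X = Dd f p X - Dd g p X"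
  by (rule Dd_eqI) (intro derivative_intros assms Dd_has_derivative)

lemma Dd_cnj:
  assumes "f differentiable (at p)"
  shows "Dd (\<lambda>q. cnj (f q)) p X = cnj (Dd f p X)"
  by (rule Dd_eqI) (rule bounded_linear.has_derivative[OF bounded_linear_cnj Dd_has_derivative[OF assms]])

lemma cnj_differentiable: "f differentiable (at p) \<Longrightarrow> (\<lambda>q. cnj (f q)) differentiable (at p)"
  unfolding differentiable_def using bounded_linear.has_derivative[OF bounded_linear_cnj] by blast

lemma ck_const: "ck n S (\<lambda>_. a)"
  by (induction n arbitrary: a) auto

lemma ck_blinear: "bounded_linear f \<Longrightarrow> ck n S f"
  by (cases n) (auto simp: Dd_blinear ck_const bounded_linear_imp_differentiable)

lemma ck_add: "open S \<Longrightarrow> ck n S f \<Longrightarrow> ck n S g \<Longrightarrow> ck n S (\<lambda>q. f q + g q)"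
proof (induction n arbitrary: f g)
  case (Suc n)
  have "ck n S (\<lambda>p. Dd (\<lambda>q. f q + g q) p X)" for X
    by (rule ck_cong[where f = "\<lambda>p. Dd f p X + Dd g p X"])
       (use Suc in \<open>auto simp: Dd_add\<close>)
  then show ?case using Suc by auto
qed simp

lemma ck_mult: "open S \<Longrightarrow> ck n S f \<Longrightarrow> ck n S g \<Longrightarrow> ck n S (\<lambda>q. f q * g q)"
proof (induction n arbitrary: f g)
  case (Suc n)
  have "ck n S (\<lambda>p. Dd (\<lambda>q. f q * g q) p X)" for X
    by (rule ck_cong[where f = "\<lambda>p. f p * Dd g p X + Dd f p X * g p"])
       (use Suc ck_SucD[of n S f] ck_SucD[of n S g] in \<open>auto simp: Dd_mult intro!: ck_add\<close>)
  then show ?case using Suc by auto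
qed simp

lemma ck_cnj: "open S \<Longrightarrow> ck n S f \<Longrightarrow> ck n S (\<lambda>q. cnj (f q))"
proof (induction n arbitrary: f)
  case (Suc n)
  have "ck n S (\<lambda>p. Dd (\<lambda>q. cnj (f q)) p X)" for X
    by (rule ck_cong[where f = "\<lambda>p. cnj (Dd f p X)"])
       (use Suc in \<open>auto simp: Dd_cnj\<close>)
  then show ?case using Suc by (auto simp: cnj_differentiable)
qed simp

text \<open>The derivative of \<open>inverse f\<close> is a product of derivatives of f and
  \<open>inverse f\<close> itself; the induction hypothesis covers the latter at one order less, so
  f can stay fixed.\<close>

lemma ck_inverse:
  "open S \<Longrightarrow> ck n S f \<Longrightarrow> \<forall>p\<in>S. f p \<noteq> 0 \<Longrightarrow> ck n S (\<lambda>q. inverse (f q))"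
proof (induction n)
  case (Suc n)
  have i: "ck n S (\<lambda>q. inverse (f q))" using Suc ck_SucD by blast
  have d: "ck n S (\<lambda>p. Dd f p X)" for X using Suc.prems by simp
  have "ck n S (\<lambda>p. Dd (\<lambda>q. inverse (f q)) p X)" for X
    by (rule ck_cong[OF Suc.prems(1) _
          ck_mult[OF Suc.prems(1) ck_const[of n S "- 1"]
            ck_mult[OF Suc.prems(1) ck_mult[OF Suc.prems(1) i d[of X]] i]]])
       (use Suc.prems in \<open>auto simp: Dd_inverse\<close>)
  moreover have "(\<lambda>q. inverse (f q)) differentiable (at p)" if "p \<in> S" for p
  proof -
    have "(f has_derivative Dd f p) (at p)" "f p \<noteq> 0"
      using Suc.prems that by (auto intro: Dd_has_derivative)
    from Deriv.has_derivative_inverse[OF this(2,1)] show ?thesis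
      unfolding differentiable_def by blast
  qed
  ultimately show ?case by auto
qed simp

lemma smooth_on_differentiable:
  assumes "smooth_on S f" "p \<in> S"
  shows "f differentiable (at p)"
proof -
  have "ck (Suc 0) S f" using assms unfolding smooth_on_def by blast
  then show ?thesis using assms by simp
qed

lemma smooth_on_Dd:
  assumes "smooth_on S f"
  shows "smooth_on S (\<lambda>p. Dd f p X)"
  unfolding smooth_on_def
proof
  fix n
  have "ck (Suc n) S f" using assms unfolding smooth_on_def by blast
  then show "ck n S (\<lambda>p. Dd f p X)" by simp
qed

lemma smooth_on_const: "smooth_on S (\<lambda>_. a)"
  by (simp add: smooth_on_def ck_const)

lemma smooth_on_blinear: "bounded_linear f \<Longrightarrow> smooth_on S f"
  by (simp add: smooth_on_def ck_blinear)

lemma smooth_on_add: "open S \<Longrightarrow> smooth_on S f \<Longrightarrow> smooth_on S g \<Longrightarrow> smooth_on S (\<lambda>q. f q + g q)"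
  by (simp add: smooth_on_def ck_add)

lemma smooth_on_mult: "open S \<Longrightarrow> smooth_on S f \<Longrightarrow> smooth_on S g \<Longrightarrow> smooth_on S (\<lambda>q. f q * g q)"
  by (simp add: smooth_on_def ck_mult)

lemma smooth_on_cnj: "open S \<Longrightarrow> smooth_on S f \<Longrightarrow> smooth_on S (\<lambda>q. cnj (f q))"
  by (simp add: smooth_on_def ck_cnj)

lemma smooth_on_inverse:
  "open S \<Longrightarrow> smooth_on S f \<Longrightarrow> \<forall>p\<in>S. f p \<noteq> 0 \<Longrightarrow> smooth_on S (\<lambda>q. inverse (f q))"
  by (simp add: smooth_on_def ck_inverse)

lemma smooth_on_uminus: "open S \<Longrightarrow> smooth_on S f \<Longrightarrow> smooth_on S (\<lambda>q. - f q)"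
  using smooth_on_mult[OF _ smooth_on_const[of S "-1"]] by simp

lemma smooth_on_diff: "open S \<Longrightarrow> smooth_on S f \<Longrightarrow> smooth_on S g \<Longrightarrow> smooth_on S (\<lambda>q. f q - g q)"
  using smooth_on_add[of S f "\<lambda>q. - g q"] smooth_on_uminus by simp

lemma smooth_on_divide:
  "open S \<Longrightarrow> smooth_on S f \<Longrightarrow> smooth_on S g \<Longrightarrow> \<forall>p\<in>S. g p \<noteq> 0 \<Longrightarrow> smooth_on S (\<lambda>q. f q / g q)"
  using smooth_on_mult[of S f "\<lambda>q. inverse (g q)"] smooth_on_inverse by (simp add: divide_inverse)

lemma smooth_on_power: "open S \<Longrightarrow> smooth_on S f \<Longrightarrow> smooth_on S (\<lambda>q. f q ^ n)"
  by (induction n) (auto simp: smooth_on_const intro: smooth_on_mult)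

section \<open>Symmetry of second derivatives\<close>

text \<open>Stated for real parts because the mean value theorem fails for complex values.\<close>

lemma mean_value_Dd:
  fixes g :: "pt \<Rightarrow> complex"
  assumes "0 < s" "\<And>u. 0 \<le> u \<Longrightarrow> u \<le> s \<Longrightarrow> g differentiable (at (p + u *\<^sub>R X))"
  shows "\<exists>u. 0 < u \<and> u < s \<and> Re (g (p + s *\<^sub>R X)) - Re (g p) = s * Re (Dd g (p + u *\<^sub>R X) X)"
proof -
  have d: "((\<lambda>u. Re (g (p + u *\<^sub>R X))) has_derivative (\<lambda>h. h * Re (Dd g (p + u *\<^sub>R X) X))) (at u)"
    if "0 \<le> u" "u \<le> s" for u
  proof -
    have 1: "((\<lambda>u::real. p + u *\<^sub>R X) has_derivative (\<lambda>h. h *\<^sub>R X)) (at u)"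
      by (auto intro!: derivative_eq_intros)
    have 2: "(g has_derivative Dd g (p + u *\<^sub>R X)) (at (p + u *\<^sub>R X))"
      by (intro Dd_has_derivative assms that)
    have "((\<lambda>u. Re (g (p + u *\<^sub>R X))) has_derivative (\<lambda>h. Re (Dd g (p + u *\<^sub>R X) (h *\<^sub>R X)))) (at u)"
      using bounded_linear.has_derivative[OF bounded_linear_Re diff_chain_at[OF 1 2]] by (simp add: o_def)
    moreover have "Re (Dd g (p + u *\<^sub>R X) (h *\<^sub>R X)) = h * Re (Dd g (p + u *\<^sub>R X) X)" for h
      using linear_scale[OF has_derivative_linear[OF 2]] by simp
    ultimately show ?thesis by simp
  qed
  obtain z where "0 < z" "z < s" "Re (g (p + s *\<^sub>R X)) - Re (g (p + 0 *\<^sub>R X)) = (s - 0) * Re (Dd g (p + z *\<^sub>R X) X)"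
    using mvt[OF assms(1), of "\<lambda>u. Re (g (p + u *\<^sub>R X))" "\<lambda>u h. h * Re (Dd g (p + u *\<^sub>R X) X)"] d
    by (smt (verit) continuous_on_eq_continuous_within has_derivative_continuous has_derivative_at_withinI atLeastAtMost_iff)
  then show ?thesis by auto
qed

text \<open>The mean value theorem, applied first to \<open>q \<mapsto> f (q + sY) - f q\<close> in direction X and then in direction Y,
  turns the second difference into \<open>s\<^sup>2\<close> times a mixed derivative at a nearby point.\<close>

lemma second_difference_limit:
  fixes f :: "pt \<Rightarrow> complex"
  assumes S: "open S" "p \<in> S" and f: "smooth_on S f"
  shows "((\<lambda>s. (Re (f (p + s *\<^sub>R X + s *\<^sub>R Y)) - Re (f (p + s *\<^sub>R X)) - Re (f (p + s *\<^sub>R Y)) + Re (f p)) / s\<^sup>2)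
          \<longlongrightarrow> Re (Dd (\<lambda>q. Dd f q X) p Y)) (at_right 0)"
proof -
  let ?h = "\<lambda>q. Dd (\<lambda>q. Dd f q X) q Y"
  have "smooth_on S ?h" by (intro smooth_on_Dd f)
  then have "isCont ?h p"
    using smooth_on_differentiable[OF _ S(2)] differentiable_imp_continuous_within by blast
  then have cont: "isCont (\<lambda>q. Re (?h q)) p" by (rule isCont_Re)
  obtain r where r: "r > 0" "ball p r \<subseteq> S" using S open_contains_ball by blast
  show ?thesis
  proof (rule tendstoI)
    fix e :: real assume "e > 0"
    then obtain d where d: "d > 0" "\<And>q. dist q p < d \<Longrightarrow> dist (Re (?h q)) (Re (?h p)) < e"
      using cont unfolding continuous_at_eps_delta by blast
    \<comment> \<open>Two steps shorter than m, one along X and one along Y, stay both in S and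
      within the continuity radius d; the summand 1 keeps the divisor positive when X and Y
      vanish.\<close>
    define m where "m = min r d / (norm X + norm Y + 1)"
    have m: "m > 0" unfolding m_def using r d by (auto simp: add_nonneg_pos)
    have near: "dist (p + u *\<^sub>R X + w *\<^sub>R Y) p < min r d" if "0 \<le> u" "u < m" "0 \<le> w" "w < m" for u w
    proof -
      have "dist (p + u *\<^sub>R X + w *\<^sub>R Y) p = norm (u *\<^sub>R X + w *\<^sub>R Y)" by (simp add: dist_norm)
      also have "\<dots> \<le> u * norm X + w * norm Y"
        using norm_triangle_ineq[of "u *\<^sub>R X" "w *\<^sub>R Y"] that by simp
      also have "\<dots> \<le> m * norm X + m * norm Y"
        using that by (intro add_mono mult_right_mono) auto
      also have "\<dots> < m * (norm X + norm Y + 1)" using m by (simp add: algebra_simps)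
      also have "\<dots> = min r d" unfolding m_def
        using norm_ge_zero[of X] norm_ge_zero[of Y] by (simp add: add_nonneg_eq_0_iff)
      finally show ?thesis .
    qed
    have inS: "p + u *\<^sub>R X + w *\<^sub>R Y \<in> S" if "0 \<le> u" "u < m" "0 \<le> w" "w < m" for u w
      using near[OF that] r by (auto simp: dist_commute subset_iff)
    have key: "dist ((Re (f (p + s *\<^sub>R X + s *\<^sub>R Y)) - Re (f (p + s *\<^sub>R X)) - Re (f (p + s *\<^sub>R Y)) + Re (f p)) / s\<^sup>2) (Re (?h p)) < e"
      if s: "0 < s" "s < m" for s
    proof -
      let ?g = "\<lambda>q. f (q + s *\<^sub>R Y) - f q"
      have fd: "f differentiable (at (p + u *\<^sub>R X + w *\<^sub>R Y))" if "0 \<le> u" "u \<le> s" "0 \<le> w" "w \<le> s" for u w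
        using smooth_on_differentiable[OF f inS] that s by simp
      have shift: "((\<lambda>q. f (q + s *\<^sub>R Y)) has_derivative Dd f (q + s *\<^sub>R Y)) (at q)"
        if "f differentiable (at (q + s *\<^sub>R Y))" for q
      proof -
        have "((\<lambda>q. q + s *\<^sub>R Y) has_derivative (\<lambda>h. h)) (at q)"
          by (auto intro!: derivative_eq_intros)
        from diff_chain_at[OF this Dd_has_derivative[OF that]] show ?thesis by (simp add: o_def)
      qed
      have gd: "(?g has_derivative (\<lambda>h. Dd f (p + u *\<^sub>R X + s *\<^sub>R Y) h - Dd f (p + u *\<^sub>R X) h)) (at (p + u *\<^sub>R X))"
        if "0 \<le> u" "u \<le> s" for u
        using fd[of u s] fd[of u 0] that s by (intro has_derivative_diff shift Dd_has_derivative) auto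
      obtain u where u: "0 < u" "u < s"
        "Re (?g (p + s *\<^sub>R X)) - Re (?g p) = s * Re (Dd ?g (p + u *\<^sub>R X) X)"
      proof -
        have "?g differentiable (at (p + u *\<^sub>R X))" if "0 \<le> u" "u \<le> s" for u
          by (rule differentiableI[OF gd[OF that]])
        from mean_value_Dd[OF s(1) this] show ?thesis using that by blast
      qed
      have "Dd ?g (p + u *\<^sub>R X) X = Dd f (p + u *\<^sub>R X + s *\<^sub>R Y) X - Dd f (p + u *\<^sub>R X) X"
        using Dd_eqI[OF gd] u by simp
      moreover obtain w where w: "0 < w" "w < s"
        "Re (Dd f (p + u *\<^sub>R X + s *\<^sub>R Y) X) - Re (Dd f (p + u *\<^sub>R X) X) = s * Re (?h (p + u *\<^sub>R X + w *\<^sub>R Y))"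
      proof -
        have "(\<lambda>q. Dd f q X) differentiable (at (p + u *\<^sub>R X + w *\<^sub>R Y))" if "0 \<le> w" "w \<le> s" for w
          using smooth_on_differentiable[OF smooth_on_Dd[OF f] inS] that s u by simp
        from mean_value_Dd[OF s(1) this] show ?thesis using that by auto
      qed
      ultimately have "Re (?g (p + s *\<^sub>R X)) - Re (?g p) = s * (s * Re (?h (p + u *\<^sub>R X + w *\<^sub>R Y)))"
        using u by simp
      then have "(Re (f (p + s *\<^sub>R X + s *\<^sub>R Y)) - Re (f (p + s *\<^sub>R X)) - Re (f (p + s *\<^sub>R Y)) + Re (f p)) / s\<^sup>2
        = Re (?h (p + u *\<^sub>R X + w *\<^sub>R Y))"
        using s by (simp add: field_simps power2_eq_square)
      then show ?thesis using d(2) near[of u w] u w s by simp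
    qed
    then show "\<forall>\<^sub>F s in at_right 0. dist ((Re (f (p + s *\<^sub>R X + s *\<^sub>R Y)) - Re (f (p + s *\<^sub>R X)) - Re (f (p + s *\<^sub>R Y)) + Re (f p)) / s\<^sup>2) (Re (?h p)) < e"
      using m eventually_at_right by blast
  qed
qed

text \<open>The second difference is symmetric in X and Y, so both mixed derivatives are its
  limit.\<close>

lemma Re_Dd_commute:
  assumes "open S" "p \<in> S" "smooth_on S f"
  shows "Re (Dd (\<lambda>q. Dd f q X) p Y) = Re (Dd (\<lambda>q. Dd f q Y) p X)"
proof (rule tendsto_unique[OF _ second_difference_limit[OF assms]])
  show "((\<lambda>s. (Re (f (p + s *\<^sub>R X + s *\<^sub>R Y)) - Re (f (p + s *\<^sub>R X)) - Re (f (p + s *\<^sub>R Y)) + Re (f p)) / s\<^sup>2)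
          \<longlongrightarrow> Re (Dd (\<lambda>q. Dd f q Y) p X)) (at_right 0)"
    using second_difference_limit[OF assms, of Y X] by (simp add: algebra_simps)
qed simp

lemma Dd_commute:
  assumes "open S" "p \<in> S" "smooth_on S f"
  shows "Dd (\<lambda>q. Dd f q X) p Y = Dd (\<lambda>q. Dd f q Y) p X"
proof (rule complex_eqI)
  \<comment> \<open>The imaginary part of a number is minus the real part of its product with i, so
    the real case is applied to \<open>i f\<close>.\<close>
  have i: "Dd (\<lambda>q. Dd (\<lambda>q. \<i> * f q) q V) p W = \<i> * Dd (\<lambda>q. Dd f q V) p W" for V W
  proof -
    have "Dd (\<lambda>q. Dd (\<lambda>q. \<i> * f q) q V) p W = Dd (\<lambda>q. \<i> * Dd f q V) p W"
      using smooth_on_differentiable[OF assms(3)]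
      by (intro Dd_cong[OF assms(1,2)]) (simp add: Dd_mult)
    then show ?thesis
      using smooth_on_differentiable[OF smooth_on_Dd[OF assms(3)] assms(2)] by (simp add: Dd_mult)
  qed
  show "Im (Dd (\<lambda>q. Dd f q X) p Y) = Im (Dd (\<lambda>q. Dd f q Y) p X)"
    using Re_Dd_commute[OF assms(1,2) smooth_on_mult[OF assms(1) smooth_on_const[of S \<i>] assms(3)], of X Y]
    unfolding i by simp
qed (rule Re_Dd_commute[OF assms])

section \<open>Power series in the base coordinates\<close>

definition co :: "nat \<Rightarrow> pt \<Rightarrow> real" where
  "co j p = [Re (pz1 p), Im (pz1 p), Re (pz2 p), Im (pz2 p), pv p] ! j"

text \<open>Exponents are a function of the coordinate index, of which only the values below 5 are
  read; one argument then serves all five real coordinates of M.\<close>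

definition mon :: "(nat \<Rightarrow> nat) \<Rightarrow> pt \<Rightarrow> pt \<Rightarrow> complex" where
  "mon I q p = (\<Prod>j<5. complex_of_real (co j p - co j q) ^ I j)"

definition deg :: "(nat \<Rightarrow> nat) \<Rightarrow> nat" where "deg I = (\<Sum>j<5. I j)"

text \<open>Unbounded in the fibre coordinates, convex as termwise differentiation requires, and of
  a shape on which a monomial is bounded by a power of r.\<close>

definition box5 :: "pt \<Rightarrow> real \<Rightarrow> pt set" where
  "box5 q r = {p. \<forall>j<5. \<bar>co j p - co j q\<bar> < r}"

lemma less5: "(j::nat) < 5 \<longleftrightarrow> j = 0 \<or> j = 1 \<or> j = 2 \<or> j = 3 \<or> j = 4" by auto

lemma bounded_linear_co: "j < 5 \<Longrightarrow> bounded_linear (co j)"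
  unfolding less5 co_def pz1_def pz2_def pv_def
  by (auto simp: numeral_eq_Suc intro!: bounded_linear_intros bounded_linear_compose[OF bounded_linear_Re]
     bounded_linear_compose[OF bounded_linear_Im]
     bounded_linear_compose[OF bounded_linear_fst]
     bounded_linear_compose[OF bounded_linear_snd] bounded_linear_fst bounded_linear_snd)

lemma norm_co_le:
  assumes "j < 5" shows "\<bar>co j p\<bar> \<le> norm p"
proof -
  have a: "norm (fst p) \<le> norm p" "norm (snd p) \<le> norm p" for p :: "'a::real_normed_vector \<times> 'b::real_normed_vector"
    by (metis norm_fst_le norm_snd_le prod.collapse)+
  have "norm (pz1 p) \<le> norm p" "norm (pz2 p) \<le> norm p" "norm (pv p) \<le> norm p"
    unfolding pz1_def pz2_def pv_def by (meson a order_trans)+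
  then show ?thesis
    using assms abs_Re_le_cmod[of "pz1 p"] abs_Im_le_cmod[of "pz1 p"]
      abs_Re_le_cmod[of "pz2 p"] abs_Im_le_cmod[of "pz2 p"]
    unfolding less5 co_def by (auto simp: numeral_eq_Suc)
qed

lemma open_box5: "open (box5 q r)"
proof -
  have "open {p. \<bar>co j p - co j q\<bar> < r}" if "j < 5" for j
    using bounded_linear_co[OF that]
    by (intro open_Collect_less continuous_intros) (rule linear_continuous_on)
  then have "open (\<Inter>j\<in>{..<5}. {p. \<bar>co j p - co j q\<bar> < r})" by (intro open_INT) auto
  moreover have "box5 q r = (\<Inter>j\<in>{..<5}. {p. \<bar>co j p - co j q\<bar> < r})" by (auto simp: box5_def)
  ultimately show ?thesis by simp
qed

lemma convex_box5: "convex (box5 q r)"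
proof (rule convexI)
  fix x y :: pt and u v :: real
  assume a: "x \<in> box5 q r" "y \<in> box5 q r" "0 \<le> u" "0 \<le> v" "u + v = 1"
  have "\<bar>co j (u *\<^sub>R x + v *\<^sub>R y) - co j q\<bar> < r" if j: "j < 5" for j
  proof -
    interpret bounded_linear "co j" by (rule bounded_linear_co[OF j])
    have e: "co j (u *\<^sub>R x + v *\<^sub>R y) - co j q = u * (co j x - co j q) + v * (co j y - co j q)"
    proof -
      have "co j q = (u + v) * co j q" using a by simp
      then show ?thesis by (simp add: add scale algebra_simps)
    qed
    have "co j x - co j q \<in> {-r<..<r}" "co j y - co j q \<in> {-r<..<r}"
      using a j unfolding box5_def by auto
    then have "u *\<^sub>R (co j x - co j q) + v *\<^sub>R (co j y - co j q) \<in> {-r<..<r}"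
      using a by (intro convexD) auto
    then show ?thesis unfolding e by auto
  qed
  then show "u *\<^sub>R x + v *\<^sub>R y \<in> box5 q r" by (simp add: box5_def)
qed

text \<open>At \<open>I i = 0\<close> the truncated subtraction leaves I unchanged, which is
  harmless: the derivative of the monomial then carries the factor \<open>I i = 0\<close>.\<close>

definition lower :: "nat \<Rightarrow> (nat \<Rightarrow> nat) \<Rightarrow> nat \<Rightarrow> nat" where
  "lower i I = I(i := I i - 1)"

lemma mon_has_derivative:
  "(mon I q has_derivative (\<lambda>h. \<Sum>i<5. of_real (co i h) * (of_nat (I i) * mon (lower i I) q p))) (at p)"
proof -
  have "((\<lambda>p. complex_of_real (co j p - co j q) ^ I j) has_derivative
      (\<lambda>h. of_nat (I j) * of_real (co j h) * complex_of_real (co j p - co j q) ^ (I j - 1))) (at p)"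
    if "j \<in> {..<5}" for j
  proof -
    have "(co j has_derivative co j) (at p)"
      using that by (intro bounded_linear_imp_has_derivative bounded_linear_co) auto
    then show ?thesis
      by (auto intro!: derivative_eq_intros simp: algebra_simps)
  qed
  from has_derivative_prod[of "{..<5}", OF this]
  have "(mon I q has_derivative (\<lambda>h. \<Sum>i<5. of_nat (I i) * of_real (co i h) * complex_of_real (co i p - co i q) ^ (I i - 1)
     * (\<Prod>j\<in>{..<5} - {i}. complex_of_real (co j p - co j q) ^ I j))) (at p)"
    unfolding mon_def[abs_def] by simp
  moreover have "mon (lower i I) q p = complex_of_real (co i p - co i q) ^ (I i - 1)
     * (\<Prod>j\<in>{..<5} - {i}. complex_of_real (co j p - co j q) ^ I j)" if "i < 5" for i
    unfolding mon_def using that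
    by (subst prod.remove[of _ i]) (auto simp: lower_def intro!: prod.cong)
  ultimately show ?thesis by (simp add: algebra_simps cong: sum.cong_simp)
qed

lemma norm_mon_le:
  assumes "p \<in> box5 q r" "0 \<le> r"
  shows "norm (mon I q p) \<le> r ^ deg I"
proof -
  have "norm (mon I q p) = (\<Prod>j<5. \<bar>co j p - co j q\<bar> ^ I j)"
    unfolding mon_def by (simp add: prod_norm[symmetric] norm_power norm_of_real del: of_real_diff)
  also have "\<dots> \<le> (\<Prod>j<5. r ^ I j)"
    using assms by (intro prod_mono conjI power_mono) (auto simp: box5_def less_imp_le)
  also have "\<dots> = r ^ deg I" by (simp add: deg_def power_sum)
  finally show ?thesis .
qed

lemma deg_lower: "i < 5 \<Longrightarrow> I i \<noteq> 0 \<Longrightarrow> deg I = Suc (deg (lower i I))"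
  unfolding deg_def by (subst (1 2) sum.remove[of _ i]) (auto simp: lower_def intro!: sum.cong)

text \<open>Passing to a smaller radius pays for the factor \<open>I n i\<close>: it is at most the
  degree, and \<open>d * (s / r) ^ d\<close> is bounded in d.\<close>

lemma summable_lower:
  fixes a :: "nat \<Rightarrow> complex"
  assumes sm: "summable (\<lambda>n. norm (a n) * r ^ deg (I n))" and r: "0 < s" "s < r" and i: "i < 5"
  shows "summable (\<lambda>n. norm (of_nat (I n i) * a n) * s ^ deg (lower i (I n)))"
proof -
  have "(\<lambda>n. real n * (s / r) ^ n) \<longlonglongrightarrow> 0"
    using powser_times_n_limit_0[of "s / r"] r by simp
  then obtain C where C: "\<And>n. norm (real n * (s / r) ^ n) \<le> C"
    using BseqE[OF convergent_imp_Bseq[OF convergentI]] by blast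
  have C0: "C \<ge> 0" using C[of 0] by simp
  show ?thesis
  proof (rule summable_comparison_test')
    show "summable (\<lambda>n. (C / s) * (norm (a n) * r ^ deg (I n)))" using sm by (rule summable_mult)
    fix n
    show "norm (norm (of_nat (I n i) * a n) * s ^ deg (lower i (I n))) \<le> (C / s) * (norm (a n) * r ^ deg (I n))"
    proof (cases "I n i = 0")
      case True then show ?thesis using C0 r by simp
    next
      case False
      let ?d = "deg (I n)"
      have d: "?d = Suc (deg (lower i (I n)))" using i False by (rule deg_lower)
      have "I n i \<le> ?d" unfolding deg_def using i by (intro member_le_sum) auto
      have "real (I n i) * s ^ deg (lower i (I n)) = real (I n i) * s ^ ?d / s"
        using d r by simp
      also have "\<dots> \<le> real ?d * s ^ ?d / s"
        using r \<open>I n i \<le> ?d\<close> by (intro divide_right_mono mult_right_mono) auto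
      also have "\<dots> = (real ?d * (s / r) ^ ?d) * r ^ ?d / s"
        using r by (simp add: power_divide)
      also have "\<dots> \<le> C * r ^ ?d / s"
        using C[of ?d] r by (intro divide_right_mono mult_right_mono) auto
      finally have "real (I n i) * s ^ deg (lower i (I n)) * norm (a n) \<le> C * r ^ ?d / s * norm (a n)"
        by (intro mult_right_mono) auto
      then show ?thesis using r by (simp add: norm_mult algebra_simps)
    qed
  qed
qed

lemma summable_mon:
  fixes a :: "nat \<Rightarrow> complex"
  assumes "summable (\<lambda>n. norm (a n) * r ^ deg (I n))" "p \<in> box5 q r" "0 \<le> r"
  shows "summable (\<lambda>n. a n * mon (I n) q p)"
  by (rule summable_comparison_test'[OF assms(1)])
     (auto simp: norm_mult intro!: mult_left_mono norm_mon_le assms)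

lemma power_series_has_derivative:
  fixes a :: "nat \<Rightarrow> complex"
  assumes sm: "summable (\<lambda>n. norm (a n) * r ^ deg (I n))" and s: "0 < s" "s < r" and p: "p \<in> box5 q s"
  shows "((\<lambda>p. \<Sum>n. a n * mon (I n) q p) has_derivative
     (\<lambda>h. \<Sum>i<5. of_real (co i h) * (\<Sum>n. (of_nat (I n i) * a n) * mon (lower i (I n)) q p))) (at p)"
proof -
  let ?B = "box5 q s"
  let ?b = "\<lambda>i n. of_nat (I n i) * a n"
  let ?G = "\<lambda>i p. \<Sum>n. ?b i n * mon (lower i (I n)) q p"
  let ?M = "\<lambda>i n. norm (?b i n) * s ^ deg (lower i (I n))"
  have sM: "summable (?M i)" if "i < 5" for i by (rule summable_lower[OF sm s that])
  \<comment> \<open>The derivative is a sum over five directions. Each differentiated series is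
    therefore approximated up to \<open>e / 5\<close>, uniformly on the box by the majorants
    \<open>?M\<close>.\<close>
  have conv: "\<forall>\<^sub>F n in sequentially. \<forall>x\<in>?B. \<forall>h. norm ((\<Sum>k<n. \<Sum>i<5. of_real (co i h) * (?b i k * mon (lower i (I k)) q x))
        - (\<Sum>i<5. of_real (co i h) * ?G i x)) \<le> e * norm h" if "e > 0" for e :: real
  proof -
    have ev: "\<forall>\<^sub>F n in sequentially. \<forall>x\<in>?B. norm ((\<Sum>k<n. ?b i k * mon (lower i (I k)) q x) - ?G i x) < e / 5"
      if i: "i < 5" for i
    proof -
      have "uniform_limit ?B (\<lambda>n x. \<Sum>k<n. ?b i k * mon (lower i (I k)) q x) (?G i) sequentially"
        by (rule Weierstrass_m_test[OF _ sM[OF i]])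
           (use s in \<open>auto simp: norm_mult intro!: mult_left_mono norm_mon_le\<close>)
      from uniform_limitD[OF this, of "e / 5"] show ?thesis using \<open>e > 0\<close> by (simp add: dist_norm)
    qed
    have "\<forall>\<^sub>F n in sequentially. \<forall>i<5. \<forall>x\<in>?B. norm ((\<Sum>k<n. ?b i k * mon (lower i (I k)) q x) - ?G i x) < e / 5"
      using eventually_ball_finite[OF finite_lessThan[of "5::nat"], of "\<lambda>n i. \<forall>x\<in>?B. norm ((\<Sum>k<n. ?b i k * mon (lower i (I k)) q x) - ?G i x) < e / 5"] ev
      by (simp add: Ball_def)
    then show ?thesis
    proof eventually_elim
      case (elim n)
      show ?case
      proof (intro ballI allI)
        fix x h assume x: "x \<in> ?B"
        have "(\<Sum>k<n. \<Sum>i<5. of_real (co i h) * (?b i k * mon (lower i (I k)) q x)) - (\<Sum>i<5. of_real (co i h) * ?G i x)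
           = (\<Sum>i<5. of_real (co i h) * ((\<Sum>k<n. ?b i k * mon (lower i (I k)) q x) - ?G i x))"
          by (subst sum.swap) (simp add: sum_subtractf right_diff_distrib sum_distrib_left)
        also have "norm \<dots> \<le> (\<Sum>i<5::nat. norm h * (e / 5))"
        proof (intro order_trans[OF norm_sum] sum_mono)
          fix i :: nat assume "i \<in> {..<5}"
          then have i: "i < 5" by simp
          have "norm ((\<Sum>k<n. ?b i k * mon (lower i (I k)) q x) - ?G i x) \<le> e / 5"
            using elim i x less_imp_le by blast
          then show "norm (of_real (co i h) * ((\<Sum>k<n. ?b i k * mon (lower i (I k)) q x) - ?G i x)) \<le> norm h * (e / 5)"
            unfolding norm_mult norm_of_real by (intro mult_mono norm_co_le i) auto
        qed
        finally show "norm ((\<Sum>k<n. \<Sum>i<5. of_real (co i h) * (?b i k * mon (lower i (I k)) q x))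
          - (\<Sum>i<5. of_real (co i h) * ?G i x)) \<le> e * norm h" by (simp add: mult.commute)
      qed
    qed
  qed
  have der: "((\<lambda>p. a n * mon (I n) q p) has_derivative
       (\<lambda>h. \<Sum>i<5. of_real (co i h) * (?b i n * mon (lower i (I n)) q x))) (at x within ?B)" for n x
    using has_derivative_mult_right[OF has_derivative_at_withinI[OF mon_has_derivative[of "I n" q x]], of "a n" ?B]
    by (simp add: sum_distrib_left algebra_simps)
  have srB: "x \<in> ?B \<Longrightarrow> x \<in> box5 q r" for x using s by (auto simp: box5_def)
  have sums: "(\<lambda>n. a n * mon (I n) q x) sums (\<Sum>n. a n * mon (I n) q x)" if "x \<in> ?B" for x
    using summable_mon[OF sm srB[OF that]] s by (intro summable_sums) auto
  obtain g where g: "\<forall>x\<in>?B. (\<lambda>n. a n * mon (I n) q x) sums g x \<and>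
      (g has_derivative (\<lambda>h. \<Sum>i<5. of_real (co i h) * ?G i x)) (at x within ?B)"
    using has_derivative_series[OF convex_box5 der conv p sums[OF p]] by blast
  have "((\<lambda>p. \<Sum>n. a n * mon (I n) q p) has_derivative (\<lambda>h. \<Sum>i<5. of_real (co i h) * ?G i p)) (at p within ?B)"
    by (rule has_derivative_transform[OF p _ g[THEN bspec, OF p, THEN conjunct2]])
       (use g sums_unique in fastforce)
  then show ?thesis using at_within_open[OF p open_box5] by simp
qed

text \<open>The partial derivatives are series of the same kind with a slightly smaller radius of
  summability. The induction therefore varies the coefficients, the exponents and both radii, and
  inserts t between s and r.\<close>

lemma power_series_ck:
  fixes a :: "nat \<Rightarrow> complex"
  assumes "summable (\<lambda>n. norm (a n) * r ^ deg (I n))" "0 < s" "s < r"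
  shows "ck m (box5 q s) (\<lambda>p. \<Sum>n. a n * mon (I n) q p)"
  using assms
proof (induction m arbitrary: a I r s)
  case (Suc m)
  obtain t where t: "s < t" "t < r" using dense Suc.prems(3) by blast
  have D: "((\<lambda>p. \<Sum>n. a n * mon (I n) q p) has_derivative
     (\<lambda>h. \<Sum>i<5. of_real (co i h) * (\<Sum>n. (of_nat (I n i) * a n) * mon (lower i (I n)) q p))) (at p)"
    if "p \<in> box5 q s" for p
    by (rule power_series_has_derivative[OF Suc.prems that])
  have c: "ck m (box5 q s) (\<lambda>p. \<Sum>n. (of_nat (I n i) * a n) * mon (lower i (I n)) q p)" if "i < 5" for i
    using Suc.IH[OF summable_lower[OF Suc.prems(1) _ t(2) that] Suc.prems(2) t(1)] t Suc.prems by simp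
  have sumck: "ck m (box5 q s) (\<lambda>p. \<Sum>i\<in>J. of_real (co i h) * (\<Sum>n. (of_nat (I n i) * a n) * mon (lower i (I n)) q p))"
    if "finite J" "J \<subseteq> {..<5}" for J h
    using that
    by (induction J rule: finite_induct) (auto simp: ck_const intro!: ck_add ck_mult c open_box5)
  have "ck m (box5 q s) (\<lambda>p. Dd (\<lambda>p. \<Sum>n. a n * mon (I n) q p) p X)" for X
    by (rule ck_cong[OF open_box5 _ sumck[of "{..<5}" X]]) (auto simp: Dd_eqI[OF D])
  moreover have "(\<lambda>p. \<Sum>n. a n * mon (I n) q p) differentiable (at p)" if "p \<in> box5 q s" for p
    using D[OF that] unfolding differentiable_def by blast
  ultimately show ?case by simp
qed simp

definition bproj :: "pt \<Rightarrow> complex \<times> complex \<times> real" where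
  "bproj p = (pz1 p, pz2 p, pv p)"

lemma bproj_near:
  assumes "\<And>j. j < 5 \<Longrightarrow> \<bar>co j p - co j q\<bar> \<le> t"
  shows "dist (bproj p) (bproj q) \<le> 5 * t"
proof -
  have n3: "norm (x, y, z) \<le> norm x + norm y + norm z" for x y :: complex and z :: real
    using norm_Pair_le[of x "(y, z)"] norm_Pair_le[of y z] by linarith
  have "dist (bproj p) (bproj q) \<le> norm (pz1 p - pz1 q) + norm (pz2 p - pz2 q) + norm (pv p - pv q)"
    unfolding bproj_def dist_norm diff_Pair by (rule n3)
  also have "\<dots> \<le> \<bar>co 0 p - co 0 q\<bar> + \<bar>co 1 p - co 1 q\<bar> + (\<bar>co 2 p - co 2 q\<bar> + \<bar>co 3 p - co 3 q\<bar>) + \<bar>co 4 p - co 4 q\<bar>"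
    using cmod_le[of "pz1 p - pz1 q"] cmod_le[of "pz2 p - pz2 q"]
    by (simp add: co_def numeral_eq_Suc)
  also have "\<dots> \<le> 5 * t"
    using assms[of 0] assms[of 1] assms[of 2] assms[of 3] assms[of 4] by simp
  finally show ?thesis .
qed

lemma real_analytic_ck_near:
  assumes F: "real_analytic_on U F" and p0: "bproj p0 \<in> U"
  shows "\<exists>s>0. ck m (box5 p0 s) (Fl F)"
proof -
  let ?q = "bproj p0"
  let ?tm = "\<lambda>(a :: nat \<times> nat \<times> nat \<times> nat \<times> nat \<Rightarrow> real) x. \<lambda>(i, j, k, l, m). a (i, j, k, l, m)
               * (Re (fst x) - Re (fst ?q)) ^ i * (Im (fst x) - Im (fst ?q)) ^ j
               * (Re (fst (snd x)) - Re (fst (snd ?q))) ^ k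
               * (Im (fst (snd x)) - Im (fst (snd ?q))) ^ l
               * (snd (snd x) - snd (snd ?q)) ^ m"
  obtain r a where r: "r > 0" and a: "\<And>x. x \<in> ball ?q r \<Longrightarrow> (?tm a x has_sum F x) UNIV"
    using bspec[OF F[unfolded real_analytic_on_def] p0]
    by (elim exE conjE) (rule that, assumption, erule bspec)
  define G where "G = ?tm a"
  have a: "(G x has_sum F x) UNIV" if "x \<in> ball ?q r" for x
    unfolding G_def by (rule a[OF that])
  \<comment> \<open>An enumeration of the quintuples of exponents turns the unordered sum into an
    ordinary series.\<close>
  define e :: "nat \<Rightarrow> nat \<times> nat \<times> nat \<times> nat \<times> nat" where "e = from_nat_into UNIV"
  have e: "bij_betw e UNIV UNIV"
    unfolding e_def by (intro bij_betw_from_nat_into countableI_type) (simp add: finite_prod)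
  define I where "I n = (\<lambda>v. case e n of (i, j, k, l, m) \<Rightarrow> [i, j, k, l, m] ! v)" for n
  have tm: "of_real (G (bproj p) (e n)) = complex_of_real (a (e n)) * mon (I n) p0 p" for p n
    by (cases "e n")
       (simp add: G_def mon_def I_def bproj_def co_def numeral_eq_Suc lessThan_Suc algebra_simps)
  \<comment> \<open>By \<open>bproj_near\<close> a box of half-width t lies within distance
    \<open>5 * t = r / 2\<close>, inside the ball of convergence.\<close>
  define t where "t = r / 10"
  have t: "0 < t" "5 * t < r" using r by (auto simp: t_def)
  \<comment> \<open>A corner of the box: all five increments equal t, so every monomial has the
    value t to its degree there. Summability of a real family is absolute, so convergence at this
    single point is the majorant that the power series lemmas need.\<close>
  define p1 :: pt where "p1 = (pz1 p0 + Complex t t, pz2 p0 + Complex t t, pv p0 + t, 0, 0, 0)"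
  have c1: "co j p1 - co j p0 = t" if "j < 5" for j
    using that unfolding less5 by (auto simp: co_def p1_def pz1_def pz2_def pv_def numeral_eq_Suc)
  have inball: "bproj p \<in> ball ?q r" if "\<And>j. j < 5 \<Longrightarrow> \<bar>co j p - co j p0\<bar> \<le> t" for p
    using bproj_near[OF that] t by (simp add: dist_commute)
  have "bproj p1 \<in> ball ?q r" using c1 t by (intro inball) simp
  from a[OF this] have "G (bproj p1) summable_on UNIV" by (rule has_sum_imp_summable)
  then have "(\<lambda>I. \<bar>G (bproj p1) I\<bar>) summable_on UNIV"
    by (simp add: summable_on_iff_abs_summable_on_real[of "G (bproj p1)"])
  then have "(\<lambda>n. \<bar>G (bproj p1) (e n)\<bar>) summable_on UNIV"
    using summable_on_reindex_bij_betw[OF e, of "\<lambda>I. \<bar>G (bproj p1) I\<bar>"] by simp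
  then have "summable (\<lambda>n. \<bar>G (bproj p1) (e n)\<bar>)"
    by (rule summable_on_imp_summable)
  moreover have "\<bar>G (bproj p1) (e n)\<bar> = norm (complex_of_real (a (e n))) * t ^ deg (I n)" for n
  proof -
    have "mon (I n) p0 p1 = complex_of_real (t ^ deg (I n))"
      unfolding mon_def deg_def by (simp add: c1 power_sum)
    then have "norm (complex_of_real (G (bproj p1) (e n))) = norm (complex_of_real (a (e n))) * t ^ deg (I n)"
      unfolding tm norm_mult using t by (simp add: norm_power)
    then show ?thesis by (simp only: norm_of_real)
  qed
  ultimately have sm: "summable (\<lambda>n. norm (complex_of_real (a (e n))) * t ^ deg (I n))" by simp
  have "Fl F p = (\<Sum>n. complex_of_real (a (e n)) * mon (I n) p0 p)" if "p \<in> box5 p0 (t / 2)" for p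
  proof -
    have "\<bar>co j p - co j p0\<bar> \<le> t" if "j < 5" for j
    proof -
      have "\<bar>co j p - co j p0\<bar> < t / 2" using \<open>p \<in> _\<close> that unfolding box5_def by blast
      then show ?thesis using t by linarith
    qed
    then have "(G (bproj p) has_sum F (bproj p)) UNIV" by (intro a inball)
    then have "((\<lambda>n. G (bproj p) (e n)) has_sum F (bproj p)) UNIV"
      using has_sum_reindex_bij_betw[OF e, of "G (bproj p)"] by simp
    then have "(\<lambda>n. G (bproj p) (e n)) sums F (bproj p)" by (rule has_sum_imp_sums)
    then have "(\<lambda>n. complex_of_real (G (bproj p) (e n))) sums complex_of_real (F (bproj p))"
      by (rule sums_of_real)
    then have "(\<lambda>n. complex_of_real (a (e n)) * mon (I n) p0 p) sums Fl F p"
      by (simp only: tm Fl_def bproj_def[symmetric])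
    then show ?thesis by (rule sums_unique)
  qed
  then have "ck m (box5 p0 (t / 2)) (Fl F)"
    by (intro ck_cong[OF open_box5 _ power_series_ck[OF sm, of "t / 2"]]) (use t in simp_all)
  then show ?thesis using t by (intro exI[of _ "t / 2"]) auto
qed

lemma real_analytic_smooth_on:
  assumes "real_analytic_on U F" "\<And>p. p \<in> S \<Longrightarrow> bproj p \<in> U"
  shows "smooth_on S (Fl F)"
  unfolding smooth_on_def
proof
  fix m
  show "ck m S (Fl F)"
  proof (rule ck_local)
    fix p assume "p \<in> S"
    then obtain s where "s > 0" "ck m (box5 p s) (Fl F)"
      using real_analytic_ck_near assms by blast
    moreover have "p \<in> box5 p s" using \<open>s > 0\<close> by (simp add: box5_def)
    ultimately show "\<exists>T. p \<in> T \<and> ck m T (Fl F)" by blast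
  qed
qed

lemma open_dom_MG: "open U \<Longrightarrow> open (dom_MG U)"
proof -
  assume U: "open U"
  have c: "continuous_on UNIV bproj" "continuous_on UNIV pc"
    unfolding bproj_def[abs_def] pz1_def pz2_def pv_def pc_def[abs_def]
    by (intro continuous_intros)+
  have "dom_MG U = bproj -` U \<inter> pc -` (- {0})"
    by (auto simp: dom_MG_def bproj_def)
  then show ?thesis using c U by (auto intro!: open_Int open_vimage)
qed

section \<open>Functions on the hypersurface and derivations\<close>

definition bfun :: "pt set \<Rightarrow> (pt \<Rightarrow> complex) \<Rightarrow> bool" where
  "bfun S f \<longleftrightarrow> smooth_on S f \<and> (\<forall>p q. bproj p = bproj q \<longrightarrow> f p = f q)"

text \<open>The second clause is locality: identities between functions hold on S only and may still
  be differentiated. Every differentiated identity below is obtained through it.\<close>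

definition derivation :: "pt set \<Rightarrow> ((pt \<Rightarrow> complex) \<Rightarrow> pt \<Rightarrow> complex) \<Rightarrow> bool" where
  "derivation S D \<longleftrightarrow>
     (\<forall>f. bfun S f \<longrightarrow> bfun S (D f)) \<and>
     (\<forall>f g p. p \<in> S \<longrightarrow> (\<forall>q\<in>S. f q = g q) \<longrightarrow> D f p = D g p) \<and>
     (\<forall>f g p. p \<in> S \<longrightarrow> bfun S f \<longrightarrow> bfun S g \<longrightarrow>
        D (\<lambda>q. f q + g q) p = D f p + D g p \<and>
        D (\<lambda>q. f q * g q) p = f p * D g p + D f p * g p) \<and>
     (\<forall>a p. D (\<lambda>_. a) p = 0)"

lemma derivation_bfun: "derivation S D \<Longrightarrow> bfun S f \<Longrightarrow> bfun S (D f)"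
  by (simp add: derivation_def)

lemma derivation_cong:
  "derivation S D \<Longrightarrow> p \<in> S \<Longrightarrow> (\<And>q. q \<in> S \<Longrightarrow> f q = g q) \<Longrightarrow> D f p = D g p"
  unfolding derivation_def by blast

lemma derivation_add:
  "derivation S D \<Longrightarrow> p \<in> S \<Longrightarrow> bfun S f \<Longrightarrow> bfun S g \<Longrightarrow> D (\<lambda>q. f q + g q) p = D f p + D g p"
  by (simp add: derivation_def)

lemma derivation_mult:
  "derivation S D \<Longrightarrow> p \<in> S \<Longrightarrow> bfun S f \<Longrightarrow> bfun S g \<Longrightarrow>
    D (\<lambda>q. f q * g q) p = f p * D g p + D f p * g p"
  by (simp add: derivation_def)

lemma derivation_const: "derivation S D \<Longrightarrow> D (\<lambda>_. a) p = 0"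
  by (simp add: derivation_def)

lemma bproj_add: "bproj p = bproj q \<Longrightarrow> bproj (p + s *\<^sub>R X) = bproj (q + s *\<^sub>R X)"
  by (simp add: bproj_def pz1_def pz2_def pv_def)

lemma bfun_basic: "bfun S f \<Longrightarrow> bproj p = bproj q \<Longrightarrow> f p = f q"
  unfolding bfun_def by blast

lemma bfun_differentiable: "bfun S f \<Longrightarrow> p \<in> S \<Longrightarrow> f differentiable (at p)"
  unfolding bfun_def using smooth_on_differentiable by blast

lemma bfun_const: "bfun S (\<lambda>_. a)"
  by (simp add: bfun_def smooth_on_const)

text \<open>\<open>bfun\<close> demands fibre independence at all points, also outside S, so the two
  functions of s compared here agree along the whole line.\<close>

lemma bfun_Dd: "bfun S f \<Longrightarrow> bfun S (\<lambda>p. Dd f p X)"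
  unfolding bfun_def
proof (intro conjI allI impI)
  fix p q assume a: "smooth_on S f \<and> (\<forall>p q. bproj p = bproj q \<longrightarrow> f p = f q)" "bproj p = bproj q"
  then have "f (p + s *\<^sub>R X) = f (q + s *\<^sub>R X)" for s using bproj_add by blast
  then show "Dd f p X = Dd f q X" by (simp add: Dd_def)
qed (auto intro: smooth_on_Dd)

lemma Dd_bfun:
  assumes f: "bfun S f" and p: "p \<in> S"
  shows "Dd f p X = dZ1 f p * pz1 X + dZ2 f p * pz2 X + dZb1 f p * cnj (pz1 X) + dZb2 f p * cnj (pz2 X)
    + dV f p * of_real (pv X)"
proof -
  define W :: pt where "W = (0, 0, 0, pc X, pe X, ptt X)"
  have X: "X = Re (pz1 X) *\<^sub>R ex1 + Im (pz1 X) *\<^sub>R ey1 + Re (pz2 X) *\<^sub>R ex2 + Im (pz2 X) *\<^sub>R ey2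
      + pv X *\<^sub>R evv + W"
    by (cases X) (simp add: W_def pz1_def pz2_def pv_def pc_def pe_def ptt_def ex1_def ey1_def
        ex2_def ey2_def evv_def complex_eq_iff)
  have "f (p + s *\<^sub>R W) = f p" for s
    by (rule bfun_basic[OF f]) (simp add: W_def bproj_def pz1_def pz2_def pv_def)
  then have W: "Dd f p W = 0" by (simp add: Dd_def)
  have lin: "linear (Dd f p)"
    by (rule has_derivative_linear[OF Dd_has_derivative[OF bfun_differentiable[OF f p]]])
  have "Dd f p X = Re (pz1 X) * Dd f p ex1 + Im (pz1 X) * Dd f p ey1 + Re (pz2 X) * Dd f p ex2
      + Im (pz2 X) * Dd f p ey2 + pv X * Dd f p evv"
    by (subst X) (simp only: linear_add[OF lin] linear_scale[OF lin] W scaleR_conv_of_real add_0_right)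
  then show ?thesis
    unfolding dZ1_def dZ2_def dZb1_def dZb2_def dV_def
    by (simp add: complex_eq_iff field_simps)
qed

locale open_dom =
  fixes S :: "pt set"
  assumes S_open: "open S"
begin

lemma bfun_add [simp]: "bfun S f \<Longrightarrow> bfun S g \<Longrightarrow> bfun S (\<lambda>q. f q + g q)"
  unfolding bfun_def using smooth_on_add[OF S_open] by metis

lemma bfun_mult [simp]: "bfun S f \<Longrightarrow> bfun S g \<Longrightarrow> bfun S (\<lambda>q. f q * g q)"
  unfolding bfun_def using smooth_on_mult[OF S_open] by metis

lemma bfun_uminus [simp]: "bfun S f \<Longrightarrow> bfun S (\<lambda>q. - f q)"
  unfolding bfun_def using smooth_on_uminus[OF S_open] by metis

lemma bfun_diff [simp]: "bfun S f \<Longrightarrow> bfun S g \<Longrightarrow> bfun S (\<lambda>q. f q - g q)"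
  unfolding bfun_def using smooth_on_diff[OF S_open] by metis

lemma bfun_cnj [simp]: "bfun S f \<Longrightarrow> bfun S (\<lambda>q. cnj (f q))"
  unfolding bfun_def using smooth_on_cnj[OF S_open] by metis

lemma bfun_cf [simp]: "bfun S f \<Longrightarrow> bfun S (cf f)"
  using bfun_cnj by (simp add: cf_def[abs_def])

lemma bfun_divide: "bfun S f \<Longrightarrow> bfun S g \<Longrightarrow> \<forall>p\<in>S. g p \<noteq> 0 \<Longrightarrow> bfun S (\<lambda>q. f q / g q)"
  unfolding bfun_def using smooth_on_divide[OF S_open] by metis

lemma bfun_power [simp]: "bfun S f \<Longrightarrow> bfun S (\<lambda>q. f q ^ n)"
  unfolding bfun_def using smooth_on_power[OF S_open] by metis

lemmas [simp] = bfun_const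

lemma derivation_dZ1: "derivation S dZ1"
  and derivation_dZ2: "derivation S dZ2"
  and derivation_dZb1: "derivation S dZb1"
  and derivation_dZb2: "derivation S dZb2"
  and derivation_dV: "derivation S dV"
proof -
  have c: "Dd f p X = Dd g p X" if "p \<in> S" "\<forall>q\<in>S. f q = g q" for f g p X
    using Dd_cong[OF S_open] that by blast
  have m: "bfun S (\<lambda>p. a * Dd f p X + b * Dd f p Y)" if "bfun S f" for a b f X Y
    using that by (simp add: bfun_Dd)
  show "derivation S dV"
    unfolding derivation_def dV_def[abs_def]
    by (auto simp: bfun_Dd Dd_add Dd_mult bfun_differentiable intro: c)
  have w: "derivation S (\<lambda>f p. a * Dd f p X + b * Dd f p Y)" for a b X Y
    unfolding derivation_def
    by (auto simp: m Dd_add Dd_mult bfun_differentiable algebra_simps intro!: arg_cong2[of _ _ _ _ "(+)"] c)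
  have e: "dZ1 = (\<lambda>f p. (1/2) * Dd f p ex1 + (- \<i>/2) * Dd f p ey1)"
    "dZ2 = (\<lambda>f p. (1/2) * Dd f p ex2 + (- \<i>/2) * Dd f p ey2)"
    "dZb1 = (\<lambda>f p. (1/2) * Dd f p ex1 + (\<i>/2) * Dd f p ey1)"
    "dZb2 = (\<lambda>f p. (1/2) * Dd f p ex2 + (\<i>/2) * Dd f p ey2)"
    by (auto simp: fun_eq_iff dZ1_def dZ2_def dZb1_def dZb2_def field_simps)
  show "derivation S dZ1" "derivation S dZ2" "derivation S dZb1" "derivation S dZb2"
    unfolding e by (rule w)+
qed

lemma derivation_comb:
  assumes D: "derivation S D" and E: "derivation S E" and a: "bfun S a"
  shows "derivation S (\<lambda>f p. D f p + a p * E f p)"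
  unfolding derivation_def
proof (intro conjI allI impI)
  fix f g :: "pt \<Rightarrow> complex" and p assume "p \<in> S" "\<forall>q\<in>S. f q = g q"
  then have "D f p = D g p" "E f p = E g p"
    using derivation_cong[OF D, of p f g] derivation_cong[OF E, of p f g] by auto
  then show "D f p + a p * E f p = D g p + a p * E g p" by simp
qed (auto simp: derivation_bfun[OF D] derivation_bfun[OF E] a derivation_add[OF D] derivation_add[OF E]
    derivation_mult[OF D] derivation_mult[OF E] derivation_const[OF D] derivation_const[OF E] algebra_simps)

lemma derivation_scale:
  assumes "derivation S D" "bfun S a"
  shows "derivation S (\<lambda>f p. a p * D f p)"
proof -
  have "derivation S (\<lambda>f p. 0)" by (simp add: derivation_def)
  from derivation_comb[OF this assms] show ?thesis by simp
qed

lemma derivation_uminus: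
  assumes D: "derivation S D" and "p \<in> S" "bfun S f"
  shows "D (\<lambda>q. - f q) p = - D f p"
  using derivation_mult[OF D assms(2) bfun_const[of S "- 1"] assms(3)] derivation_const[OF D] by simp

lemma derivation_diff:
  assumes D: "derivation S D" and "p \<in> S" "bfun S f" "bfun S g"
  shows "D (\<lambda>q. f q - g q) p = D f p - D g p"
  using derivation_add[OF D assms(2,3), of "\<lambda>q. - g q"] derivation_uminus[OF D] assms by simp

text \<open>The quotient rule for an abstract derivation: apply the Leibniz rule to
  \<open>f = (f / g) * g\<close>, which holds on S.\<close>

lemma derivation_divide:
  assumes D: "derivation S D" and p: "p \<in> S" and f: "bfun S f" and g: "bfun S g"
    and nz: "\<forall>q\<in>S. g q \<noteq> 0"
  shows "D (\<lambda>q. f q / g q) p = D f p / g p - f p * D g p / (g p)\<^sup>2"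
proof -
  have "D f p = D (\<lambda>q. f q / g q * g q) p"
    by (rule derivation_cong[OF D p]) (use nz in auto)
  also have "\<dots> = f p / g p * D g p + D (\<lambda>q. f q / g q) p * g p"
    by (rule derivation_mult[OF D p bfun_divide[OF f g nz] g])
  finally show ?thesis using nz p by (simp add: field_simps power2_eq_square)
qed

lemma derivation_square:
  assumes D: "derivation S D" and p: "p \<in> S" and f: "bfun S f"
  shows "D (\<lambda>q. (f q)\<^sup>2) p = 2 * f p * D f p"
  using derivation_mult[OF D p f f] by (simp add: power2_eq_square)

text \<open>When D, E and V commute on f, the bracket of \<open>D + a V\<close> and
  \<open>E + b V\<close> is a multiple of V. With V the derivative in v, this covers every bracket
  among the two fields \<open>L1\<close>, \<open>L2\<close> and their conjugates.\<close>

lemma bracket_graph: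
  assumes D: "derivation S D" and E: "derivation S E" and V: "derivation S V"
    and a: "bfun S a" and b: "bfun S b" and f: "bfun S f" and p: "p \<in> S"
    and DE: "D (E f) p = E (D f) p" and DV: "D (V f) p = V (D f) p" and EV: "E (V f) p = V (E f) p"
  shows "D (\<lambda>q. E f q + b q * V f q) p + a p * V (\<lambda>q. E f q + b q * V f q) p
     - (E (\<lambda>q. D f q + a q * V f q) p + b p * V (\<lambda>q. D f q + a q * V f q) p)
   = ((D b p + a p * V b p) - (E a p + b p * V a p)) * V f p"
  using a b f p
  by (simp add: derivation_add[OF D] derivation_add[OF E] derivation_add[OF V]
    derivation_mult[OF D] derivation_mult[OF E] derivation_mult[OF V]
    derivation_bfun[OF D] derivation_bfun[OF E] derivation_bfun[OF V] DE DV EV algebra_simps)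

lemma partials_commute:
  assumes f: "bfun S f" and p: "p \<in> S"
  shows "dZ1 (dZ2 f) p = dZ2 (dZ1 f) p" "dZ1 (dZb1 f) p = dZb1 (dZ1 f) p" "dZ1 (dZb2 f) p = dZb2 (dZ1 f) p"
    "dZ2 (dZb1 f) p = dZb1 (dZ2 f) p" "dZ2 (dZb2 f) p = dZb2 (dZ2 f) p"
    "dZ1 (dV f) p = dV (dZ1 f) p" "dZ2 (dV f) p = dV (dZ2 f) p"
    "dZb1 (dV f) p = dV (dZb1 f) p" "dZb2 (dV f) p = dV (dZb2 f) p"
proof -
  have sf: "smooth_on S f" using f by (simp add: bfun_def)
  have d: "(\<lambda>q. Dd f q X) differentiable (at p)" for X
    by (rule smooth_on_differentiable[OF smooth_on_Dd[OF sf] p])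
  have l: "Dd (\<lambda>q. (Dd f q X - \<i> * Dd f q Y) / 2) p Z = (Dd (\<lambda>q. Dd f q X) p Z - \<i> * Dd (\<lambda>q. Dd f q Y) p Z) / 2"
    "Dd (\<lambda>q. (Dd f q X + \<i> * Dd f q Y) / 2) p Z = (Dd (\<lambda>q. Dd f q X) p Z + \<i> * Dd (\<lambda>q. Dd f q Y) p Z) / 2"
    for X Y Z
    by (rule Dd_eqI, intro bounded_linear.has_derivative[OF bounded_linear_divide] has_derivative_diff
        has_derivative_add has_derivative_mult_right Dd_has_derivative d)+
  note c = Dd_commute[OF S_open p sf]
  show "dZ1 (dZ2 f) p = dZ2 (dZ1 f) p" "dZ1 (dZb1 f) p = dZb1 (dZ1 f) p" "dZ1 (dZb2 f) p = dZb2 (dZ1 f) p"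
    "dZ2 (dZb1 f) p = dZb1 (dZ2 f) p" "dZ2 (dZb2 f) p = dZb2 (dZ2 f) p"
    "dZ1 (dV f) p = dV (dZ1 f) p" "dZ2 (dV f) p = dV (dZ2 f) p"
    "dZb1 (dV f) p = dV (dZb1 f) p" "dZb2 (dV f) p = dV (dZb2 f) p"
    unfolding dZ1_def[abs_def] dZ2_def[abs_def] dZb1_def[abs_def] dZb2_def[abs_def] dV_def[abs_def] l
      c[of ex2 ex1] c[of ex2 ey1] c[of ey2 ex1] c[of ey2 ey1] c[of ey1 ex1] c[of ey2 ex2]
      c[of evv ex1] c[of evv ex2] c[of evv ey1] c[of evv ey2]
    by (simp_all add: field_simps)
qed

lemma partials_cnj:
  assumes f: "bfun S f" and p: "p \<in> S"
  shows "dZ1 (\<lambda>q. cnj (f q)) p = cnj (dZb1 f p)" "dZ2 (\<lambda>q. cnj (f q)) p = cnj (dZb2 f p)"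
    "dZb1 (\<lambda>q. cnj (f q)) p = cnj (dZ1 f p)" "dZb2 (\<lambda>q. cnj (f q)) p = cnj (dZ2 f p)"
    "dV (\<lambda>q. cnj (f q)) p = cnj (dV f p)"
  using bfun_differentiable[OF f p]
  by (simp_all add: dZ1_def dZ2_def dZb1_def dZb2_def dV_def Dd_cnj)

end

lemma cf_cf [simp]: "cf (cf f) = f"
  by (simp add: cf_def fun_eq_iff)

section \<open>The CR structure of a graph\<close>

definition KKb where "KKb F f p = cnj (kk F p) * Lb1 F f p + Lb2 F f p"

locale cr_graph =
  fixes U :: "(complex \<times> complex \<times> real) set" and F :: "complex \<times> complex \<times> real \<Rightarrow> real"
  assumes U_open: "open U"
    and analytic: "real_analytic_on U F"
    and ell_nz: "\<forall>p\<in>dom_MG U. ell F p \<noteq> 0"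
    and rank_one: "\<forall>p\<in>dom_MG U. levi_rank_one F p"
    and nondeg: "\<forall>p\<in>dom_MG U. Lb1 F (kk F) p \<noteq> 0"
begin

abbreviation "S \<equiv> dom_MG U"
abbreviation "L \<equiv> L1 F"
abbreviation "M \<equiv> Lb1 F"
abbreviation "K \<equiv> KK F"
abbreviation "N \<equiv> KKb F"
abbreviation "T \<equiv> TT F"
abbreviation "k \<equiv> kk F"
abbreviation "kb \<equiv> cf (kk F)"
abbreviation "f0 \<equiv> M k"
abbreviation "P \<equiv> PP F"
abbreviation "Pb \<equiv> cf (PP F)"

sublocale open_dom "dom_MG U"
  by unfold_locales (rule open_dom_MG[OF U_open])

lemma bfun_Fl: "bfun S (Fl F)"
  unfolding bfun_def
  using real_analytic_smooth_on[OF analytic, of S]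
  by (auto simp: dom_MG_def bproj_def Fl_def)

lemma bfun_partial [simp]:
  assumes "bfun S f"
  shows "bfun S (dZ1 f)" "bfun S (dZ2 f)" "bfun S (dZb1 f)" "bfun S (dZb2 f)" "bfun S (dV f)"
  using assms derivation_bfun derivation_dZ1 derivation_dZ2 derivation_dZb1 derivation_dZb2 derivation_dV
  by blast+

lemma cnj_dV_Fl: "cnj (dV (Fl F) p) = dV (Fl F) p" if "p \<in> S"
  using partials_cnj(5)[OF bfun_Fl that] by (simp add: Fl_def[abs_def])

text \<open>F is real, so its v-derivative is real and the denominator has real part 1.\<close>

lemma denominator_nz: "\<forall>p\<in>S. 1 + \<i> * dV (Fl F) p \<noteq> 0"
proof
  fix p assume "p \<in> S"
  then have "Im (dV (Fl F) p) = 0" using cnj_dV_Fl by (metis cnj.sel(2) neg_equal_zero)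
  then show "1 + \<i> * dV (Fl F) p \<noteq> 0" by (simp add: complex_eq_iff)
qed

lemma bfun_A [simp]: "bfun S (A1 F)" "bfun S (A2 F)"
  unfolding A1_def[abs_def] A2_def[abs_def]
  by (intro bfun_divide denominator_nz; simp add: bfun_Fl)+

lemma L1_eq: "L1 F = (\<lambda>f p. dZ1 f p + A1 F p * dV f p)"
  and L2_eq: "L2 F = (\<lambda>f p. dZ2 f p + A2 F p * dV f p)"
  and Lb1_eq: "Lb1 F = (\<lambda>f p. dZb1 f p + cf (A1 F) p * dV f p)"
  and Lb2_eq: "Lb2 F = (\<lambda>f p. dZb2 f p + cf (A2 F) p * dV f p)"
  by (simp_all add: fun_eq_iff L1_def L2_def Lb1_def Lb2_def cf_def)

lemma der_L1: "derivation S (L1 F)" unfolding L1_eq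
  by (intro derivation_comb derivation_dZ1 derivation_dV) simp
lemma der_L2: "derivation S (L2 F)" unfolding L2_eq
  by (intro derivation_comb derivation_dZ2 derivation_dV) simp
lemma der_Lb1: "derivation S (Lb1 F)" unfolding Lb1_eq
  by (intro derivation_comb derivation_dZb1 derivation_dV) simp
lemma der_Lb2: "derivation S (Lb2 F)" unfolding Lb2_eq
  by (intro derivation_comb derivation_dZb2 derivation_dV) simp

lemma bfun_L12 [simp]:
  assumes "bfun S f"
  shows "bfun S (L1 F f)" "bfun S (L2 F f)" "bfun S (Lb1 F f)" "bfun S (Lb2 F f)"
  using assms derivation_bfun der_L1 der_L2 der_Lb1 der_Lb2 by blast+

lemma L_cnj:
  assumes "bfun S f" "p \<in> S"
  shows "L1 F (cf f) p = cnj (Lb1 F f p)" "L2 F (cf f) p = cnj (Lb2 F f p)"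
    "Lb1 F (cf f) p = cnj (L1 F f p)" "Lb2 F (cf f) p = cnj (L2 F f p)"
  using partials_cnj[OF assms] by (simp_all add: L1_def L2_def Lb1_def Lb2_def cf_def[abs_def])

lemma bfun_ell [simp]: "bfun S (ell F)"
  unfolding ell_def[abs_def] by simp

lemma ell_levi: "ell F p = \<i> * levi11 F p"
  by (simp add: ell_def levi11_def)

text \<open>The matrix is skew-Hermitian, being built from brackets without the factor i; hence
  \<open>ell\<close> is real and \<rho>0 is a real form.\<close>

lemma cnj_levi:
  assumes "p \<in> S"
  shows "cnj (levi11 F p) = - levi11 F p" "cnj (levi12 F p) = - levi21 F p"
    "cnj (levi21 F p) = - levi12 F p" "cnj (levi22 F p) = - levi22 F p"
  using assms L_cnj[OF bfun_A(1) assms] L_cnj[OF bfun_A(2) assms]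
  by (simp_all add: levi11_def levi12_def levi21_def levi22_def L_cnj)

lemma cnj_ell: "p \<in> S \<Longrightarrow> cnj (ell F p) = ell F p"
  by (simp add: ell_levi cnj_levi)

lemma levi11_nz: "p \<in> S \<Longrightarrow> levi11 F p \<noteq> 0"
  using ell_nz by (auto simp: ell_levi)

lemma kk_levi: "kk F p = - levi21 F p / levi11 F p"
  by (simp add: kk_def levi11_def levi21_def)

lemma bfun_k [simp]: "bfun S k"
proof -
  have "\<forall>p\<in>S. L1 F (cf (A1 F)) p - Lb1 F (A1 F) p \<noteq> 0"
    using levi11_nz by (simp add: levi11_def)
  then show ?thesis unfolding kk_def[abs_def] by (intro bfun_divide) simp_all
qed

lemma bfun_P [simp]: "bfun S P"
  unfolding PP_def[abs_def] using ell_nz by (intro bfun_divide) simp_all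

lemma K_eq: "K = (\<lambda>f p. L2 F f p + k p * L1 F f p)"
  and N_eq: "N = (\<lambda>f p. Lb2 F f p + cf k p * Lb1 F f p)"
  and T_eq: "T = (\<lambda>f p. ell F p * dV f p)"
  by (simp_all add: fun_eq_iff KK_def KKb_def TT_def cf_def)

lemma der_K: "derivation S K" unfolding K_eq by (intro derivation_comb der_L1 der_L2) simp
lemma der_N: "derivation S N" unfolding N_eq by (intro derivation_comb der_Lb1 der_Lb2) simp
lemma der_T: "derivation S T" unfolding T_eq by (intro derivation_scale derivation_dV) simp

lemmas ders = der_L1 der_Lb1 der_K der_N der_T
lemmas more_ders = ders der_L2 der_Lb2 derivation_dV

lemma bfun_frame [simp]:
  assumes "bfun S f"
  shows "bfun S (K f)" "bfun S (N f)" "bfun S (T f)"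
  using assms derivation_bfun ders by blast+

lemmas D_const = more_ders[THEN derivation_const]
lemmas D_add = more_ders[THEN derivation_add]
lemmas D_mult = more_ders[THEN derivation_mult]
lemmas D_diff = more_ders[THEN derivation_diff]
lemmas D_uminus = more_ders[THEN derivation_uminus]
lemmas D_square = more_ders[THEN derivation_square]
lemmas D_rules = D_const D_add D_mult D_diff D_uminus D_square

lemma frame_cnj:
  assumes "bfun S f" "p \<in> S"
  shows "cnj (L f p) = M (cf f) p" "cnj (M f p) = L (cf f) p" "cnj (K f p) = N (cf f) p"
    "cnj (N f p) = K (cf f) p" "cnj (T f p) = T (cf f) p"
  using assms partials_cnj(5)[OF assms]
  by (simp_all add: L_cnj KK_def KKb_def TT_def cnj_ell cf_def[abs_def] L_cnj[unfolded cf_def[abs_def]])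

lemma frame_cf:
  assumes "bfun S f" "p \<in> S"
  shows "cf (L f) p = M (cf f) p" "cf (M f) p = L (cf f) p" "cf (K f) p = N (cf f) p"
    "cf (N f) p = K (cf f) p" "cf (T f) p = T (cf f) p"
  using frame_cnj[OF assms] by (simp_all add: cf_def[of "_ F f" for f])

section \<open>Brackets of the frame\<close>

text \<open>Integrability of the CR structure. Both sides are quotients in the derivatives of F, and
  the symmetry of the mixed second derivatives makes them agree.\<close>

lemma L1_A2: "p \<in> S \<Longrightarrow> L1 F (A2 F) p = L2 F (A1 F) p"
proof -
  assume p: "p \<in> S"
  note b [simp] = bfun_Fl
  have nz: "1 + \<i> * dV (Fl F) p \<noteq> 0" using denominator_nz p by blast
  let ?u = "\<lambda>q. - \<i> * dZ1 (Fl F) q" and ?v = "\<lambda>q. - \<i> * dZ2 (Fl F) q" and ?w = "\<lambda>q. 1 + \<i> * dV (Fl F) q"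
  have A: "A1 F = (\<lambda>q. ?u q / ?w q)" "A2 F = (\<lambda>q. ?v q / ?w q)"
    by (simp_all add: fun_eq_iff A1_def A2_def)
  have d: "D (\<lambda>q. a q / ?w q) p = D a p / ?w p - a p * D ?w p / (?w p)\<^sup>2" if "derivation S D" "bfun S a" for D a
    by (rule derivation_divide[OF that(1) p that(2) _ denominator_nz]) simp
  have e: "D ?u p = - \<i> * D (dZ1 (Fl F)) p" "D ?v p = - \<i> * D (dZ2 (Fl F)) p" "D ?w p = \<i> * D (dV (Fl F)) p"
    if "derivation S D" for D
    using p by (simp_all add: derivation_uminus[OF that] derivation_add[OF that] derivation_mult[OF that] derivation_const[OF that])
  have "D (A1 F) p = (- \<i> * D (dZ1 (Fl F)) p) / ?w p - ?u p * (\<i> * D (dV (Fl F)) p) / (?w p)\<^sup>2"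
       "D (A2 F) p = (- \<i> * D (dZ2 (Fl F)) p) / ?w p - ?v p * (\<i> * D (dV (Fl F)) p) / (?w p)\<^sup>2"
    if "derivation S D" for D
    unfolding A using d[OF that, of ?u] d[OF that, of ?v] e[OF that] by simp_all
  note e' = this
  define w where "w = 1 + \<i> * dV (Fl F) p"
  have "w \<noteq> 0" using nz by (simp add: w_def)
  then show ?thesis
    unfolding L1_def L2_def e'[OF derivation_dZ1] e'[OF derivation_dZ2] e'[OF derivation_dV]
      partials_commute[OF b p] A1_def A2_def w_def[symmetric]
    by (simp add: field_simps power2_eq_square)
qed

lemma brackets_L:
  assumes f: "bfun S f" and p: "p \<in> S"
  shows "L1 F (Lb1 F f) p - Lb1 F (L1 F f) p = levi11 F p * dV f p"
    "L1 F (Lb2 F f) p - Lb2 F (L1 F f) p = levi12 F p * dV f p"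
    "L2 F (Lb1 F f) p - Lb1 F (L2 F f) p = levi21 F p * dV f p"
    "L2 F (Lb2 F f) p - Lb2 F (L2 F f) p = levi22 F p * dV f p"
    "L1 F (L2 F f) p - L2 F (L1 F f) p = 0"
proof -
  note pc = partials_commute[OF f p]
  note ds = derivation_dZ1 derivation_dZ2 derivation_dZb1 derivation_dZb2 derivation_dV
  show "L1 F (Lb1 F f) p - Lb1 F (L1 F f) p = levi11 F p * dV f p"
    unfolding levi11_def unfolding L1_eq Lb1_eq
    by (rule bracket_graph[OF ds(1,3,5) _ _ f p pc(2,6,8)]) simp_all
  show "L1 F (Lb2 F f) p - Lb2 F (L1 F f) p = levi12 F p * dV f p"
    unfolding levi12_def unfolding L1_eq Lb2_eq
    by (rule bracket_graph[OF ds(1,4,5) _ _ f p pc(3,6,9)]) simp_all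
  show "L2 F (Lb1 F f) p - Lb1 F (L2 F f) p = levi21 F p * dV f p"
    unfolding levi21_def unfolding L2_eq Lb1_eq
    by (rule bracket_graph[OF ds(2,3,5) _ _ f p pc(4,7,8)]) simp_all
  show "L2 F (Lb2 F f) p - Lb2 F (L2 F f) p = levi22 F p * dV f p"
    unfolding levi22_def unfolding L2_eq Lb2_eq
    by (rule bracket_graph[OF ds(2,4,5) _ _ f p pc(5,7,9)]) simp_all
  have "L1 F (L2 F f) p - L2 F (L1 F f) p = (L1 F (A2 F) p - L2 F (A1 F) p) * dV f p"
    unfolding L1_eq L2_eq
    by (rule bracket_graph[OF ds(1,2,5) _ _ f p pc(1,6,7)]) simp_all
  then show "L1 F (L2 F f) p - L2 F (L1 F f) p = 0" using L1_A2[OF p] by simp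
qed

lemma bracket_LM:
  assumes "bfun S f" "p \<in> S"
  shows "L (M f) p = M (L f) p - \<i> * T f p"
  using brackets_L(1)[OF assms] by (simp add: TT_def ell_levi algebra_simps)

text \<open>k is chosen so that the Levi form pairs K with M to zero; this removes the transversal
  term, and only the derivative of the coefficient k survives.\<close>

lemma bracket_KM:
  assumes f: "bfun S f" and p: "p \<in> S"
  shows "K (M f) p = M (K f) p - f0 p * L f p"
proof -
  have "k p * levi11 F p + levi21 F p = 0" using levi11_nz[OF p] by (simp add: kk_levi)
  moreover have "M (K f) p = M (L2 F f) p + k p * M (L f) p + f0 p * L f p"
    using f p by (simp add: K_eq D_rules algebra_simps)
  ultimately show ?thesis
    using brackets_L(1,3)[OF f p] by (simp add: KK_def) algebra
qed

lemma bracket_LK: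
  assumes f: "bfun S f" and p: "p \<in> S"
  shows "L (K f) p = K (L f) p + L k p * L f p"
proof -
  have "L (K f) p = L (L2 F f) p + k p * L (L f) p + L k p * L f p"
    using f p by (simp add: K_eq D_rules algebra_simps)
  then show ?thesis using brackets_L(5)[OF f p] by (simp add: KK_def algebra_simps)
qed

text \<open>Rank one removes the transversal term. The two remaining terms contain derivatives of
  the coefficients k and \<open>kb\<close>, which \<open>K_kb\<close> and \<open>N_k\<close> show to
  vanish.\<close>

lemma bracket_KN_aux:
  assumes f: "bfun S f" and p: "p \<in> S"
  shows "K (N f) p = N (K f) p + K kb p * M f p - N k p * L f p"
proof -
  have l: "levi12 F p * levi21 F p = levi11 F p * levi22 F p"
    using rank_one p by (simp add: levi_rank_one_def)
  have kb: "kb p = - levi12 F p / levi11 F p"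
    by (simp add: cf_def kk_levi cnj_levi[OF p])
  \<comment> \<open>This is the Levi form evaluated on K and its conjugate; the vanishing
    determinant makes it zero.\<close>
  have z: "k p * kb p * levi11 F p + k p * levi12 F p + kb p * levi21 F p + levi22 F p = 0"
    unfolding kb kk_levi using levi11_nz[OF p] l by (simp add: field_simps)
  have "K (N f) p = K (Lb2 F f) p + kb p * K (M f) p + K kb p * M f p"
    using f p by (simp add: N_eq D_rules algebra_simps)
  also have "K (Lb2 F f) p = k p * L (Lb2 F f) p + L2 F (Lb2 F f) p" by (simp add: KK_def)
  also have "K (M f) p = k p * L (M f) p + L2 F (M f) p" by (simp add: KK_def)
  finally have 1: "K (N f) p = k p * L (Lb2 F f) p + L2 F (Lb2 F f) p
     + kb p * (k p * L (M f) p + L2 F (M f) p) + K kb p * M f p" .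
  have "N (K f) p = N (L2 F f) p + k p * N (L f) p + N k p * L f p"
    using f p by (simp add: K_eq D_rules algebra_simps)
  also have "N (L2 F f) p = kb p * M (L2 F f) p + Lb2 F (L2 F f) p" by (simp add: KKb_def cf_def)
  also have "N (L f) p = kb p * M (L f) p + Lb2 F (L f) p" by (simp add: KKb_def cf_def)
  finally have 2: "N (K f) p = kb p * M (L2 F f) p + Lb2 F (L2 F f) p
     + k p * (kb p * M (L f) p + Lb2 F (L f) p) + N k p * L f p" .
  show ?thesis
    unfolding 1 2 using brackets_L(1-4)[OF f p] z by algebra
qed

text \<open>P is by definition the factor in this bracket: the logarithmic L-derivative of
  \<open>ell\<close>, corrected by the bracket of L with the derivative in v.\<close>

lemma bracket_LT:
  assumes f: "bfun S f" and p: "p \<in> S"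
  shows "L (T f) p = T (L f) p + P p * T f p"
proof -
  have "L (dV f) p = dV (L f) p - dV (A1 F) p * dV f p"
    using f p partials_commute(6)[OF f p]
    by (simp add: L1_eq derivation_add[OF derivation_dV] derivation_mult[OF derivation_dV] algebra_simps)
  moreover have "L (T f) p = ell F p * L (dV f) p + L (ell F) p * dV f p"
    using f p by (simp add: T_eq D_rules)
  moreover have "P p * ell F p = L (ell F) p - ell F p * dV (A1 F) p"
    using ell_nz p by (simp add: PP_def L1_def)
  ultimately show ?thesis by (simp add: TT_def) algebra
qed

text \<open>The conjugate of \<open>bracket_KM\<close>: apply it to \<open>cf f\<close>, conjugate,
  and rewrite the inner functions on S by locality. \<open>bracket_MN\<close>,
  \<open>bracket_MT\<close> and \<open>bracket_NT\<close> arise in the same way.\<close>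

lemma bracket_NL:
  assumes f: "bfun S f" and p: "p \<in> S"
  shows "N (L f) p = L (N f) p - L kb p * M f p"
proof -
  have "cnj (K (M (cf f)) p) = cnj (M (K (cf f)) p - f0 p * L (cf f) p)"
    using bracket_KM[of "cf f" p] f p by simp
  moreover have "N (cf (M (cf f))) p = N (L f) p"
    by (rule derivation_cong[OF der_N p]) (use f in \<open>simp add: frame_cf\<close>)
  moreover have "L (cf (K (cf f))) p = L (N f) p"
    by (rule derivation_cong[OF der_L1 p]) (use f in \<open>simp add: frame_cf\<close>)
  ultimately show ?thesis using f p by (simp add: frame_cnj)
qed

lemma bracket_MN:
  assumes f: "bfun S f" and p: "p \<in> S"
  shows "M (N f) p = N (M f) p + M kb p * M f p"
proof -
  have "cnj (L (K (cf f)) p) = cnj (K (L (cf f)) p + L k p * L (cf f) p)"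
    using bracket_LK[of "cf f" p] f p by simp
  moreover have "M (cf (K (cf f))) p = M (N f) p"
    by (rule derivation_cong[OF der_Lb1 p]) (use f in \<open>simp add: frame_cf\<close>)
  moreover have "N (cf (L (cf f))) p = N (M f) p"
    by (rule derivation_cong[OF der_N p]) (use f in \<open>simp add: frame_cf\<close>)
  ultimately show ?thesis using f p by (simp add: frame_cnj)
qed

lemma bracket_MT:
  assumes f: "bfun S f" and p: "p \<in> S"
  shows "M (T f) p = T (M f) p + Pb p * T f p"
proof -
  have "cnj (L (T (cf f)) p) = cnj (T (L (cf f)) p + P p * T (cf f) p)"
    using bracket_LT[of "cf f" p] f p by simp
  moreover have "M (cf (T (cf f))) p = M (T f) p"
    by (rule derivation_cong[OF der_Lb1 p]) (use f in \<open>simp add: frame_cf\<close>)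
  moreover have "T (cf (L (cf f))) p = T (M f) p"
    by (rule derivation_cong[OF der_T p]) (use f in \<open>simp add: frame_cf\<close>)
  ultimately show ?thesis using f p by (simp add: frame_cnj cf_def[of P])
qed

text \<open>T is i times the bracket of L and M, so the brackets of K with L and M determine the one
  with T.\<close>

lemma bracket_KT:
  assumes f: "bfun S f" and p: "p \<in> S"
  shows "K (T f) p = T (K f) p - L k p * T f p - T k p * L f p"
proof -
  have T: "T g q = \<i> * (L (M g) q - M (L g) q)" if "bfun S g" "q \<in> S" for g q
    unfolding bracket_LM[OF that] by (simp add: algebra_simps)
  have "K (T f) p = K (\<lambda>q. \<i> * (L (M f) q - M (L f) q)) p"
    by (rule derivation_cong[OF der_K p]) (use T f in simp)
  also have "\<dots> = \<i> * (K (L (M f)) p - K (M (L f)) p)"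
    using f p by (simp add: D_rules)
  finally have 1: "K (T f) p = \<i> * (K (L (M f)) p - K (M (L f)) p)" .
  have "L (K (M f)) p = L (\<lambda>q. M (K f) q - f0 q * L f q) p"
    by (rule derivation_cong[OF der_L1 p]) (use bracket_KM f in simp)
  then have 2: "L (K (M f)) p = L (M (K f)) p - f0 p * L (L f) p - L f0 p * L f p"
    using f p by (simp add: D_rules algebra_simps)
  have "M (K (L f)) p = M (\<lambda>q. L (K f) q - L k q * L f q) p"
    by (rule derivation_cong[OF der_Lb1 p]) (use bracket_LK f in simp)
  then have 3: "M (K (L f)) p = M (L (K f)) p - L k p * M (L f) p - M (L k) p * L f p"
    using f p by (simp add: D_rules algebra_simps)
  have 4: "K (L (M f)) p = L (K (M f)) p - L k p * L (M f) p"
    using bracket_LK[of "M f" p] f p by simp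
  have 5: "K (M (L f)) p = M (K (L f)) p - f0 p * L (L f) p"
    using bracket_KM[of "L f" p] f p by simp
  have "T (K f) p = \<i> * (L (M (K f)) p - M (L (K f)) p)" "T k p = \<i> * (L f0 p - M (L k) p)"
      "T f p = \<i> * (L (M f) p - M (L f) p)"
    using T f p by simp_all
  then show ?thesis unfolding 1 4 2 5 3 by algebra
qed

lemma bracket_NT:
  assumes f: "bfun S f" and p: "p \<in> S"
  shows "N (T f) p = T (N f) p - M kb p * T f p - T kb p * M f p"
proof -
  have "cnj (K (T (cf f)) p) = cnj (T (K (cf f)) p - L k p * T (cf f) p - T k p * L (cf f) p)"
    using bracket_KT[of "cf f" p] f p by simp
  moreover have "N (cf (T (cf f))) p = N (T f) p"
    by (rule derivation_cong[OF der_N p]) (use f in \<open>simp add: frame_cf\<close>)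
  moreover have "T (cf (K (cf f))) p = T (N f) p"
    by (rule derivation_cong[OF der_T p]) (use f in \<open>simp add: frame_cf\<close>)
  ultimately show ?thesis using f p by (simp add: frame_cnj)
qed

section \<open>Jacobi identities and their consequences\<close>

lemma coordinate_derivatives:
  assumes p: "p \<in> S"
  shows "bfun S pz1" "L pz1 p = 1" "M pz1 p = 0" "T pz1 p = 0"
    "bfun S (cf pz1)" "L (cf pz1) p = 0" "M (cf pz1) p = 1" "T (cf pz1) p = 0"
    "bfun S (\<lambda>p. of_real (pv p))" "T (\<lambda>p. of_real (pv p)) p = ell F p"
proof -
  have l1: "bounded_linear pz1" unfolding pz1_def[abs_def] by (rule bounded_linear_fst)
  have l2: "bounded_linear (cf pz1)"
    unfolding cf_def[abs_def] by (rule bounded_linear_compose[OF bounded_linear_cnj l1])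
  have l3: "bounded_linear (\<lambda>p. complex_of_real (pv p))"
    unfolding pv_def[abs_def]
    by (intro bounded_linear_compose[OF bounded_linear_of_real] bounded_linear_compose[OF bounded_linear_fst]
        bounded_linear_compose[OF bounded_linear_snd] bounded_linear_snd)
  show "bfun S pz1" "bfun S (cf pz1)" "bfun S (\<lambda>p. of_real (pv p))"
    using l1 l2 l3 by (auto simp: bfun_def smooth_on_blinear bproj_def cf_def)
  show "L pz1 p = 1" "M pz1 p = 0" "T pz1 p = 0" "L (cf pz1) p = 0" "M (cf pz1) p = 1" "T (cf pz1) p = 0"
    "T (\<lambda>p. of_real (pv p)) p = ell F p"
    unfolding L1_def Lb1_def TT_def dZ1_def dZb1_def dV_def Dd_blinear[OF l1] Dd_blinear[OF l2] Dd_blinear[OF l3]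
    by (simp_all add: cf_def pz1_def pv_def ex1_def ey1_def evv_def)
qed

text \<open>The test functions are z1 for a, its conjugate for b, and then v for c, since
  \<open>T v = ell\<close>. In the Jacobi identities below the second-order terms and the K- and
  N-components cancel beforehand, so these three fields suffice.\<close>

lemma frame_independent:
  assumes p: "p \<in> S" and "\<And>f. bfun S f \<Longrightarrow> a * L f p + b * M f p + c * T f p = 0"
  shows "a = 0" "b = 0" "c = 0"
proof -
  note cd = coordinate_derivatives[OF p]
  show a: "a = 0" using assms(2)[OF cd(1)] cd by simp
  show b: "b = 0" using assms(2)[OF cd(5)] cd by simp
  show "c = 0" using assms(2)[OF cd(9)] cd ell_nz p a b by auto
qed

text \<open>Jacobi identity for K, N and L. The bracket of K and N contributes \<open>K kb\<close>
  times M, and bracketing that with L produces T; hence the T-component is a multiple of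
  \<open>K kb\<close>.\<close>

lemma K_kb:
  assumes p: "p \<in> S"
  shows "K kb p = 0"
proof -
  let ?x = "L (K kb) p - L k p * L kb p - K (L kb) p" and ?y = "N (L k) p + L kb p * f0 p - L (N k) p"
  have "?y * L f p + ?x * M f p + (- \<i> * K kb p) * T f p = 0" if f: "bfun S f" for f
  proof -
    have 1: "K (N (L f)) p = N (K (L f)) p + K kb p * M (L f) p - N k p * L (L f) p"
      using bracket_KN_aux[of "L f"] f p by simp
    have "K (N (L f)) p = K (\<lambda>q. L (N f) q - L kb q * M f q) p"
      by (rule derivation_cong[OF der_K p]) (use bracket_NL f in simp)
    then have 2: "K (N (L f)) p = K (L (N f)) p - L kb p * K (M f) p - K (L kb) p * M f p"
      using f p by (simp add: D_rules algebra_simps)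
    have 3: "K (L (N f)) p = L (K (N f)) p - L k p * L (N f) p"
      using bracket_LK[of "N f"] f p by simp
    have "L (K (N f)) p = L (\<lambda>q. N (K f) q + K kb q * M f q - N k q * L f q) p"
      by (rule derivation_cong[OF der_L1 p]) (use bracket_KN_aux f in simp)
    then have 4: "L (K (N f)) p = L (N (K f)) p + K kb p * L (M f) p + L (K kb) p * M f p
        - N k p * L (L f) p - L (N k) p * L f p"
      using f p by (simp add: D_rules algebra_simps)
    have "N (K (L f)) p = N (\<lambda>q. L (K f) q - L k q * L f q) p"
      by (rule derivation_cong[OF der_N p]) (use bracket_LK f in simp)
    then have 5: "N (K (L f)) p = N (L (K f)) p - L k p * N (L f) p - N (L k) p * L f p"
      using f p by (simp add: D_rules algebra_simps)
    have 6: "N (L (K f)) p = L (N (K f)) p - L kb p * M (K f) p"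
      using bracket_NL[of "K f"] f p by simp
    show ?thesis
      using 1 2 3 4 5 6 bracket_NL[OF f p] bracket_KM[OF f p] bracket_LM[OF f p] by algebra
  qed
  from frame_independent(3)[OF p this] show ?thesis by simp
qed

lemma N_k: "p \<in> S \<Longrightarrow> N k p = 0"
  using K_kb[of p] frame_cnj(4)[of k p] by (metis bfun_k complex_cnj_zero_iff)

lemma bracket_KN:
  assumes "bfun S f" "p \<in> S"
  shows "K (N f) p = N (K f) p"
  using bracket_KN_aux[OF assms] K_kb N_k assms by simp

text \<open>The T-component of the Jacobi identity for L, M and T. The two sides are conjugate to
  each other, so it says that \<open>M P\<close> is real; \<open>Re_torsion\<close> relies on
  this.\<close>

lemma L_Pb:
  assumes p: "p \<in> S"
  shows "L Pb p = M P p"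
proof -
  have "0 * L f p + 0 * M f p + (L Pb p - M P p) * T f p = 0" if f: "bfun S f" for f
  proof -
    have "M (L (T f)) p = M (\<lambda>q. T (L f) q + P q * T f q) p"
      by (rule derivation_cong[OF der_Lb1 p]) (use bracket_LT f in simp)
    then have 1: "M (L (T f)) p = M (T (L f)) p + P p * M (T f) p + M P p * T f p"
      using f p by (simp add: D_rules algebra_simps)
    have "L (M (T f)) p = L (\<lambda>q. T (M f) q + Pb q * T f q) p"
      by (rule derivation_cong[OF der_L1 p]) (use bracket_MT f in simp)
    then have 2: "L (M (T f)) p = L (T (M f)) p + Pb p * L (T f) p + L Pb p * T f p"
      using f p by (simp add: D_rules algebra_simps)
    have "T (L (M f)) p = T (\<lambda>q. M (L f) q - \<i> * T f q) p"
      by (rule derivation_cong[OF der_T p]) (use bracket_LM f in simp)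
    then have 3: "T (L (M f)) p = T (M (L f)) p - \<i> * T (T f) p"
      using f p by (simp add: D_rules algebra_simps)
    show ?thesis
      using 1 2 3 bracket_LT[of "M f" p] bracket_MT[of "L f" p] bracket_LM[of "T f" p] bracket_LM[OF f p]
        bracket_LT[OF f p] bracket_MT[OF f p] f p by simp algebra
  qed
  from frame_independent(3)[OF p this] show ?thesis by simp
qed

text \<open>The T-component of the Jacobi identity for N, L and T; \<open>K_P\<close> comes from K,
  L and T in the same way.\<close>

lemma N_P:
  assumes p: "p \<in> S"
  shows "N P p = - L kb p * Pb p - L (M kb) p + \<i> * T kb p"
proof -
  let ?x = "L (T kb) p - T (L kb) p - P p * T kb p"
  have "0 * L f p + ?x * M f p + (N P p - (- L kb p * Pb p - L (M kb) p + \<i> * T kb p)) * T f p = 0"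
    if f: "bfun S f" for f
  proof -
    have "N (L (T f)) p = N (\<lambda>q. T (L f) q + P q * T f q) p"
      by (rule derivation_cong[OF der_N p]) (use bracket_LT f in simp)
    then have 1: "N (L (T f)) p = N (T (L f)) p + P p * N (T f) p + N P p * T f p"
      using f p by (simp add: D_rules algebra_simps)
    have "L (N (T f)) p = L (\<lambda>q. T (N f) q - M kb q * T f q - T kb q * M f q) p"
      by (rule derivation_cong[OF der_L1 p]) (use bracket_NT f in simp)
    then have 2: "L (N (T f)) p = L (T (N f)) p - M kb p * L (T f) p - L (M kb) p * T f p
        - T kb p * L (M f) p - L (T kb) p * M f p"
      using f p by (simp add: D_rules algebra_simps)
    have "T (N (L f)) p = T (\<lambda>q. L (N f) q - L kb q * M f q) p"
      by (rule derivation_cong[OF der_T p]) (use bracket_NL f in simp)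
    then have 3: "T (N (L f)) p = T (L (N f)) p - L kb p * T (M f) p - T (L kb) p * M f p"
      using f p by (simp add: D_rules algebra_simps)
    show ?thesis
      using 1 2 3 bracket_LT[of "N f" p] bracket_NT[of "L f" p] bracket_NL[of "T f" p] bracket_LM[OF f p]
        bracket_LT[OF f p] bracket_MT[OF f p] bracket_NT[OF f p] f p by simp algebra
  qed
  from frame_independent(3)[OF p this] show ?thesis by simp
qed

lemma K_P:
  assumes p: "p \<in> S"
  shows "K P p = - L k p * P p - L (L k) p"
proof -
  let ?y = "L (T k) p - T (L k) p - P p * T k p"
  have "?y * L f p + 0 * M f p + (K P p - (- L k p * P p - L (L k) p)) * T f p = 0"
    if f: "bfun S f" for f
  proof -
    have "K (L (T f)) p = K (\<lambda>q. T (L f) q + P q * T f q) p"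
      by (rule derivation_cong[OF der_K p]) (use bracket_LT f in simp)
    then have 1: "K (L (T f)) p = K (T (L f)) p + P p * K (T f) p + K P p * T f p"
      using f p by (simp add: D_rules algebra_simps)
    have "L (K (T f)) p = L (\<lambda>q. T (K f) q - L k q * T f q - T k q * L f q) p"
      by (rule derivation_cong[OF der_L1 p]) (use bracket_KT f in simp)
    then have 2: "L (K (T f)) p = L (T (K f)) p - L k p * L (T f) p - L (L k) p * T f p
        - T k p * L (L f) p - L (T k) p * L f p"
      using f p by (simp add: D_rules algebra_simps)
    have "T (L (K f)) p = T (\<lambda>q. K (L f) q + L k q * L f q) p"
      by (rule derivation_cong[OF der_T p]) (use bracket_LK f in simp)
    then have 3: "T (L (K f)) p = T (K (L f)) p + L k p * T (L f) p + T (L k) p * L f p"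
      using f p by (simp add: D_rules algebra_simps)
    show ?thesis
      using 1 2 3 bracket_LT[of "K f" p] bracket_KT[of "L f" p] bracket_LK[of "T f" p]
        bracket_LT[OF f p] bracket_KT[OF f p] f p by simp algebra
  qed
  from frame_independent(3)[OF p this] show ?thesis by simp
qed

text \<open>The conjugate of \<open>N_P\<close>. One term in \<open>T k\<close> comes from there;
  exchanging L and M on k gives the second, hence the factor 2.\<close>

lemma K_Pb:
  assumes p: "p \<in> S"
  shows "K Pb p = - f0 p * P p - L f0 p - 2 * \<i> * T k p"
proof -
  have "cnj (N P p) = cnj (- L kb p * Pb p - L (M kb) p + \<i> * T kb p)"
    using N_P[OF p] by simp
  moreover have "M (cf (M kb)) p = M (L k) p"
    by (rule derivation_cong[OF der_Lb1 p]) (simp add: frame_cf)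
  ultimately have "K Pb p = - f0 p * P p - M (L k) p - \<i> * T k p"
    using p by (simp add: frame_cnj) (simp add: cf_def)
  then show ?thesis using bracket_LM[OF bfun_k p] by simp
qed

lemma N_Pb:
  assumes p: "p \<in> S"
  shows "N Pb p = - M kb p * Pb p - M (M kb) p"
proof -
  have "cnj (K P p) = cnj (- L k p * P p - L (L k) p)"
    using K_P[OF p] by simp
  moreover have "M (cf (L k)) p = M (M kb) p"
    by (rule derivation_cong[OF der_Lb1 p]) (simp add: frame_cf)
  ultimately show ?thesis
    using p by (simp add: frame_cnj) (simp add: cf_def)
qed


section \<open>The invariants along the frame\<close>

abbreviation "f1 \<equiv> M f0"
abbreviation "B \<equiv> B0 F"
abbreviation "Bb \<equiv> cf (B0 F)"
abbreviation "H \<equiv> H0 F"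
abbreviation "W \<equiv> W0 F"

lemma f0_nz: "p \<in> S \<Longrightarrow> f0 p \<noteq> 0"
  using nondeg by blast

lemma L_kb: "p \<in> S \<Longrightarrow> L kb p = cnj (f0 p)"
  by (simp add: L_cnj)

lemma bfun_B [simp]: "bfun S B"
  unfolding B0_def[abs_def] using nondeg by (intro bfun_diff bfun_divide) simp_all

lemma bfun_H [simp]: "bfun S H"
proof -
  have p2: "\<forall>p\<in>S. (f0 p)\<^sup>2 \<noteq> 0" using nondeg by simp
  show ?thesis unfolding H0_def[abs_def]
    by (intro bfun_add bfun_diff bfun_divide nondeg p2 bfun_mult bfun_const bfun_power) simp_all
qed

lemma bfun_W [simp]: "bfun S W"
proof -
  have p2: "\<forall>p\<in>S. (f0 p)\<^sup>2 \<noteq> 0" "\<forall>p\<in>S. (f0 p) ^ 3 \<noteq> 0" "\<forall>p\<in>S. L kb p \<noteq> 0"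
    using nondeg by (simp_all add: L_kb)
  show ?thesis unfolding W0_def[abs_def]
    by (intro bfun_add bfun_diff bfun_divide nondeg p2 bfun_mult bfun_const) simp_all
qed

text \<open>\<open>B0\<close> solved for the second M-derivative of k. Higher derivatives of k are
  from here on replaced by derivatives of \<open>f0\<close>, B and \<open>Pb\<close>.\<close>

lemma f1_eq: "p \<in> S \<Longrightarrow> f1 p = f0 p * (B p + Pb p)"
  using f0_nz by (simp add: B0_def cf_def)

lemma derivation_f1:
  assumes D: "derivation S D" and p: "p \<in> S"
  shows "D f1 p = D f0 p * (B p + Pb p) + f0 p * (D B p + D Pb p)"
proof -
  have "D f1 p = D (\<lambda>q. f0 q * (B q + Pb q)) p"
    by (rule derivation_cong[OF D p]) (rule f1_eq)
  then show ?thesis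
    using p by (simp add: derivation_add[OF D] derivation_mult[OF D])
qed

text \<open>Differentiate \<open>N k = 0\<close> along M and exchange the two fields.\<close>

lemma N_f0:
  assumes p: "p \<in> S"
  shows "N f0 p = - M kb p * f0 p"
proof -
  have "M (N k) p = M (\<lambda>q. 0) p"
    by (rule derivation_cong[OF der_Lb1 p]) (rule N_k)
  then show ?thesis
    using bracket_MN[of k p] p by (simp add: D_const algebra_simps eq_neg_iff_add_eq_0)
qed

text \<open>Under N both \<open>f0\<close> and B are multiplied by \<open>- M kb\<close>, and
  \<open>N_H\<close> gives twice this factor for H. With these weights the coefficients of \<rho> ^
  conj \<zeta> cancel in d\<kappa>0' and d\<zeta>0''.\<close>

lemma N_B:
  assumes p: "p \<in> S"
  shows "N B p = - M kb p * B p"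
proof -
  have "M (N f0) p = M (\<lambda>q. - M kb q * f0 q) p"
    by (rule derivation_cong[OF der_Lb1 p]) (rule N_f0)
  then have "M (N f0) p = - M kb p * f1 p - M (M kb) p * f0 p"
    using p by (simp add: D_rules)
  moreover have "M (N f0) p = N f1 p + M kb p * f1 p"
    using bracket_MN[of f0 p] p by simp
  ultimately have "N f1 p = - M kb p * f1 p - M (M kb) p * f0 p - M kb p * f1 p"
    by algebra
  then have "f0 p * (N B p + M kb p * B p) = 0"
    using derivation_f1[OF der_N p] N_f0[OF p] N_Pb[OF p] f1_eq[OF p] by algebra
  then show ?thesis using f0_nz[OF p] by (simp add: eq_neg_iff_add_eq_0)
qed

lemma H_eq:
  assumes p: "p \<in> S"
  shows "H p = - (1/6) * (M B p - B p * Pb p - (B p)\<^sup>2 / 3)"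
proof -
  have 1: "M f1 p = f1 p * (B p + Pb p) + f0 p * (M B p + M Pb p)"
    by (rule derivation_f1[OF der_Lb1 p])
  have "cnj (P p) = Pb p" by (simp add: cf_def)
  then show ?thesis
    unfolding H0_def 1 f1_eq[OF p] using f0_nz[OF p]
    by (simp add: field_simps power2_eq_square)
qed

lemma derivation_H:
  assumes D: "derivation S D" and p: "p \<in> S"
  shows "D H p = - (1/6) * (D (M B) p - D B p * Pb p - B p * D Pb p - 2 / 3 * B p * D B p)"
proof -
  have *: "D (\<lambda>q. b * (M B q - B q * Pb q - a * (B q)\<^sup>2)) p
      = b * (D (M B) p - (B p * D Pb p + D B p * Pb p) - a * (2 * B p * D B p))" for a b
    using p by (simp add: derivation_mult[OF D] derivation_diff[OF D] derivation_const[OF D] derivation_square[OF D])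
  have "D H p = D (\<lambda>q. (- (1/6)) * (M B q - B q * Pb q - (1/3) * (B q)\<^sup>2)) p"
    by (rule derivation_cong[OF D p]) (simp add: H_eq)
  then show ?thesis unfolding * by (simp add: algebra_simps)
qed

lemma N_H:
  assumes p: "p \<in> S"
  shows "N H p = - 2 * M kb p * H p"
proof -
  have "M (N B) p = M (\<lambda>q. - M kb q * B q) p"
    by (rule derivation_cong[OF der_Lb1 p]) (rule N_B)
  then have "M (N B) p = - M kb p * M B p - M (M kb) p * B p"
    using p by (simp add: D_rules)
  moreover have "M (N B) p = N (M B) p + M kb p * M B p"
    using bracket_MN[of B p] p by simp
  ultimately have nmb: "N (M B) p = - M kb p * M B p - M (M kb) p * B p - M kb p * M B p"
    by algebra
  show ?thesis
    unfolding derivation_H[OF der_N p] nmb H_eq[OF p] N_B[OF p] N_Pb[OF p]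
    by (simp add: field_simps power2_eq_square)
qed

text \<open>The first two terms of \<open>W0\<close> are \<open>- 1 / (3 f0)\<close> times K applied
  to \<open>f1 / f0 = B + Pb\<close>. Expanding \<open>K Pb\<close> completes the thirds in front of
  \<open>L f0\<close>, P and \<open>T k\<close>.\<close>

lemma W_eq:
  assumes p: "p \<in> S"
  shows "W p = L f0 p / f0 p + P p + 2 / 3 * cnj (B p) + \<i> * T k p / f0 p - K B p / (3 * f0 p)"
proof -
  have "L (L kb) p = L (cf f0) p"
    by (rule derivation_cong[OF der_L1 p]) (simp add: L_kb cf_def)
  then have LL: "L (L kb) p = cnj (f1 p)" using p by (simp add: L_cnj)
  have b: "cnj (B p) = cnj (f1 p) / cnj (f0 p) - P p" by (simp add: B0_def)
  show ?thesis
    unfolding W0_def LL L_kb[OF p] b derivation_f1[OF der_K p] K_Pb[OF p] f1_eq[OF p]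
    using f0_nz[OF p] by (simp add: field_simps power2_eq_square power3_eq_cube)
qed

lemma K_B:
  assumes p: "p \<in> S"
  shows "K B p = 3 * L f0 p + f0 p * (3 * P p + 2 * Bb p - 3 * W p) + 3 * \<i> * T k p"
  unfolding W_eq[OF p] using f0_nz[OF p] by (simp add: field_simps cf_def)

text \<open>Needed because \<open>K H\<close> contains \<open>K (M B)\<close>. The coefficient 6 of
  \<open>M P\<close> has two equal sources: P itself in \<open>K_B\<close>, and \<open>L Pb\<close>
  from \<open>L f1\<close>.\<close>

lemma M_K_B:
  assumes p: "p \<in> S"
  shows "M (K B) p = (B p + Pb p) * K B p
    + f0 p * (3 * L B p + 6 * M P p + 2 * M Bb p - 3 * M W p) + 6 * \<i> * T f0 p - 3 * \<i> * B p * T k p"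
proof -
  have "M (K B) p = M (\<lambda>q. 3 * L f0 q + f0 q * (3 * P q + 2 * Bb q - 3 * W q) + 3 * \<i> * T k q) p"
    by (rule derivation_cong[OF der_Lb1 p]) (rule K_B)
  also have "\<dots> = 3 * M (L f0) p + f0 p * (3 * M P p + 2 * M Bb p - 3 * M W p)
      + f1 p * (3 * P p + 2 * Bb p - 3 * W p) + 3 * \<i> * M (T k) p"
    using p by (simp add: D_rules)
  also have "M (L f0) p = L f1 p + \<i> * T f0 p" using bracket_LM[of f0 p] p by simp
  also have "M (T k) p = T f0 p + Pb p * T k p" using bracket_MT[of k p] p by simp
  finally show ?thesis
    unfolding derivation_f1[OF der_L1 p] L_Pb[OF p] f1_eq[OF p] K_B[OF p] by algebra
qed

text \<open>The left side is the coefficient of \<rho>0 ^ \<zeta>0'' in d\<zeta>0'' without two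
  terms whose sum is imaginary. Eliminating \<open>K B\<close> and \<open>M (K B)\<close> brings in
  W.\<close>

lemma Re_torsion:
  assumes p: "p \<in> S"
  shows "Re (T f0 p / f0 p - \<i> / 3 * B p * L f0 p / f0 p + \<i> / 3 * cnj (B p) * f1 p / f0 p - \<i> * K H p / f0 p)
    = Re (- (\<i>/2) * M W p + (\<i>/2) * (- (1/3) * f1 p / f0 p + (1/3) * cnj (P p)) * W p)"
proof -
  have KMB: "K (M B) p = M (K B) p - f0 p * L B p" using bracket_KM[of B p] p by simp
  have c: "Bb p = cnj (B p)" "Pb p = cnj (P p)" by (simp_all add: cf_def)
  \<comment> \<open>Each of the four is i times a quantity equal to its own conjugate. For
    \<open>?z\<close> this is \<open>L_Pb\<close>; for \<open>?x\<close> and \<open>?w\<close> the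
    two summands are conjugate to each other.\<close>
  let ?x = "\<i> * (L B p + M Bb p)" and ?y = "\<i> * (B p * cnj (B p))"
    and ?z = "\<i> * M P p" and ?w = "\<i> * (B p * P p + cnj (B p) * cnj (P p))"
  have "cnj (L B p) = M Bb p" "cnj (M Bb p) = L B p" "cnj (M P p) = M P p"
    using p frame_cnj(1)[of B p] frame_cnj(2)[of Bb p] frame_cnj(2)[of P p] L_Pb[OF p] by simp_all
  then have "cnj (L B p + M Bb p) = L B p + M Bb p" "cnj (M P p) = M P p"
    "cnj (B p * cnj (B p)) = B p * cnj (B p)"
    "cnj (B p * P p + cnj (B p) * cnj (P p)) = B p * P p + cnj (B p) * cnj (P p)"
    by simp_all
  then have im: "Re ?x = 0" "Re ?y = 0" "Re ?z = 0" "Re ?w = 0"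
    by (simp_all add: complex_eq_iff)
  have "T f0 p / f0 p - \<i> / 3 * B p * L f0 p / f0 p + \<i> / 3 * cnj (B p) * f1 p / f0 p - \<i> * K H p / f0 p
    = (- (\<i>/2) * M W p + (\<i>/2) * (- (1/3) * f1 p / f0 p + (1/3) * cnj (P p)) * W p)
     + (1/3) * ?x + (4/9) * ?y + ?z + (1/3) * ?w"
    unfolding derivation_H[OF der_K p] KMB M_K_B[OF p] K_Pb[OF p] f1_eq[OF p] K_B[OF p] c
    using f0_nz[OF p] by (simp add: field_simps power2_eq_square)
  then show ?thesis using im by simp
qed

section \<open>Structure equations on the hypersurface\<close>

lemma rho0_real: "p \<in> S \<Longrightarrow> cnj (rho0 F p X) = rho0 F p X"
  by (simp add: rho0_def cnj_ell algebra_simps)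

lemma bfun_rho0: "bfun S (\<lambda>q. rho0 F q X)"
  unfolding rho0_def using ell_nz
  by (intro bfun_divide bfun_diff bfun_mult bfun_const bfun_cnj) simp_all

text \<open>The coframe dual to T, L, K, M, N consists of \<rho>0, \<open>dz1 - k dz2\<close>,
  \<open>dz2\<close> and the conjugates of the last two.\<close>

lemma Dd_frame:
  assumes g: "bfun S g" and p: "p \<in> S"
  shows "Dd g p X = T g p * rho0 F p X + L g p * (pz1 X - k p * pz2 X) + K g p * pz2 X
    + M g p * cnj (pz1 X - k p * pz2 X) + N g p * cnj (pz2 X)"
proof -
  have v: "complex_of_real (pv X) = ell F p * rho0 F p X + A1 F p * pz1 X + A2 F p * pz2 X
      + cnj (A1 F p) * cnj (pz1 X) + cnj (A2 F p) * cnj (pz2 X)"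
    unfolding rho0_def using ell_nz p by simp
  show ?thesis
    unfolding Dd_bfun[OF assms] v KK_def KKb_def L1_def L2_def Lb1_def Lb2_def TT_def
    by (simp add: algebra_simps)
qed

abbreviation wd :: "pt \<Rightarrow> pt \<Rightarrow> (pt \<Rightarrow> complex) \<Rightarrow> (pt \<Rightarrow> complex) \<Rightarrow> complex" where
  "wd X Y \<theta> \<eta> \<equiv> \<theta> X * \<eta> Y - \<theta> Y * \<eta> X"

text \<open>Expand $d(dv) = 0$ in the frame; the brackets of the frame, evaluated on $v$, isolate $d\rho_0$
  because $\mathcal T v = \ell \neq 0$.\<close>

lemma dform_rho0:
  assumes p: "p \<in> S"
  defines "c \<equiv> \<lambda>X. pz1 X - k p * pz2 X" and "r \<equiv> \<lambda>X. rho0 F p X"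
  shows "dform (rho0 F) p X Y = P p * wd X Y r c - L k p * wd X Y r pz2 + Pb p * wd X Y r (\<lambda>X. cnj (c X))
      - M kb p * wd X Y r (\<lambda>X. cnj (pz2 X)) + \<i> * wd X Y c (\<lambda>X. cnj (c X))"
proof -
  define g where "g = (\<lambda>p. complex_of_real (pv p))"
  have g: "bfun S g" and Tg: "T g p = ell F p"
    using coordinate_derivatives(9,10)[OF p] by (simp_all add: g_def)
  have sg: "smooth_on S g" using g by (simp add: bfun_def)
  have dd: "h differentiable (at p)" if "bfun S h" for h by (rule bfun_differentiable[OF that p])
  have DN: "Dd (\<lambda>q. cnj (k q)) p X = cnj (Dd k p X)" for X by (rule Dd_cnj[OF dd]) simp
  have df: "Dd (\<lambda>q. Dd g q Y) p X = Dd (T g) p X * r Y + T g p * Dd (\<lambda>q. rho0 F q Y) p X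
      + Dd (L g) p X * c Y - L g p * Dd k p X * pz2 Y + Dd (K g) p X * pz2 Y
      + Dd (M g) p X * cnj (c Y) - M g p * cnj (Dd k p X) * cnj (pz2 Y) + Dd (N g) p X * cnj (pz2 Y)" for X Y
  proof -
    have "Dd (\<lambda>q. Dd g q Y) p X = Dd (\<lambda>q. T g q * rho0 F q Y + L g q * (pz1 Y - k q * pz2 Y) + K g q * pz2 Y
        + M g q * (cnj (pz1 Y) - cnj (k q) * cnj (pz2 Y)) + N g q * cnj (pz2 Y)) p X"
      by (rule Dd_cong[OF S_open p]) (simp add: Dd_frame[OF g])
    also have "\<dots> = Dd (T g) p X * r Y + T g p * Dd (\<lambda>q. rho0 F q Y) p X
      + Dd (L g) p X * c Y - L g p * Dd k p X * pz2 Y + Dd (K g) p X * pz2 Y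
      + Dd (M g) p X * cnj (c Y) - M g p * cnj (Dd k p X) * cnj (pz2 Y) + Dd (N g) p X * cnj (pz2 Y)"
      using g by (simp add: Dd_add Dd_mult Dd_diff DN dd bfun_rho0 r_def c_def algebra_simps)
    finally show ?thesis .
  qed
  have kX: "Dd k p X = T k p * r X + L k p * c X + K k p * pz2 X + f0 p * cnj (c X)" for X
    using Dd_frame[OF bfun_k p] N_k[OF p] by (simp add: r_def c_def)
  have kbX: "cnj (Dd k p X) = T kb p * r X + M kb p * cnj (c X) + N kb p * cnj (pz2 X) + L kb p * c X" for X
    unfolding kX using p rho0_real[OF p] frame_cnj[OF bfun_k p] by (simp add: r_def)
  have gX: "Dd h p X = T h p * r X + L h p * c X + K h p * pz2 X + M h p * cnj (c X) + N h p * cnj (pz2 X)"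
    if "bfun S h" for h X
    unfolding Dd_frame[OF that p] by (simp add: r_def c_def)
  have gs: "bfun S (T g)" "bfun S (L g)" "bfun S (K g)" "bfun S (M g)" "bfun S (N g)"
    using g by simp_all
  \<comment> \<open>Symmetry of second derivatives. After the expansion \<open>df\<close> all terms
    in derivatives of g other than \<open>T g\<close> cancel through the bracket formulas.\<close>
  have z: "Dd (\<lambda>q. Dd g q Y) p X - Dd (\<lambda>q. Dd g q X) p Y = 0"
    using Dd_commute[OF S_open p sg, of Y X] by simp
  have "T g p * dform (rho0 F) p X Y = T g p * (P p * wd X Y r c - L k p * wd X Y r pz2
      + Pb p * wd X Y r (\<lambda>X. cnj (c X)) - M kb p * wd X Y r (\<lambda>X. cnj (pz2 X)) + \<i> * wd X Y c (\<lambda>X. cnj (c X)))"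
    using z unfolding df[unfolded kbX] gX[OF gs(1)] gX[OF gs(2)] gX[OF gs(3)] gX[OF gs(4)] gX[OF gs(5)] kbX kX
      bracket_LM[OF g p] bracket_KM[OF g p] bracket_LK[OF g p] bracket_LT[OF g p] bracket_MT[OF g p]
      bracket_KT[OF g p] bracket_NT[OF g p] bracket_NL[OF g p] bracket_MN[OF g p] bracket_KN[OF g p]
      dform_def
    by (simp add: algebra_simps)
  then show ?thesis using Tg ell_nz p by simp
qed


text \<open>Change of coframe. \<open>kap0\<close> and \<open>zet0\<close> differ from
  \<open>c\<close> and \<open>f0 dz2\<close> by multiples of r only, so wedges with r merely rescale
  and the others acquire wedges with r.\<close>

lemma wd_base:
  assumes p: "p \<in> S"
  defines "c \<equiv> \<lambda>X. pz1 X - k p * pz2 X" and "r \<equiv> rho0 F p" and "b \<equiv> \<i> / 3 * B p" and "h \<equiv> \<i> * H p"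
    and "e1 \<equiv> kap0 F p" and "e2 \<equiv> zet0 F p"
  defines "e3 \<equiv> \<lambda>X. cnj (e1 X)" and "e4 \<equiv> \<lambda>X. cnj (e2 X)"
  shows "wd X Y r c = wd X Y r e1"
    "wd X Y r pz2 = wd X Y r e2 / f0 p"
    "wd X Y r (\<lambda>X. cnj (c X)) = wd X Y r e3"
    "wd X Y r (\<lambda>X. cnj (pz2 X)) = wd X Y r e4 / cnj (f0 p)"
    "wd X Y c pz2 = (wd X Y e1 e2 + h * wd X Y r e1 - b * wd X Y r e2) / f0 p"
    "wd X Y c (\<lambda>X. cnj (c X)) = wd X Y e1 e3 + cnj b * wd X Y r e1 - b * wd X Y r e3"
    "wd X Y pz2 (\<lambda>X. cnj (c X)) = (wd X Y e2 e3 + cnj b * wd X Y r e2 - h * wd X Y r e3) / f0 p"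
    "wd X Y pz2 (\<lambda>X. cnj (pz2 X)) = (wd X Y e2 e4 + cnj h * wd X Y r e2 - h * wd X Y r e4) / (f0 p * cnj (f0 p))"
proof -
  have nz: "f0 p \<noteq> 0" "cnj (f0 p) \<noteq> 0" using f0_nz[OF p] by simp_all
  have c: "c X = e1 X - b * r X" for X by (simp add: c_def e1_def kap0_def b_def r_def)
  have y: "pz2 X = (e2 X - h * r X) / f0 p" for X
    using nz by (simp add: e2_def zet0_def h_def r_def)
  have r: "cnj (r X) = r X" for X by (simp add: r_def rho0_real[OF p])
  have cc: "cnj (c X) = e3 X - cnj b * r X" for X by (simp add: c r e3_def)
  have yc: "cnj (pz2 X) = (e4 X - cnj h * r X) / cnj (f0 p)" for X by (simp add: y r e4_def)
  show "wd X Y r c = wd X Y r e1"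
    "wd X Y r pz2 = wd X Y r e2 / f0 p"
    "wd X Y r (\<lambda>X. cnj (c X)) = wd X Y r e3"
    "wd X Y r (\<lambda>X. cnj (pz2 X)) = wd X Y r e4 / cnj (f0 p)"
    "wd X Y c pz2 = (wd X Y e1 e2 + h * wd X Y r e1 - b * wd X Y r e2) / f0 p"
    "wd X Y c (\<lambda>X. cnj (c X)) = wd X Y e1 e3 + cnj b * wd X Y r e1 - b * wd X Y r e3"
    "wd X Y pz2 (\<lambda>X. cnj (c X)) = (wd X Y e2 e3 + cnj b * wd X Y r e2 - h * wd X Y r e3) / f0 p"
    "wd X Y pz2 (\<lambda>X. cnj (pz2 X)) = (wd X Y e2 e4 + cnj h * wd X Y r e2 - h * wd X Y r e4) / (f0 p * cnj (f0 p))"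
    unfolding cc yc unfolding c y using nz by (simp_all add: field_simps)
qed

lemma bfun_kap0: "bfun S (\<lambda>q. kap0 F q X)" and bfun_zet0: "bfun S (\<lambda>q. zet0 F q X)"
  unfolding kap0_def zet0_def
  by (intro bfun_add bfun_diff bfun_mult bfun_rho0 bfun_const; simp)+

text \<open>The differential of \<open>- k dz2 + (i/3) B \<rho>0\<close>, expanded in the frame; the
  term in conj dz2 from dk is absent by \<open>N_k\<close>.\<close>

lemma dform_kap0:
  assumes p: "p \<in> S"
  defines "c \<equiv> \<lambda>X. pz1 X - k p * pz2 X" and "r \<equiv> rho0 F p"
  shows "dform (kap0 F) p X Y = - T k p * wd X Y r pz2 - L k p * wd X Y c pz2
      + f0 p * wd X Y pz2 (\<lambda>X. cnj (c X))
      - \<i> / 3 * (L B p * wd X Y r c + K B p * wd X Y r pz2 + M B p * wd X Y r (\<lambda>X. cnj (c X))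
         + N B p * wd X Y r (\<lambda>X. cnj (pz2 X)))
      + \<i> / 3 * B p * dform (rho0 F) p X Y"
proof -
  have dd: "g differentiable (at p)" if "bfun S g" for g by (rule bfun_differentiable[OF that p])
  have fr: "Dd g p X = T g p * r X + L g p * c X + K g p * pz2 X + M g p * cnj (c X) + N g p * cnj (pz2 X)"
    if "bfun S g" for g X
    unfolding Dd_frame[OF that p] by (simp add: r_def c_def)
  have d: "Dd (\<lambda>q. kap0 F q Y) p X = - Dd k p X * pz2 Y + \<i> / 3 * (B p * Dd (\<lambda>q. rho0 F q Y) p X + Dd B p X * r Y)"
    for X Y
  proof -
    have "Dd (\<lambda>q. pz1 Y - k q * pz2 Y + m * B q * rho0 F q Y) p X
        = - Dd k p X * pz2 Y + m * (B p * Dd (\<lambda>q. rho0 F q Y) p X + Dd B p X * r Y)" for m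
      by (simp add: Dd_add Dd_mult Dd_diff dd bfun_rho0 r_def algebra_simps)
    then show ?thesis unfolding kap0_def .
  qed
  show ?thesis
    unfolding dform_def d fr[OF bfun_k] fr[OF bfun_B] N_k[OF p] by (simp add: algebra_simps)
qed

lemma dform_zet0:
  assumes p: "p \<in> S"
  defines "c \<equiv> \<lambda>X. pz1 X - k p * pz2 X" and "r \<equiv> rho0 F p"
  shows "dform (zet0 F) p X Y = T f0 p * wd X Y r pz2 + L f0 p * wd X Y c pz2
      - f1 p * wd X Y pz2 (\<lambda>X. cnj (c X)) - N f0 p * wd X Y pz2 (\<lambda>X. cnj (pz2 X))
      - \<i> * (L H p * wd X Y r c + K H p * wd X Y r pz2 + M H p * wd X Y r (\<lambda>X. cnj (c X))
         + N H p * wd X Y r (\<lambda>X. cnj (pz2 X)))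
      + \<i> * H p * dform (rho0 F) p X Y"
proof -
  have dd: "g differentiable (at p)" if "bfun S g" for g by (rule bfun_differentiable[OF that p])
  have fr: "Dd g p X = T g p * r X + L g p * c X + K g p * pz2 X + M g p * cnj (c X) + N g p * cnj (pz2 X)"
    if "bfun S g" for g X
    unfolding Dd_frame[OF that p] by (simp add: r_def c_def)
  have b: "bfun S f0" by simp
  have d: "Dd (\<lambda>q. zet0 F q Y) p X = Dd f0 p X * pz2 Y + \<i> * (H p * Dd (\<lambda>q. rho0 F q Y) p X + Dd H p X * r Y)"
    for X Y
    unfolding zet0_def by (simp add: Dd_add Dd_mult dd bfun_rho0 r_def algebra_simps)
  show ?thesis
    unfolding dform_def d fr[OF b] fr[OF bfun_H] by (simp add: algebra_simps)
qed

text \<open>The coefficients are hidden by the existential because the lift uses only how those of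
  d\<zeta>0'' depend on the others, together with the real part of \<open>z2\<close>.\<close>

lemma base_structure:
  assumes p: "p \<in> S"
  defines "r \<equiv> rho0 F p" and "e1 \<equiv> kap0 F p" and "e2 \<equiv> zet0 F p"
  defines "e3 \<equiv> \<lambda>X. cnj (e1 X)" and "e4 \<equiv> \<lambda>X. cnj (e2 X)"
  shows "\<exists>r1 r2 k1 k2 k3 k6 z1 z2.
    Re z2 = Re (- (\<i>/2) * M W p + (\<i>/2) * (- (1/3) * f1 p / f0 p + (1/3) * cnj (P p)) * W p) \<and>
    (\<forall>X Y.
      dform (rho0 F) p X Y = r1 * wd X Y r e1 + r2 * wd X Y r e2 + cnj r1 * wd X Y r e3
         + cnj r2 * wd X Y r e4 + \<i> * wd X Y e1 e3 \<and>
      dform (kap0 F) p X Y = k1 * wd X Y r e1 + k2 * wd X Y r e2 + k3 * wd X Y r e3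
         + r2 * wd X Y e1 e2 + k6 * wd X Y e1 e3 + wd X Y e2 e3 \<and>
      dform (zet0 F) p X Y = z1 * wd X Y r e1 + z2 * wd X Y r e2 + \<i> * J0b F p * wd X Y r e3
         + (- r1 + 2 * cnj k6 + \<i> * k2 + W p) * wd X Y e1 e2 + \<i> * k3 * wd X Y e1 e3
         + (2 * k6 - cnj r1) * wd X Y e2 e3 - cnj r2 * wd X Y e2 e4)"
proof -
  define b where "b = \<i> / 3 * B p"
  define h where "h = \<i> * H p"
  define r1 where "r1 = P p + cnj (B p) / 3"
  define r2 where "r2 = - L k p / f0 p"
  define k1 where "k1 = - h * L k p / f0 p - \<i> / 3 * L B p + b * r1"
  define k2 where "k2 = - T k p / f0 p + cnj b - \<i> / 3 * K B p / f0 p"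
  define k3 where "k3 = - h - \<i> / 3 * M B p + b * cnj r1"
  define k6 where "k6 = - B p / 3"
  define z1 where "z1 = h * L f0 p / f0 p - \<i> * L H p + h * r1"
  define z2 where "z2 = (T f0 p - b * L f0 p - cnj b * f1 p) / f0 p + cnj h * M kb p / cnj (f0 p)
     - \<i> * K H p / f0 p + h * r2"
  have nz: "f0 p \<noteq> 0" "cnj (f0 p) \<noteq> 0" using f0_nz[OF p] by simp_all
  have Mkb: "cnj (L k p) = M kb p" "cnj (P p) = Pb p" "cnj (M kb p) = L k p"
    using p by (simp_all add: frame_cnj) (simp_all add: cf_def)
  note wb = wd_base[OF p, folded r_def e1_def e2_def, folded b_def h_def]
  have R: "dform (rho0 F) p X Y = r1 * wd X Y r e1 + r2 * wd X Y r e2 + cnj r1 * wd X Y r e3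
         + cnj r2 * wd X Y r e4 + \<i> * wd X Y e1 e3" for X Y
    unfolding e3_def e4_def dform_rho0[OF p, folded r_def] wb r1_def r2_def b_def
    using nz by (simp add: Mkb field_simps)
  have Kp: "dform (kap0 F) p X Y = k1 * wd X Y r e1 + k2 * wd X Y r e2 + k3 * wd X Y r e3
         + r2 * wd X Y e1 e2 + k6 * wd X Y e1 e3 + wd X Y e2 e3" for X Y
  proof -
    have "dform (kap0 F) p X Y = k1 * wd X Y r e1 + k2 * wd X Y r e2 + k3 * wd X Y r e3
         + (- \<i> / 3 * N B p / cnj (f0 p) + b * cnj r2) * wd X Y r e4
         + r2 * wd X Y e1 e2 + \<i> * b * wd X Y e1 e3 + wd X Y e2 e3"
      unfolding dform_kap0[OF p, folded r_def] R unfolding e3_def e4_def wb k1_def k2_def k3_def r2_def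
      unfolding b_def[symmetric]
      using nz by (simp add: field_simps)
    \<comment> \<open>The \<rho> ^ conj \<zeta> torsion cancels here: the weight of B under N
      matches the contribution of \<rho>0.\<close>
    moreover have "- \<i> / 3 * N B p / cnj (f0 p) + b * cnj r2 = 0"
      by (simp add: N_B[OF p] b_def r2_def Mkb)
    moreover have "\<i> * b = k6" by (simp add: b_def k6_def)
    ultimately show ?thesis by simp
  qed
  have Zp: "dform (zet0 F) p X Y = z1 * wd X Y r e1 + z2 * wd X Y r e2 + \<i> * J0b F p * wd X Y r e3
         + (- r1 + 2 * cnj k6 + \<i> * k2 + W p) * wd X Y e1 e2 + \<i> * k3 * wd X Y e1 e3
         + (2 * k6 - cnj r1) * wd X Y e2 e3 - cnj r2 * wd X Y e2 e4" for X Y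
  proof -
    have N: "N f0 p = - M kb p * f0 p" by (rule N_f0[OF p])
    have main: "dform (zet0 F) p X Y = z1 * wd X Y r e1 + z2 * wd X Y r e2
         + (h * f1 p / f0 p - \<i> * M H p + h * cnj r1) * wd X Y r e3
         + (- h * M kb p / cnj (f0 p) - \<i> * N H p / cnj (f0 p) + h * cnj r2) * wd X Y r e4
         + L f0 p / f0 p * wd X Y e1 e2 + \<i> * h * wd X Y e1 e3
         + (- f1 p / f0 p) * wd X Y e2 e3 + M kb p / cnj (f0 p) * wd X Y e2 e4"
      unfolding dform_zet0[OF p, folded r_def] R unfolding e3_def e4_def wb z1_def z2_def N
      unfolding h_def[symmetric]
      using nz by (simp add: field_simps)
    have i1: "h * f1 p / f0 p - \<i> * M H p + h * cnj r1 = \<i> * J0b F p"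
      unfolding J0b_def h_def r1_def f1_eq[OF p] using nz by (simp add: Mkb field_simps)
    have i2: "- h * M kb p / cnj (f0 p) - \<i> * N H p / cnj (f0 p) + h * cnj r2 = 0"
      using nz by (simp add: N_H[OF p] h_def r2_def Mkb field_simps)
    \<comment> \<open>W is what the other torsion leaves unaccounted for in the coefficient of
      \<kappa> ^ \<zeta>.\<close>
    have i3: "L f0 p / f0 p = - r1 + 2 * cnj k6 + \<i> * k2 + W p"
      unfolding W_eq[OF p] r1_def k6_def k2_def b_def using nz by (simp add: field_simps)
    \<comment> \<open>By \<open>H_eq\<close> the last two terms of \<open>k3\<close> add up to
      \<open>2 h\<close>.\<close>
    have i4: "\<i> * h = \<i> * k3"
      unfolding k3_def h_def b_def r1_def H_eq[OF p]
      by (simp add: Mkb field_simps power2_eq_square)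
    have i5: "- f1 p / f0 p = 2 * k6 - cnj r1"
      unfolding k6_def r1_def f1_eq[OF p] using nz by (simp add: Mkb field_simps)
    have i6: "M kb p / cnj (f0 p) = - cnj r2" by (simp add: r2_def Mkb)
    show ?thesis unfolding main[unfolded i1 i2 i3 i4 i5 i6] by simp
  qed
  \<comment> \<open>The two terms are a number's conjugate and the negative of that number, so they
    do not affect the real part.\<close>
  have "cnj h * M kb p / cnj (f0 p) = cnj (h * L k p / f0 p)" "h * r2 = - (h * L k p / f0 p)"
    by (simp_all add: Mkb r2_def)
  then have "Re (cnj h * M kb p / cnj (f0 p) + h * r2) = 0"
    by (simp only: plus_complex.sel uminus_complex.sel cnj.sel)
  moreover have "z2 = (T f0 p / f0 p - \<i> / 3 * B p * L f0 p / f0 p + \<i> / 3 * cnj (B p) * f1 p / f0 p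
      - \<i> * K H p / f0 p) + (cnj h * M kb p / cnj (f0 p) + h * r2)"
    unfolding z2_def b_def using nz by (simp add: field_simps)
  ultimately have "Re z2 = Re (- (\<i>/2) * M W p + (\<i>/2) * (- (1/3) * f1 p / f0 p + (1/3) * cnj (P p)) * W p)"
    unfolding Re_torsion[OF p, symmetric] by simp
  then show ?thesis using R Kp Zp by blast
qed

section \<open>Lifting to the structure group\<close>

lemma fibre_differentiable:
  "pc differentiable (at p)" "(\<lambda>q. cnj (pc q)) differentiable (at p)" "pe differentiable (at p)"
  and Dd_fibre: "Dd pc p X = pc X" "Dd (\<lambda>q. cnj (pc q)) p X = cnj (pc X)" "Dd pe p X = pe X"
proof -
  have l: "bounded_linear pc" "bounded_linear pe"
    unfolding pc_def[abs_def] pe_def[abs_def]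
    by (intro bounded_linear_compose[OF bounded_linear_fst] bounded_linear_compose[OF bounded_linear_snd] bounded_linear_snd)+
  have l': "bounded_linear (\<lambda>q. cnj (pc q))" by (rule bounded_linear_compose[OF bounded_linear_cnj l(1)])
  show "pc differentiable (at p)" "(\<lambda>q. cnj (pc q)) differentiable (at p)" "pe differentiable (at p)"
    "Dd pc p X = pc X" "Dd (\<lambda>q. cnj (pc q)) p X = cnj (pc X)" "Dd pe p X = pe X"
    using l l' by (auto simp: Dd_blinear bounded_linear_imp_differentiable)
qed

text \<open>The relations of \<open>base_structure\<close> persist with the new coefficients.
  \<open>K4\<close> is zero for \<open>e = 0\<close> and reappears as \<open>i K4\<close> in
  d\<zeta>. The relations also cancel every contribution of e to the coefficient of \<rho> ^ conj
  \<kappa> in d\<zeta>, so J is only rescaled.\<close>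

lemma lifted_structure:
  assumes p: "p \<in> S"
  defines "r \<equiv> rho F p" and "y \<equiv> kap F p" and "z \<equiv> zet F p" and "a \<equiv> alph p" and "b \<equiv> bet p"
  defines "y' \<equiv> \<lambda>X. cnj (y X)" and "z' \<equiv> \<lambda>X. cnj (z X)" and "a' \<equiv> \<lambda>X. cnj (a X)"
  shows "\<exists>R1 R2 K1 K2 K3 K4 K6 Z1 Z2. complex_of_real (Re Z2) = Rsc F p \<and>
    (\<forall>X Y.
      dform (rho F) p X Y = wd X Y a r + wd X Y a' r + R1 * wd X Y r y + R2 * wd X Y r z
         + cnj R1 * wd X Y r y' + cnj R2 * wd X Y r z' + \<i> * wd X Y y y' \<and>
      dform (kap F) p X Y = wd X Y b r + wd X Y a y + K1 * wd X Y r y + K2 * wd X Y r z + K3 * wd X Y r y'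
         + K4 * wd X Y r z' + R2 * wd X Y y z + K6 * wd X Y y y' + wd X Y z y' \<and>
      dform (zet F) p X Y = wd X Y a z - wd X Y a' z + \<i> * wd X Y b y + Z1 * wd X Y r y + Z2 * wd X Y r z
         + Jsc F p * wd X Y r y' + (- R1 + 2 * cnj K6 + \<i> * K2 + Wsc F p) * wd X Y y z
         + \<i> * K3 * wd X Y y y' + \<i> * K4 * wd X Y y z' + (2 * K6 - cnj R1) * wd X Y z y'
         - cnj R2 * wd X Y z z')"
proof -
  define x0 where "x0 = rho0 F p"
  define x1 where "x1 = kap0 F p"
  define x2 where "x2 = zet0 F p"
  define x3 where "x3 = (\<lambda>X. cnj (x1 X))"
  define x4 where "x4 = (\<lambda>X. cnj (x2 X))"
  define c where "c = pc p"
  \<comment> \<open>The conjugates d of c and t of s are handled as variables of their own, which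
    makes the identities below rational in c, d, s and t.\<close>
  define d where "d = cnj c"
  define s where "s = pe p / c"
  define t where "t = cnj s"
  have c0: "c \<noteq> 0" "d \<noteq> 0" using p by (auto simp: c_def d_def dom_MG_def)
  have conj: "cnj c = d" "cnj d = c" "cnj s = t" "cnj t = s" by (simp_all add: d_def t_def)
  have e: "pe p = s * c" using c0 by (simp add: s_def)
  from base_structure[OF p] obtain r1 r2 k1 k2 k3 k6 z1 z2 where
    z2: "Re z2 = Re (- (\<i>/2) * M W p + (\<i>/2) * (- (1/3) * f1 p / f0 p + (1/3) * cnj (P p)) * W p)"
    and dr0: "\<And>X Y. dform (rho0 F) p X Y = r1 * wd X Y x0 x1 + r2 * wd X Y x0 x2 + cnj r1 * wd X Y x0 x3
         + cnj r2 * wd X Y x0 x4 + \<i> * wd X Y x1 x3"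
    and dk0: "\<And>X Y. dform (kap0 F) p X Y = k1 * wd X Y x0 x1 + k2 * wd X Y x0 x2 + k3 * wd X Y x0 x3
         + r2 * wd X Y x1 x2 + k6 * wd X Y x1 x3 + wd X Y x2 x3"
    and dz0: "\<And>X Y. dform (zet0 F) p X Y = z1 * wd X Y x0 x1 + z2 * wd X Y x0 x2 + \<i> * J0b F p * wd X Y x0 x3
         + (- r1 + 2 * cnj k6 + \<i> * k2 + W p) * wd X Y x1 x2 + \<i> * k3 * wd X Y x1 x3
         + (2 * k6 - cnj r1) * wd X Y x2 x3 - cnj r2 * wd X Y x2 x4"
    unfolding x0_def x1_def x2_def x3_def x4_def by blast
  have r: "r X = c * d * x0 X" for X by (simp add: r_def rho_def c_def d_def x0_def)
  have y: "y X = - \<i> * d * (s * c) * x0 X + c * x1 X" for X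
    by (simp add: y_def kap_def c_def[symmetric] d_def[symmetric] e x0_def x1_def)
  have z: "z X = - (\<i>/2) * d * c * s\<^sup>2 * x0 X + s * c * x1 X + c / d * x2 X" for X
    using c0 by (simp add: z_def zet_def c_def[symmetric] d_def[symmetric] e x0_def x1_def x2_def power2_eq_square)
  have pc: "pc X = c * a X" for X using c0 by (simp add: a_def alph_def c_def)
  have pc': "cnj (pc X) = d * a' X" for X by (simp add: pc a'_def d_def)
  \<comment> \<open>\<open>bet\<close> solved for de, so that differentiating the group parameters
    produces \<alpha>, its conjugate and \<beta> only.\<close>
  have pe: "pe X = c * (\<i> * b X + s * a X - s * a' X)" for X
  proof -
    have "b X = \<i> * s * a X - \<i> * s * a' X - \<i> * pe X / c"
      unfolding b_def bet_def e unfolding c_def[symmetric] unfolding d_def[symmetric] unfolding pc' unfolding pc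
      using c0 by (simp add: field_simps power2_eq_square)
    then show ?thesis using c0 by (simp add: right_diff_distrib distrib_left) (simp add: algebra_simps)
  qed
  have x0: "x0 X = r X / (c * d)" for X using c0 by (simp add: r)
  have x1: "x1 X = (y X + \<i> * s * r X) / c" for X using c0 by (simp add: y r field_simps)
  have x2: "x2 X = d / c * (z X - s * y X - \<i> / 2 * s\<^sup>2 * r X)" for X
    using c0 by (simp add: z y r field_simps power2_eq_square)
  have x0r: "cnj (x0 X) = x0 X" for X by (simp add: x0_def rho0_real[OF p])
  have rr: "cnj (r X) = r X" for X by (simp add: r x0r conj)
  have x3: "x3 X = (y' X - \<i> * t * r X) / d" for X by (simp add: x3_def x1 y'_def rr conj)
  have x4: "x4 X = c / d * (z' X - t * y' X + \<i> / 2 * t\<^sup>2 * r X)" for X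
    by (simp add: x4_def x2 z'_def y'_def rr conj)
  have w: "wd X Y x0 x1 = wd X Y r y / (c * d * c)"
    "wd X Y x0 x2 = (wd X Y r z - s * wd X Y r y) / (c * c)"
    "wd X Y x0 x3 = wd X Y r y' / (c * d * d)"
    "wd X Y x0 x4 = (wd X Y r z' - t * wd X Y r y') / (d * d)"
    "wd X Y x1 x2 = d / (c * c) * (wd X Y y z + \<i> * s * wd X Y r z - \<i> / 2 * s\<^sup>2 * wd X Y r y)"
    "wd X Y x1 x3 = (wd X Y y y' + \<i> * s * wd X Y r y' + \<i> * t * wd X Y r y) / (c * d)"
    "wd X Y x2 x3 = (wd X Y z y' + \<i> * t * wd X Y r z - s * wd X Y y y' - \<i> * s * t * wd X Y r y
        - \<i> / 2 * s\<^sup>2 * wd X Y r y') / c"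
    "wd X Y x2 x4 = wd X Y z z' - t * wd X Y z y' - \<i> / 2 * t\<^sup>2 * wd X Y r z - s * wd X Y y z'
        + s * t * wd X Y y y' + \<i> / 2 * s * t\<^sup>2 * wd X Y r y - \<i> / 2 * s\<^sup>2 * wd X Y r z'
        + \<i> / 2 * s\<^sup>2 * t * wd X Y r y'" for X Y
    unfolding x0 x1 x2 x3 x4 using c0 by (simp_all add: field_simps power2_eq_square)
  \<comment> \<open>These values are read off by inserting the wedges \<open>w\<close> into
    \<open>dr\<close>, \<open>dk\<close> and \<open>dz\<close> below and collecting terms.\<close>
  define R1 where "R1 = r1 / c - d / c * r2 * s - t"
  define R2 where "R2 = d / c * r2"
  define K1 where "K1 = k1 / (c * d) + \<i> / 2 * d / c * r2 * s\<^sup>2 - k2 * s / c - \<i> * r1 * s / c + \<i> * k6 * t / d"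
  define K2 where "K2 = k2 / c + \<i> * t"
  define K3 where "K3 = \<i> * c / d * cnj r2 * s * t + \<i> * k6 * s / d - \<i> * cnj r1 * s / d + k3 / (d * d) + \<i> / 2 * s\<^sup>2"
  define K4 where "K4 = - \<i> * c / d * cnj r2 * s"
  define K6 where "K6 = k6 / d"
  define Z1 where "Z1 = - \<i> / 2 * W p * s\<^sup>2 / c + k1 * s / (c * d) - s * z2 / (c * d) + z1 / (c * d * d)
     - k2 * s\<^sup>2 / (2 * c) - \<i> * cnj k6 * s\<^sup>2 / c - \<i> / 2 * c / d * cnj r2 * s * t\<^sup>2 - \<i> * k6 * s * t / d
     + \<i> * cnj r1 * s * t / d - k3 * t / (d * d) - \<i> / 2 * s\<^sup>2 * t"
  define Z2 where "Z2 = \<i> * W p * s / c + z2 / (c * d) + \<i> / 2 * d / c * r2 * s\<^sup>2 + 2 * \<i> * cnj k6 * s / c - \<i> * r1 * s / c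
     + \<i> / 2 * c / d * cnj r2 * t\<^sup>2 + 2 * \<i> * k6 * t / d - \<i> * cnj r1 * t / d + \<i> * s * t"
  have cR: "cnj R1 = cnj r1 / d - c / d * cnj r2 * t - s" "cnj R2 = c / d * cnj r2" "cnj K6 = cnj k6 / c"
    by (simp_all add: R1_def R2_def K6_def conj)
  have dd: "(\<lambda>q. rho0 F q Y) differentiable (at p)" "(\<lambda>q. kap0 F q Y) differentiable (at p)"
    "(\<lambda>q. zet0 F q Y) differentiable (at p)" for Y
    using bfun_rho0 bfun_kap0 bfun_zet0 bfun_differentiable p by blast+
  have pcnz: "pc p \<noteq> 0" using c0 by (simp add: c_def)
  note sm = dd fibre_differentiable pcnz
  have dr: "dform (rho F) p X Y = wd X Y a r + wd X Y a' r + c * d * dform (rho0 F) p X Y" for X Y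
  proof -
    have D: "Dd (\<lambda>q. rho F q Y) p X = (pc X * d + c * cnj (pc X)) * x0 Y + c * d * Dd (\<lambda>q. rho0 F q Y) p X" for X Y
      unfolding rho_def by (simp add: Dd_mult sm Dd_fibre c_def d_def x0_def algebra_simps)
    show ?thesis unfolding dform_def D unfolding pc' unfolding pc r by (simp add: algebra_simps)
  qed
  have dk: "dform (kap F) p X Y = wd X Y b r + wd X Y a y
      - \<i> * s * c * d * dform (rho0 F) p X Y + c * dform (kap0 F) p X Y" for X Y
  proof -
    have D: "Dd (\<lambda>q. kap F q Y) p X = - \<i> * (cnj (pc X) * (s * c) + d * pe X) * x0 Y
       - \<i> * d * (s * c) * Dd (\<lambda>q. rho0 F q Y) p X + pc X * x1 Y + c * Dd (\<lambda>q. kap0 F q Y) p X" for X Y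
      unfolding kap_def e[symmetric]
      by (simp add: Dd_mult Dd_add Dd_diff sm Dd_fibre c_def d_def x0_def x1_def algebra_simps)
    show ?thesis unfolding dform_def D unfolding pc' pe unfolding pc r y by (simp add: algebra_simps)
  qed
  have dz: "dform (zet F) p X Y = wd X Y a z - wd X Y a' z + \<i> * wd X Y b y
      - \<i> / 2 * s\<^sup>2 * c * d * dform (rho0 F) p X Y + s * c * dform (kap0 F) p X Y
      + c / d * dform (zet0 F) p X Y" for X Y
  proof -
    have D1: "Dd (\<lambda>q. cnj (pc q) * (pe q)\<^sup>2 / pc q) p X
       = d * c * (s\<^sup>2 * a' X + 2 * s * (\<i> * b X + s * a X - s * a' X) - s\<^sup>2 * a X)" for X
    proof -
      have "Dd (\<lambda>q. cnj (pc q) * (pe q)\<^sup>2 / pc q) p X =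
         (cnj (pc X) * (pe p)\<^sup>2 + d * (2 * pe p * pe X)) / c - d * (pe p)\<^sup>2 * pc X / c\<^sup>2"
        unfolding power2_eq_square
        by (simp add: Dd_divide Dd_mult sm Dd_fibre c_def d_def power2_eq_square algebra_simps)
      also have "\<dots> = d * c * (s\<^sup>2 * a' X + 2 * s * (\<i> * b X + s * a X - s * a' X) - s\<^sup>2 * a X)"
        unfolding e unfolding pc' pe unfolding pc using c0 by (simp add: field_simps power2_eq_square)
      finally show ?thesis .
    qed
    have D2: "Dd (\<lambda>q. pc q / cnj (pc q)) p X = c / d * (a X - a' X)" for X
    proof -
      have "Dd (\<lambda>q. pc q / cnj (pc q)) p X = pc X / d - c * cnj (pc X) / d\<^sup>2"
        by (simp add: Dd_divide sm Dd_fibre c_def d_def)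
      also have "\<dots> = c / d * (a X - a' X)"
        unfolding pc' unfolding pc using c0 by (simp add: field_simps power2_eq_square)
      finally show ?thesis .
    qed
    have sm': "(\<lambda>q. cnj (pc q) * (pe q)\<^sup>2 / pc q) differentiable (at p)"
        "(\<lambda>q. pc q / cnj (pc q)) differentiable (at p)"
      by (intro differentiable_divide differentiable_mult differentiable_power sm; simp add: pcnz)+
    have D: "Dd (\<lambda>q. zet F q Y) p X =
       - (\<i>/2) * (d * c * (s\<^sup>2 * a' X + 2 * s * (\<i> * b X + s * a X - s * a' X) - s\<^sup>2 * a X)) * x0 Y
       - (\<i>/2) * d * c * s\<^sup>2 * Dd (\<lambda>q. rho0 F q Y) p X
       + pe X * x1 Y + s * c * Dd (\<lambda>q. kap0 F q Y) p X
       + c / d * (a X - a' X) * x2 Y + c / d * Dd (\<lambda>q. zet0 F q Y) p X" for X Y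
    proof -
      have v: "cnj (pc p) * (pe p)\<^sup>2 / pc p = d * c * s\<^sup>2"
        unfolding e unfolding c_def[symmetric] d_def[symmetric] using c0 by (simp add: power2_eq_square)
      have "Dd (\<lambda>q. zet F q Y) p X =
         - (\<i>/2) * (Dd (\<lambda>q. cnj (pc q) * (pe q)\<^sup>2 / pc q) p X * x0 Y
              + cnj (pc p) * (pe p)\<^sup>2 / pc p * Dd (\<lambda>q. rho0 F q Y) p X)
         + (pe X * x1 Y + pe p * Dd (\<lambda>q. kap0 F q Y) p X)
         + (Dd (\<lambda>q. pc q / cnj (pc q)) p X * x2 Y + pc p / cnj (pc p) * Dd (\<lambda>q. zet0 F q Y) p X)"
        unfolding zet_def x0_def x1_def x2_def mult.assoc
        by (subst Dd_add Dd_mult | (intro differentiable_add differentiable_mult sm sm' differentiable_const)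
             | simp add: Dd_fibre)+
      then show ?thesis unfolding D1 D2 v unfolding e unfolding c_def[symmetric] d_def[symmetric]
        by (simp add: algebra_simps)
    qed
    show ?thesis unfolding dform_def D unfolding pe unfolding r y z using c0
      by (simp add: field_simps power2_eq_square)
  qed
  have 1: "dform (rho F) p X Y = wd X Y a r + wd X Y a' r + R1 * wd X Y r y + R2 * wd X Y r z
         + cnj R1 * wd X Y r y' + cnj R2 * wd X Y r z' + \<i> * wd X Y y y'" for X Y
    unfolding dr dr0 w cR unfolding R1_def R2_def using c0 by (simp add: divide_simps) (simp add: algebra_simps power2_eq_square)
  have 2: "dform (kap F) p X Y = wd X Y b r + wd X Y a y + K1 * wd X Y r y + K2 * wd X Y r z + K3 * wd X Y r y'
         + K4 * wd X Y r z' + R2 * wd X Y y z + K6 * wd X Y y y' + wd X Y z y'" for X Y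
    unfolding dk dr0 dk0 w K1_def K2_def K3_def K4_def K6_def R2_def
    using c0 by (simp add: divide_simps) (simp add: algebra_simps power2_eq_square)
  have 3: "dform (zet F) p X Y = wd X Y a z - wd X Y a' z + \<i> * wd X Y b y + Z1 * wd X Y r y + Z2 * wd X Y r z
         + Jsc F p * wd X Y r y' + (- R1 + 2 * cnj K6 + \<i> * K2 + Wsc F p) * wd X Y y z
         + \<i> * K3 * wd X Y y y' + \<i> * K4 * wd X Y y z' + (2 * K6 - cnj R1) * wd X Y z y'
         - cnj R2 * wd X Y z z'" for X Y
    unfolding dz dr0 dk0 dz0 w cR Jsc_def Wsc_def
    unfolding c_def[symmetric] unfolding d_def[symmetric] Z1_def Z2_def K2_def K3_def K4_def K6_def R1_def
    using c0 by (simp add: divide_simps) (simp add: algebra_simps power2_eq_square power3_eq_cube)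
  have "complex_of_real (Re Z2) = Rsc F p"
  proof -
    \<comment> \<open>The s-dependent part of \<open>Z2\<close> without W is a difference of
      conjugates plus i times the squared modulus of s, hence imaginary.\<close>
    let ?g = "\<i> / 2 * d / c * r2 * s\<^sup>2 + 2 * \<i> * cnj k6 * s / c - \<i> * r1 * s / c"
    have "Z2 = (\<i> * s / c * W p + 1 / (c * d) * z2) + ((?g - cnj ?g) + \<i> * (s * cnj s))"
      by (simp add: Z2_def conj algebra_simps)
    moreover have "Re ((g - cnj g) + \<i> * (s * cnj s)) = 0" for g by simp
    moreover have "Re (1 / (c * d) * x) = Re x / (cmod c)\<^sup>2" for x
    proof -
      have "c * d = complex_of_real ((cmod c)\<^sup>2)" unfolding d_def by (rule complex_norm_square[symmetric])
      then have "1 / (c * d) * x = x / complex_of_real ((cmod c)\<^sup>2)" by simp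
      then show ?thesis by (simp only: Re_divide_of_real)
    qed
    ultimately have "Re Z2 = Re (\<i> * s / c * W p + 1 / (c * d) * (- (\<i>/2) * M W p
         + (\<i>/2) * (- (1/3) * f1 p / f0 p + (1/3) * cnj (P p)) * W p))"
      by (simp only: plus_complex.sel z2 add_0_right)
    moreover have "\<i> * pe p / (pc p)\<^sup>2 = \<i> * s / c"
      unfolding e unfolding c_def[symmetric] using c0 by (simp add: power2_eq_square)
    ultimately show ?thesis unfolding Rsc_def unfolding c_def[symmetric] d_def[symmetric]
      by (simp only: c_def[symmetric])
  qed
  then show ?thesis using 1 2 3 by blast
qed


section \<open>Coefficients in the coframe\<close>

text \<open>The system is triangular: \<rho> fixes \<open>rho0\<close>, then \<kappa> and \<zeta>
  fix the components along z1 and z2, and \<alpha>, \<beta> those along c and e. The value of \<rho>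
  must be real because the form is.\<close>

lemma coframe_surj:
  assumes p: "p \<in> S"
  shows "\<exists>X. ptt X = 0 \<and> rho F p X = complex_of_real x \<and> kap F p X = y \<and> zet F p X = z
    \<and> alph p X = a \<and> bet p X = b"
proof -
  let ?c = "pc p" and ?e = "pe p"
  have c0: "?c \<noteq> 0" using p by (simp add: dom_MG_def)
  have l0: "ell F p \<noteq> 0" using ell_nz p by blast
  define r where "r = complex_of_real (x / (cmod ?c)\<^sup>2)"
  define u where "u = (y + \<i> * cnj ?c * ?e * r) / ?c"
  define v where "v = cnj ?c / ?c * (z + (\<i>/2) * (cnj ?c * ?e\<^sup>2 / ?c) * r - ?e * u)"
  define w2 where "w2 = (v - \<i> * H p * r) / f0 p"
  define w1 where "w1 = u + k p * w2 - (\<i>/3) * B p * r"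
  \<comment> \<open>The v-component forced by \<open>rho0\<close>; it equals its conjugate because
    \<open>ell\<close> and r are real, so it is admissible as a real coordinate.\<close>
  define vv where "vv = ell F p * r + A1 F p * w1 + A2 F p * w2 + cnj (A1 F p) * cnj w1 + cnj (A2 F p) * cnj w2"
  define X :: pt where "X = (w1, w2, Re vv, ?c * a,
     \<i> * ?c * (b - (\<i> * ?e * (?c * a) / ?c\<^sup>2 - \<i> * ?e * cnj (?c * a) / (?c * cnj ?c))), 0)"
  have "cnj vv = vv" by (simp add: vv_def cnj_ell[OF p] r_def algebra_simps)
  then have "complex_of_real (Re vv) = vv" by (simp add: complex_eq_iff)
  then have r: "rho0 F p X = r"
    using l0 by (simp add: rho0_def X_def pz1_def pz2_def pv_def) (simp add: vv_def)
  have u: "kap0 F p X = u"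
    unfolding kap0_def r by (simp add: X_def pz1_def pz2_def w1_def)
  have v: "zet0 F p X = v"
    unfolding zet0_def r using f0_nz[OF p] by (simp add: X_def pz2_def w2_def)
  have "?c * cnj ?c = complex_of_real ((cmod ?c)\<^sup>2)" by (rule complex_norm_square[symmetric])
  then have "rho F p X = x" unfolding rho_def r using c0 by (simp add: r_def)
  moreover have "kap F p X = y" unfolding kap_def r u using c0 by (simp add: u_def)
  moreover have "zet F p X = z" unfolding zet_def r u v using c0 by (simp add: v_def)
  moreover have "ptt X = 0" by (simp add: ptt_def X_def)
  moreover have "alph p X = a" using c0 by (simp add: alph_def X_def pc_def[of X] pc_def[of "(_, _)"])
  moreover have "bet p X = b"
  proof -
    have "pc X = ?c * a" "pe X = \<i> * ?c * (b - (\<i> * ?e * (?c * a) / ?c\<^sup>2 - \<i> * ?e * cnj (?c * a) / (?c * cnj ?c)))"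
      by (simp_all add: X_def pc_def[of "(_, _)"] pe_def[of "(_, _)"])
    then show ?thesis unfolding bet_def using c0 by simp
  qed
  ultimately show ?thesis by blast
qed

lemma less9: "(j::nat) < 9 \<longleftrightarrow> j = 0 \<or> j = 1 \<or> j = 2 \<or> j = 3 \<or> j = 4 \<or> j = 5 \<or> j = 6 \<or> j = 7 \<or> j = 8"
  by auto

text \<open>Here \<open>X + \<i> X'\<close> plays the role of a complexified tangent vector: real vectors alone do not separate a form
  from its conjugate.\<close>

lemma coframe_values:
  assumes p: "p \<in> S"
  shows "\<exists>X X'. ptt X = 0 \<and> ptt X' = 0 \<and>
    (\<forall>y<9. (coframe F ! y) p X + \<i> * (coframe F ! y) p X' = v y)"
proof -
  \<comment> \<open>\<open>re\<close> and \<open>im\<close> distribute the independently prescribed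
    values of a form and of its conjugate over X and X'.\<close>
  define re where "re a b = (a + cnj b) / 2" for a b
  define im where "im a b = (a - cnj b) / (2 * \<i>)" for a b
  have ri: "re a b + \<i> * im a b = a" "cnj (re a b) + \<i> * cnj (im a b) = b" for a b
    by (simp_all add: re_def im_def field_simps)
  obtain X where X: "ptt X = 0" "rho F p X = complex_of_real (Re (v 0))" "kap F p X = re (v 1) (v 3)"
    "zet F p X = re (v 2) (v 4)" "alph p X = re (v 5) (v 7)" "bet p X = re (v 6) (v 8)"
    using coframe_surj[OF p] by blast
  obtain X' where X': "ptt X' = 0" "rho F p X' = complex_of_real (Im (v 0))" "kap F p X' = im (v 1) (v 3)"
    "zet F p X' = im (v 2) (v 4)" "alph p X' = im (v 5) (v 7)" "bet p X' = im (v 6) (v 8)"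
    using coframe_surj[OF p] by blast
  have "(coframe F ! y) p X + \<i> * (coframe F ! y) p X' = v y" if "y < 9" for y
    using that complex_eq[of "v 0", symmetric] unfolding less9
    by (elim disjE) (simp_all add: coframe_def cform_def X X' ri)
  then show ?thesis using X(1) X'(1) by blast
qed

text \<open>Uniqueness: the difference of two expansions, extended complex-bilinearly, is evaluated
  on vectors dual to two coframe members. Since vectors without t-component already realise these
  dual values, the restriction in \<open>coeff2\<close> costs nothing.\<close>

lemma coeff2_eqI:
  assumes p: "p \<in> S"
    and supp: "\<And>x y. c x y \<noteq> 0 \<Longrightarrow> x < y \<and> y < 9"
    and exp: "\<And>X Y. \<Omega> p X Y = (\<Sum>x<9. \<Sum>y<9. c x y * wedge (coframe F ! x) (coframe F ! y) p X Y)"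
  shows "coeff2 F \<Omega> p = c"
  unfolding coeff2_def
proof (rule the_equality)
  show "(\<forall>x y. c x y \<noteq> 0 \<longrightarrow> x < y \<and> y < 9) \<and> (\<forall>X Y. ptt X = 0 \<longrightarrow> ptt Y = 0 \<longrightarrow>
         \<Omega> p X Y = (\<Sum>x<9. \<Sum>y<9. c x y * wedge (coframe F ! x) (coframe F ! y) p X Y))"
    using supp exp by blast
next
  fix c' assume c': "(\<forall>x y. c' x y \<noteq> 0 \<longrightarrow> x < y \<and> y < 9) \<and> (\<forall>X Y. ptt X = 0 \<longrightarrow> ptt Y = 0 \<longrightarrow>
         \<Omega> p X Y = (\<Sum>x<9. \<Sum>y<9. c' x y * wedge (coframe F ! x) (coframe F ! y) p X Y))"
  let ?\<theta> = "\<lambda>x X. (coframe F ! x) p X"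
  define d where "d x y = c' x y - c x y" for x y
  have d0: "d x y = 0" if "\<not> (x < y \<and> y < 9)" for x y
  proof -
    have "c' x y = 0" using c' that by blast
    moreover have "c x y = 0" using supp that by blast
    ultimately show ?thesis by (simp add: d_def)
  qed
  define G where "G X Y = (\<Sum>x<9. \<Sum>y<9. d x y * (?\<theta> x X * ?\<theta> y Y - ?\<theta> x Y * ?\<theta> y X))" for X Y
  have G: "G X Y = 0" if "ptt X = 0" "ptt Y = 0" for X Y
  proof -
    have "(\<Sum>x<9. \<Sum>y<9. c' x y * wedge (coframe F ! x) (coframe F ! y) p X Y)
      = (\<Sum>x<9. \<Sum>y<9. c x y * wedge (coframe F ! x) (coframe F ! y) p X Y)"
      using c' that unfolding exp[symmetric] by simp
    then show ?thesis
      by (simp add: G_def d_def wedge_def left_diff_distrib sum_subtractf)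
  qed
  have "d a b = 0" if ab: "a < 9" "b < 9" "a < b" for a b
  proof -
    obtain X X' where X: "ptt X = 0" "ptt X' = 0"
      "\<And>y. y < 9 \<Longrightarrow> ?\<theta> y X + \<i> * ?\<theta> y X' = of_bool (y = a)"
      using coframe_values[OF p, of "\<lambda>y. of_bool (y = a)"] by blast
    obtain Y Y' where Y: "ptt Y = 0" "ptt Y' = 0"
      "\<And>y. y < 9 \<Longrightarrow> ?\<theta> y Y + \<i> * ?\<theta> y Y' = of_bool (y = b)"
      using coframe_values[OF p, of "\<lambda>y. of_bool (y = b)"] by blast
    \<comment> \<open>The left side is the bilinear extension of G at \<open>X + i X'\<close> and
      \<open>Y + i Y'\<close>; all its terms vanish, while the right side isolates one
      coefficient.\<close>
    have "G X Y + \<i> * G X' Y + \<i> * G X Y' - G X' Y'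
      = (\<Sum>x<9. \<Sum>y<9. d x y * ((?\<theta> x X + \<i> * ?\<theta> x X') * (?\<theta> y Y + \<i> * ?\<theta> y Y')
           - (?\<theta> x Y + \<i> * ?\<theta> x Y') * (?\<theta> y X + \<i> * ?\<theta> y X')))"
      unfolding G_def sum_distrib_left sum.distrib[symmetric] sum_subtractf[symmetric]
      by (intro sum.cong refl) (simp add: algebra_simps)
    also have "\<dots> = (\<Sum>x<9. \<Sum>y<9. d x y * (of_bool (x = a) * of_bool (y = b) - of_bool (x = b) * of_bool (y = a)))"
      by (intro sum.cong refl) (simp add: X(3) Y(3))
    also have "\<dots> = (\<Sum>x<9. \<Sum>y<9. (if x = a then (if y = b then d x y else 0) else 0))
        - (\<Sum>x<9. \<Sum>y<9. (if x = b then (if y = a then d x y else 0) else 0))"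
      unfolding sum_subtractf[symmetric] by (intro sum.cong refl) auto
    also have "(\<Sum>x<9. \<Sum>y<9. (if x = a then (if y = b then d x y else 0) else 0)) = d a b"
    proof -
      have "(\<Sum>y<9. (if x = a then (if y = b then d x y else 0) else 0)) = (if x = a then d x b else 0)" for x
        using ab by (simp add: sum.delta)
      then show ?thesis using ab by (simp add: sum.delta)
    qed
    also have "(\<Sum>x<9. \<Sum>y<9. (if x = b then (if y = a then d x y else 0) else 0)) = d b a"
    proof -
      have "(\<Sum>y<9. (if x = b then (if y = a then d x y else 0) else 0)) = (if x = b then d x a else 0)" for x
        using ab by (simp add: sum.delta)
      then show ?thesis using ab by (simp add: sum.delta)
    qed
    finally show ?thesis using G X Y d0[of b a] ab by simp
  qed
  then have "d x y = 0" for x y using d0[of x y] by (cases "x < y \<and> y < 9") auto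
  then show "c' = c" by (simp add: d_def fun_eq_iff)
qed

text \<open>A coefficient table that is zero off the listed pairs: the ten torsion positions and the
  seven positions at which \<alpha> (index 5), \<beta> (6) or conj \<alpha> (7) meets \<rho>,
  \<kappa> or \<zeta> in the structure equations.\<close>

definition tors :: "complex list \<Rightarrow> complex list \<Rightarrow> nat \<Rightarrow> nat \<Rightarrow> complex" where
  "tors a b x y = (case map_of (zip [(0,1),(0,2),(0,3),(0,4),(1,2),(1,3),(1,4),(2,3),(2,4),(3,4)] a
      @ zip [(0,5),(0,7),(0,6),(1,5),(2,5),(2,7),(1,6)] b) (x, y) of None \<Rightarrow> 0 | Some v \<Rightarrow> v)"

lemma coeff2_tors:
  assumes p: "p \<in> S"
    and exp: "\<And>X Y. \<Omega> p X Y =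
      a1 * wedge (rho F) (kap F) p X Y + a2 * wedge (rho F) (zet F) p X Y
      + a3 * wedge (rho F) (cform (kap F)) p X Y + a4 * wedge (rho F) (cform (zet F)) p X Y
      + a5 * wedge (kap F) (zet F) p X Y + a6 * wedge (kap F) (cform (kap F)) p X Y
      + a7 * wedge (kap F) (cform (zet F)) p X Y + a8 * wedge (zet F) (cform (kap F)) p X Y
      + a9 * wedge (zet F) (cform (zet F)) p X Y
      + a10 * wedge (cform (kap F)) (cform (zet F)) p X Y
      + b1 * wedge (rho F) alph p X Y + b2 * wedge (rho F) (cform alph) p X Y + b3 * wedge (rho F) bet p X Y
      + b4 * wedge (kap F) alph p X Y + b5 * wedge (zet F) alph p X Y + b6 * wedge (zet F) (cform alph) p X Y
      + b7 * wedge (kap F) bet p X Y"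
  shows "coeff2 F \<Omega> p = tors [a1, a2, a3, a4, a5, a6, a7, a8, a9, a10] [b1, b2, b3, b4, b5, b6, b7]"
proof (rule coeff2_eqI[OF p])
  show "x < y \<and> y < 9" if "tors [a1, a2, a3, a4, a5, a6, a7, a8, a9, a10] [b1, b2, b3, b4, b5, b6, b7] x y \<noteq> 0" for x y
    using that by (auto simp: tors_def split: if_splits)
  show "\<Omega> p X Y = (\<Sum>x<9. \<Sum>y<9. tors [a1, a2, a3, a4, a5, a6, a7, a8, a9, a10] [b1, b2, b3, b4, b5, b6, b7] x y
      * wedge (coframe F ! x) (coframe F ! y) p X Y)" for X Y
    unfolding exp by (simp add: tors_def numeral_eq_Suc lessThan_Suc coframe_def)
qed

text \<open>Absorption of torsion. The parameter t drops out: in d\<rho> it multiplies \<rho> ^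
  \<rho>, in d\<kappa> it cancels between \<pi>1 and \<pi>2, and likewise in d\<zeta>, where \<pi>1
  enters minus its conjugate. That difference also contributes \<open>i Im Z2\<close> to the
  coefficient of \<rho> ^ \<zeta>, so only the real part R remains.\<close>

lemma structure_equations:
  assumes p: "p \<in> S"
  shows "dform (rho F) p X Y
        = wedge (fplus (pi1 F) (cform (pi1 F))) (rho F) p X Y
          + \<i> * wedge (kap F) (cform (kap F)) p X Y
    \<and> dform (kap F) p X Y
        = wedge (pi2 F) (rho F) p X Y + wedge (pi1 F) (kap F) p X Y
          + wedge (zet F) (cform (kap F)) p X Y
    \<and> dform (zet F) p X Y
        = wedge (fminus (pi1 F) (cform (pi1 F))) (zet F) p X Y
          + \<i> * wedge (pi2 F) (kap F) p X Y
          + Rsc F p * wedge (rho F) (zet F) p X Y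
          + Jsc F p * wedge (rho F) (cform (kap F)) p X Y
          + Wsc F p * wedge (kap F) (zet F) p X Y"
proof -
  obtain R1 R2 K1 K2 K3 K4 K6 Z1 Z2 where Z2: "complex_of_real (Re Z2) = Rsc F p"
    and st: "\<And>X Y. dform (rho F) p X Y = wd X Y (alph p) (rho F p) + wd X Y (\<lambda>X. cnj (alph p X)) (rho F p)
         + R1 * wd X Y (rho F p) (kap F p) + R2 * wd X Y (rho F p) (zet F p)
         + cnj R1 * wd X Y (rho F p) (\<lambda>X. cnj (kap F p X)) + cnj R2 * wd X Y (rho F p) (\<lambda>X. cnj (zet F p X))
         + \<i> * wd X Y (kap F p) (\<lambda>X. cnj (kap F p X)) \<and>
      dform (kap F) p X Y = wd X Y (bet p) (rho F p) + wd X Y (alph p) (kap F p) + K1 * wd X Y (rho F p) (kap F p)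
         + K2 * wd X Y (rho F p) (zet F p) + K3 * wd X Y (rho F p) (\<lambda>X. cnj (kap F p X))
         + K4 * wd X Y (rho F p) (\<lambda>X. cnj (zet F p X)) + R2 * wd X Y (kap F p) (zet F p)
         + K6 * wd X Y (kap F p) (\<lambda>X. cnj (kap F p X)) + wd X Y (zet F p) (\<lambda>X. cnj (kap F p X)) \<and>
      dform (zet F) p X Y = wd X Y (alph p) (zet F p) - wd X Y (\<lambda>X. cnj (alph p X)) (zet F p)
         + \<i> * wd X Y (bet p) (kap F p) + Z1 * wd X Y (rho F p) (kap F p) + Z2 * wd X Y (rho F p) (zet F p)
         + Jsc F p * wd X Y (rho F p) (\<lambda>X. cnj (kap F p X))
         + (- R1 + 2 * cnj K6 + \<i> * K2 + Wsc F p) * wd X Y (kap F p) (zet F p)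
         + \<i> * K3 * wd X Y (kap F p) (\<lambda>X. cnj (kap F p X)) + \<i> * K4 * wd X Y (kap F p) (\<lambda>X. cnj (zet F p X))
         + (2 * K6 - cnj R1) * wd X Y (zet F p) (\<lambda>X. cnj (kap F p X))
         - cnj R2 * wd X Y (zet F p) (\<lambda>X. cnj (zet F p X))"
    using lifted_structure[OF p] by blast
  \<comment> \<open>The entries -1 come from the ordering: the coframe lists \<rho>, \<kappa>,
    \<zeta> before \<alpha> and \<beta>, while the equations have the latter as left
    factors.\<close>
  have R: "coeff2 F (dform (rho F)) p
      = tors [R1, R2, cnj R1, cnj R2, 0, \<i>, 0, 0, 0, 0] [-1, -1, 0, 0, 0, 0, 0]"
    by (rule coeff2_tors[OF p]) (simp add: st wedge_def cform_def)
  have K: "coeff2 F (dform (kap F)) p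
      = tors [K1, K2, K3, K4, R2, K6, 0, 1, 0, 0] [0, 0, -1, -1, 0, 0, 0]"
    by (rule coeff2_tors[OF p]) (simp add: st wedge_def cform_def)
  have Z: "coeff2 F (dform (zet F)) p
      = tors [Z1, Z2, Jsc F p, 0, - R1 + 2 * cnj K6 + \<i> * K2 + Wsc F p, \<i> * K3, \<i> * K4, 2 * K6 - cnj R1, - cnj R2, 0]
         [0, 0, 0, 0, -1, 1, - \<i>]"
    by (rule coeff2_tors[OF p]) (simp add: st wedge_def cform_def algebra_simps)
  have co: "Rc F 1 p = R1" "Rc F 2 p = R2" "Kc F 1 p = K1" "Kc F 2 p = K2" "Kc F 3 p = K3" "Kc F 4 p = K4"
      "Kc F 6 p = K6" "Zc F 1 p = Z1" "Zc F 2 p = Z2"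
    unfolding Rc_def Kc_def Zc_def R K Z by (simp_all add: omidx_def tors_def)
  have Z2': "Z2 = Rsc F p + \<i> * complex_of_real (Im Z2)"
    unfolding Z2[symmetric] by (rule complex_eq)
  have rr: "cnj (rho F p X) = rho F p X" for X by (simp add: rho_def rho0_real[OF p])
  define m where "m = complex_of_real (Im Z2)"
  define \<tau> where "\<tau> = complex_of_real (ptt p)"
  have cm: "cnj m = m" "cnj \<tau> = \<tau>" by (simp_all add: m_def \<tau>_def)
  have Z2m: "Z2 = Rsc F p + \<i> * m" using Z2' by (simp add: m_def)
  have p1: "pi1 F p X = alph p X - (\<tau> - (\<i>/2) * m) * rho F p X - (R1 - cnj K6) * kap F p X
      - R2 * zet F p X - K6 * cnj (kap F p X)" for X
    unfolding pi1_def co cform_def m_def \<tau>_def by simp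
  have p2: "pi2 F p X = bet p X - \<i> * Z1 * rho F p X - (\<tau> - (\<i>/2) * m + K1) * kap F p X
      - K2 * zet F p X - K3 * cnj (kap F p X) - K4 * cnj (zet F p X)" for X
    unfolding pi2_def co cform_def m_def \<tau>_def by simp
  have p1c: "cnj (pi1 F p X) = cnj (alph p X) - (\<tau> + (\<i>/2) * m) * rho F p X - (cnj R1 - K6) * cnj (kap F p X)
      - cnj R2 * cnj (zet F p X) - cnj K6 * kap F p X" for X
    unfolding p1 by (simp add: cm rr)
  have s1: "dform (rho F) p X Y = wedge (fplus (pi1 F) (cform (pi1 F))) (rho F) p X Y
          + \<i> * wedge (kap F) (cform (kap F)) p X Y"
    unfolding st[THEN conjunct1] wedge_def fplus_def cform_def p1c unfolding p1 by (simp add: algebra_simps)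
  have s2: "dform (kap F) p X Y = wedge (pi2 F) (rho F) p X Y + wedge (pi1 F) (kap F) p X Y
          + wedge (zet F) (cform (kap F)) p X Y"
    unfolding st[THEN conjunct2, THEN conjunct1] wedge_def cform_def p1 p2 by (simp add: algebra_simps)
  have s3: "dform (zet F) p X Y
        = wedge (fminus (pi1 F) (cform (pi1 F))) (zet F) p X Y
          + \<i> * wedge (pi2 F) (kap F) p X Y
          + Rsc F p * wedge (rho F) (zet F) p X Y
          + Jsc F p * wedge (rho F) (cform (kap F)) p X Y
          + Wsc F p * wedge (kap F) (zet F) p X Y"
    unfolding st[THEN conjunct2, THEN conjunct2] wedge_def fminus_def cform_def p1c unfolding p1 p2 Z2m
    by (simp add: algebra_simps)
  show ?thesis using s1 s2 s3 by blast
qed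

end

theorem theorem13p1:
  fixes U :: "(complex \<times> complex \<times> real) set"
    and F :: "complex \<times> complex \<times> real \<Rightarrow> real"
  assumes "open U"
    and "real_analytic_on U F"
    and "\<forall>p\<in>dom_MG U. ell F p \<noteq> 0"
    and "\<forall>p\<in>dom_MG U. levi_rank_one F p"
    and "\<forall>p\<in>dom_MG U. Lb1 F (kk F) p \<noteq> 0"
  shows "\<forall>p\<in>dom_MG U. \<forall>X Y.
      dform (rho F) p X Y
        = wedge (fplus (pi1 F) (cform (pi1 F))) (rho F) p X Y
          + \<i> * wedge (kap F) (cform (kap F)) p X Y
    \<and> dform (kap F) p X Y
        = wedge (pi2 F) (rho F) p X Y + wedge (pi1 F) (kap F) p X Y
          + wedge (zet F) (cform (kap F)) p X Y
    \<and> dform (zet F) p X Y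
        = wedge (fminus (pi1 F) (cform (pi1 F))) (zet F) p X Y
          + \<i> * wedge (pi2 F) (kap F) p X Y
          + Rsc F p * wedge (rho F) (zet F) p X Y
          + Jsc F p * wedge (rho F) (cform (kap F)) p X Y
          + Wsc F p * wedge (kap F) (zet F) p X Y"
proof -
  interpret cr_graph U F by unfold_locales (use assms in auto)
  show ?thesis using structure_equations by blast
qed

end
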